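(* Let $\alpha>-1$, let $m\in\mathbb{Z}_+$, and let $\tilde{\Delta}_\alpha$ be the partial differential operator $$\tilde{\Delta}_\alpha=-4(1-|z|^2)\left[(1-|z|^2)\frac{\partial^2}{\partial z\,\partial\overline{z}}-(\alpha+2)\overline{z}\frac{\partial}{\partial\overline{z}}\right]$$ acting on the Hilbert space $L^{2,\alpha}(\mathbb{D})=L^2(\mathbb{D},(1-|z|^2)^\alpha d\lambda(z))$ with the domain $$D(\tilde{\Delta}_\alpha)=\left\{F\in L^{2,\alpha}(\mathbb{D}):\ \tilde{\Delta}_\alpha F\in L^{2,\alpha}(\mathbb{D})\ \text{and}\ \frac{\partial^m F}{\partial z^m}\in L^{2,\alpha}(\mathbb{D})\right\}.$$ Then $$\mathcal{D}_m^\alpha=\{F\in D(\tilde{\Delta}_\alpha):\ \tilde{\Delta}_\alpha F=0\}.$$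
   Context: $\mathbb{Z}_+=\{0,1,2,\dots\}$, $\mathbb{D}$ is the open unit disk in $\mathbb{C}$, $d\lambda$ is Lebesgue area measure, and $\partial/\partial z$, $\partial/\partial\overline{z}$ are the Wirtinger derivatives, with derivatives of $L^{2,\alpha}$ functions taken in the sense of distributions. The generalized Bergman-Dirichlet space $\mathcal{D}_m^\alpha$ is the space of holomorphic functions $f$ on $\mathbb{D}$ whose $m$-th derivative satisfies $\int_{\mathbb{D}}|f^{(m)}(z)|^2(1-|z|^2)^\alpha\,d\lambda(z)<+\infty$. Elements of $L^{2,\alpha}$ are identified up to equality almost everywhere. *)

theory Defs
  imports "HOL-Analysis.Analysis"
begin

abbreviation unit_disk :: "complex set" where
  "unit_disk \<equiv> ball 0 1"

text \<open>Smoothness is meant in the real sense, for functions on the plane: all iterated directional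
  derivatives exist and are continuous.\<close>

primrec Ck_function :: "nat \<Rightarrow> (complex \<Rightarrow> complex) \<Rightarrow> bool" where
  "Ck_function 0 f \<longleftrightarrow> continuous_on UNIV f"
| "Ck_function (Suc k) f \<longleftrightarrow> (\<forall>z. f differentiable (at z)) \<and>
     (\<forall>v. Ck_function k (\<lambda>z. frechet_derivative f (at z) v))"

definition test_function :: "(complex \<Rightarrow> complex) \<Rightarrow> bool" where
  "test_function \<phi> \<longleftrightarrow> (\<forall>k. Ck_function k \<phi>) \<and>
     compact (closure {z. \<phi> z \<noteq> 0}) \<and> closure {z. \<phi> z \<noteq> 0} \<subseteq> unit_disk"

definition wirtinger_dz :: "(complex \<Rightarrow> complex) \<Rightarrow> complex \<Rightarrow> complex" where
  "wirtinger_dz \<phi> z = (frechet_derivative \<phi> (at z) 1 - \<i> * frechet_derivative \<phi> (at z) \<i>) / 2"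

definition wirtinger_dzbar :: "(complex \<Rightarrow> complex) \<Rightarrow> complex \<Rightarrow> complex" where
  "wirtinger_dzbar \<phi> z = (frechet_derivative \<phi> (at z) 1 + \<i> * frechet_derivative \<phi> (at z) \<i>) / 2"

text \<open>A distribution on the unit disk is represented by a functional of which only the values on
  test functions matter, so equality of distributions is \<open>distr_eq\<close> and not HOL equality.
  Linearity and continuity are not imposed by the type; all distributions below arise from a
  function by differentiation and by multiplication with polynomials in \<open>z\<close> and \<open>cnj z\<close>.\<close>

type_synonym distr = "(complex \<Rightarrow> complex) \<Rightarrow> complex"

definition distr_eq :: "distr \<Rightarrow> distr \<Rightarrow> bool" where
  "distr_eq S T \<longleftrightarrow> (\<forall>\<phi>. test_function \<phi> \<longrightarrow> S \<phi> = T \<phi>)"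

definition distr_of :: "(complex \<Rightarrow> complex) \<Rightarrow> distr" where
  "distr_of F = (\<lambda>\<phi>. LINT z|lebesgue_on unit_disk. F z * \<phi> z)"

definition distr_mult :: "(complex \<Rightarrow> complex) \<Rightarrow> distr \<Rightarrow> distr" where
  "distr_mult a T = (\<lambda>\<phi>. T (\<lambda>z. a z * \<phi> z))"

definition distr_diff :: "distr \<Rightarrow> distr \<Rightarrow> distr" where
  "distr_diff S T = (\<lambda>\<phi>. S \<phi> - T \<phi>)"

definition distr_dz :: "distr \<Rightarrow> distr" where
  "distr_dz T = (\<lambda>\<phi>. - T (wirtinger_dz \<phi>))"

definition distr_dzbar :: "distr \<Rightarrow> distr" where
  "distr_dzbar T = (\<lambda>\<phi>. - T (wirtinger_dzbar \<phi>))"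

definition Delta_op :: "real \<Rightarrow> distr \<Rightarrow> distr" where
  "Delta_op \<alpha> T =
     distr_mult (\<lambda>z. - 4 * complex_of_real (1 - (cmod z)\<^sup>2))
       (distr_diff
         (distr_mult (\<lambda>z. complex_of_real (1 - (cmod z)\<^sup>2)) (distr_dz (distr_dzbar T)))
         (distr_mult (\<lambda>z. complex_of_real (\<alpha> + 2) * cnj z) (distr_dzbar T)))"

text \<open>Elements of the weighted space are represented by functions on \<open>complex\<close> whose values outside
  the disk are irrelevant. The identification of functions agreeing almost everywhere on the disk
  is made by passing to the quotient by \<open>ae_eq\<close>.\<close>

definition L2_weighted :: "real \<Rightarrow> (complex \<Rightarrow> complex) set" where
  "L2_weighted \<alpha> = {F. F \<in> borel_measurable (lebesgue_on unit_disk) \<and>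
     (\<integral>\<^sup>+ z. ennreal ((cmod (F z))\<^sup>2 * (1 - (cmod z)\<^sup>2) powr \<alpha>) \<partial>lebesgue_on unit_disk) < \<infinity>}"

definition ae_eq :: "((complex \<Rightarrow> complex) \<times> (complex \<Rightarrow> complex)) set" where
  "ae_eq = {(F, G). F \<in> borel_measurable (lebesgue_on unit_disk) \<and>
     G \<in> borel_measurable (lebesgue_on unit_disk) \<and> (AE z in lebesgue_on unit_disk. F z = G z)}"

lemma equiv_ae_eq: "equiv (borel_measurable (lebesgue_on unit_disk)) ae_eq"
proof (rule equivI)
  show "ae_eq \<subseteq> borel_measurable (lebesgue_on unit_disk) \<times> borel_measurable (lebesgue_on unit_disk)"
    by (auto simp: ae_eq_def)
  show "refl_on (borel_measurable (lebesgue_on unit_disk)) ae_eq"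
    by (auto simp: refl_on_def ae_eq_def)
  show "sym ae_eq"
    by (auto simp: sym_def ae_eq_def)
  show "trans ae_eq"
    by (auto simp: trans_def ae_eq_def)
qed

definition distr_in_L2 :: "real \<Rightarrow> distr \<Rightarrow> bool" where
  "distr_in_L2 \<alpha> T \<longleftrightarrow> (\<exists>G \<in> L2_weighted \<alpha>. distr_eq T (distr_of G))"

definition Delta_domain :: "real \<Rightarrow> nat \<Rightarrow> (complex \<Rightarrow> complex) set" where
  "Delta_domain \<alpha> m = {F \<in> L2_weighted \<alpha>.
     distr_in_L2 \<alpha> (Delta_op \<alpha> (distr_of F)) \<and>
     distr_in_L2 \<alpha> ((distr_dz ^^ m) (distr_of F))}"

definition bergman_dirichlet :: "real \<Rightarrow> nat \<Rightarrow> (complex \<Rightarrow> complex) set" where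
  "bergman_dirichlet \<alpha> m = {f. f holomorphic_on unit_disk \<and>
     (\<integral>\<^sup>+ z. ennreal ((cmod ((deriv ^^ m) f z))\<^sup>2 * (1 - (cmod z)\<^sup>2) powr \<alpha>)
        \<partial>lebesgue_on unit_disk) < \<infinity>}"

end

(* Write x = 1 - |z|^2. Testing the equation against x^alpha z^a cnj(z)^b, cut off near the boundary
   (where alpha > -1 makes the error terms vanish in the limit), yields a two-term recursion for the
   moments M(a,b) of F z^a cnj(z)^b x^(alpha+1): moments with a > b vanish, and those with a <= b are
   determined by M(0,b-a). The same recursion for F = 1 shows that F has exactly the moments of the
   power series f with coefficients M(0,j)/||z^j||^2, which is square integrable with weight
   x^(alpha+1) by Bessel and Fatou. Polynomials in z and cnj(z) being dense, F = f almost everywhere. *)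
theory Submission
  imports Defs "HOL-Complex_Analysis.Complex_Analysis"
begin

section \<open>Wirtinger derivatives and test functions\<close>

text \<open>In divergence form the operator is -4 x^(-\<alpha>) d/dz (x^(\<alpha>+2) d/dzbar). Hence
  the factor x^\<alpha> in the test functions: the first-order term cancels, leaving the integral of
  F against d/dzbar (x^(\<alpha>+2) d/dz psi) with psi a polynomial. Here only d/dzbar hits the
  weight, which produces x^(\<alpha>+1). The obstacle is that these functions lack compact support.
  Two derivatives of a cutoff at depth x ~ \<epsilon> cost x^(-2), just what x^(\<alpha>+2) can pay;
  the errors are dominated by |F| x^\<alpha>, which is integrable since \<alpha> > -1 makes
  x^\<alpha> integrable. Using F = 1 in the recursion spares the evaluation of Beta integrals. In
  the opposite inclusion a holomorphic f is annihilated at once; the work is to show that f lies in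
  L^(2,\<alpha>) when only its m-th derivative is known to, by a Hardy-type inequality applied m
  times. The condition on the m-th derivative of F passes to f because distributional and classical
  derivatives of f agree.\<close>

definition has_wirtinger :: "(complex \<Rightarrow> complex) \<Rightarrow> complex \<Rightarrow> complex \<Rightarrow> complex \<Rightarrow> bool" where
  "has_wirtinger f p q z \<longleftrightarrow> (f has_derivative (\<lambda>v. p * v + q * cnj v)) (at z)"

lemma has_wirtinger_imp:
  assumes "has_wirtinger f p q z"
  shows "f differentiable at z" "frechet_derivative f (at z) = (\<lambda>v. p * v + q * cnj v)"
    "wirtinger_dz f z = p" "wirtinger_dzbar f z = q"
proof -
  have d: "(f has_derivative (\<lambda>v. p * v + q * cnj v)) (at z)"
    using assms by (simp add: has_wirtinger_def)
  show "f differentiable at z" using d by (auto simp: differentiable_def)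
  show e: "frechet_derivative f (at z) = (\<lambda>v. p * v + q * cnj v)"
    using frechet_derivative_at[OF d] by simp
  show "wirtinger_dz f z = p" "wirtinger_dzbar f z = q"
    by (simp_all add: wirtinger_dz_def wirtinger_dzbar_def e complex_eq_iff)
qed

text \<open>A real-linear map of the plane is determined by its values at 1 and i, and p and q in v
  -> p v + q cnj v encode these two values.\<close>

lemma differentiable_imp_has_wirtinger:
  assumes "f differentiable at z"
  shows "has_wirtinger f (wirtinger_dz f z) (wirtinger_dzbar f z) z"
proof -
  let ?D = "frechet_derivative f (at z)"
  have d: "(f has_derivative ?D) (at z)"
    using assms frechet_derivative_works by blast
  then have l: "bounded_linear ?D" by (rule has_derivative_bounded_linear)
  have "?D v = wirtinger_dz f z * v + wirtinger_dzbar f z * cnj v" for v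
  proof -
    have "v = Re v *\<^sub>R 1 + Im v *\<^sub>R \<i>"
      by (simp add: complex_eq_iff)
    then have "?D v = ?D (Re v *\<^sub>R 1 + Im v *\<^sub>R \<i>)"
      by (rule arg_cong)
    also have "\<dots> = Re v *\<^sub>R ?D 1 + Im v *\<^sub>R ?D \<i>"
      by (simp add: linear_add[OF bounded_linear.linear[OF l]] linear_scale[OF bounded_linear.linear[OF l]])
    also have "\<dots> = wirtinger_dz f z * v + wirtinger_dzbar f z * cnj v"
      by (simp add: wirtinger_dz_def wirtinger_dzbar_def complex_eq_iff field_simps)
    finally show ?thesis .
  qed
  then have "?D = (\<lambda>v. wirtinger_dz f z * v + wirtinger_dzbar f z * cnj v)"
    by (rule ext)
  then show ?thesis
    using d by (simp add: has_wirtinger_def)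
qed

lemma has_wirtinger_transform:
  "(f has_derivative f') (at z) \<Longrightarrow> (\<And>v. f' v = p * v + q * cnj v) \<Longrightarrow> has_wirtinger f p q z"
  unfolding has_wirtinger_def by (erule has_derivative_eq_rhs) (rule ext)

lemma has_wirtinger_add:
  assumes "has_wirtinger f p q z" "has_wirtinger g p' q' z"
  shows "has_wirtinger (\<lambda>z. f z + g z) (p + p') (q + q') z"
  by (rule has_wirtinger_transform[OF has_derivative_add[OF assms[unfolded has_wirtinger_def]]])
    (simp add: algebra_simps)

lemma has_wirtinger_mult:
  assumes "has_wirtinger f p q z" "has_wirtinger g p' q' z"
  shows "has_wirtinger (\<lambda>z. f z * g z) (p * g z + f z * p') (q * g z + f z * q') z"
  by (rule has_wirtinger_transform[OF has_derivative_mult[OF assms[unfolded has_wirtinger_def]]])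
    (simp add: algebra_simps)

lemma has_wirtinger_const: "has_wirtinger (\<lambda>z. c) 0 0 z"
  by (simp add: has_wirtinger_def)

lemma has_wirtinger_id: "has_wirtinger (\<lambda>z. z) 1 0 z"
  by (simp add: has_wirtinger_def)

lemma has_wirtinger_cnj: "has_wirtinger cnj 0 1 z"
  by (simp add: has_wirtinger_def bounded_linear_imp_has_derivative bounded_linear_cnj)

lemma has_wirtinger_field_derivative:
  "(f has_field_derivative p) (at z) \<Longrightarrow> has_wirtinger f p 0 z"
  unfolding has_field_derivative_def by (erule has_wirtinger_transform) simp

lemma has_wirtinger_cnj_comp:
  assumes "has_wirtinger f p q z"
  shows "has_wirtinger (\<lambda>z. cnj (f z)) (cnj q) (cnj p) z"
proof -
  have "((\<lambda>z. cnj (f z)) has_derivative (\<lambda>v. cnj (p * v + q * cnj v))) (at z)"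
    using assms unfolding has_wirtinger_def
    by (rule bounded_linear.has_derivative[OF bounded_linear_cnj])
  then show ?thesis
    by (simp add: has_wirtinger_def add.commute)
qed

lemma has_wirtinger_monomial:
  "has_wirtinger (\<lambda>z. z ^ a * cnj z ^ b)
     (of_nat a * z ^ (a - 1) * cnj z ^ b) (of_nat b * z ^ a * cnj z ^ (b - 1)) z"
proof -
  have pow: "has_wirtinger (\<lambda>z. z ^ n) (of_nat n * z ^ (n - 1)) 0 z" for n
    using DERIV_power[OF DERIV_ident, of n z] by (intro has_wirtinger_field_derivative) simp
  have "has_wirtinger (\<lambda>z. cnj z ^ b) 0 (of_nat b * cnj z ^ (b - 1)) z"
    using has_wirtinger_cnj_comp[OF pow[of b]] by simp
  from has_wirtinger_mult[OF pow[of a] this] show ?thesis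
    by (simp add: mult_ac)
qed

text \<open>Serves points off a compact support, where derivatives must be known to vanish.\<close>

lemma has_wirtinger_eventually_eq_0:
  assumes "open S" "z \<in> S" "\<And>w. w \<in> S \<Longrightarrow> f w = 0"
  shows "has_wirtinger f 0 0 z"
proof -
  have "((\<lambda>_. 0) has_derivative (\<lambda>v. 0 * v + 0 * cnj v)) (at z)" by simp
  then show ?thesis unfolding has_wirtinger_def
    by (rule has_derivative_transform_within_open[OF _ assms(1,2)]) (simp add: assms(3))
qed

section \<open>Closure properties of smooth functions on the plane\<close>

lemma Ck_function_Suc_imp: "Ck_function (Suc k) f \<Longrightarrow> Ck_function k f"
proof (induction k arbitrary: f)
  case 0
  then show ?case
    by (auto simp: continuous_on_eq_continuous_at differentiable_imp_continuous_within)
next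
  case (Suc k)
  then show ?case by (metis Ck_function.simps(2))
qed

lemma Ck_function_const: "Ck_function k (\<lambda>z. c)"
  by (induction k arbitrary: c) auto

lemma Ck_function_SucI:
  assumes "\<And>z. (f has_derivative f' z) (at z)" "\<And>v. Ck_function k (\<lambda>z. f' z v)"
  shows "Ck_function (Suc k) f"
proof -
  have "frechet_derivative f (at z) = f' z" for z
    using frechet_derivative_at[OF assms(1)] by simp
  then show ?thesis
    using assms by (auto simp: differentiable_def)
qed

lemma Ck_function_SucD:
  assumes "Ck_function (Suc k) f"
  shows "(f has_derivative frechet_derivative f (at z)) (at z)"
    "Ck_function k (\<lambda>z. frechet_derivative f (at z) v)"
  using assms by (simp_all flip: frechet_derivative_works)

lemma Ck_function_add:
  "Ck_function k f \<Longrightarrow> Ck_function k g \<Longrightarrow> Ck_function k (\<lambda>z. f z + g z)"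
proof (induction k arbitrary: f g)
  case 0
  then show ?case by (auto intro: continuous_on_add)
next
  case (Suc k)
  note d = Ck_function_SucD[OF Suc.prems(1)] Ck_function_SucD[OF Suc.prems(2)]
  show ?case
    by (rule Ck_function_SucI[OF has_derivative_add[OF d(1,3)]]) (rule Suc.IH[OF d(2,4)])
qed

lemma Ck_function_mult:
  "Ck_function k f \<Longrightarrow> Ck_function k g \<Longrightarrow> Ck_function k (\<lambda>z. f z * g z)"
proof (induction k arbitrary: f g)
  case 0
  then show ?case by (auto intro: continuous_on_mult)
next
  case (Suc k)
  note d = Ck_function_SucD[OF Suc.prems(1)] Ck_function_SucD[OF Suc.prems(2)]
  show ?case
    by (rule Ck_function_SucI[OF has_derivative_mult[OF d(1,3)]])
      (intro Ck_function_add Suc.IH d(2,4) Suc.prems[THEN Ck_function_Suc_imp])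
qed

text \<open>The derivative in direction v is p v + q cnj v with v constant in z. Smoothness of all
  directional derivatives thus follows from that of just two functions.\<close>

lemma Ck_function_wirtingerI:
  assumes "\<And>z. has_wirtinger f (p z) (q z) z" "Ck_function k p" "Ck_function k q"
  shows "Ck_function (Suc k) f"
  using assms(2,3) has_wirtinger_imp[OF assms(1)]
  by (auto intro!: Ck_function_add Ck_function_mult Ck_function_const)

lemma Ck_function_id: "Ck_function k (\<lambda>z. z)"
  by (cases k) (auto simp del: Ck_function.simps(2)
      intro: Ck_function_wirtingerI[OF has_wirtinger_id] Ck_function_const)

lemma Ck_function_cnj: "Ck_function k cnj"
  by (cases k) (auto simp del: Ck_function.simps(2)
      intro: Ck_function_wirtingerI[OF has_wirtinger_cnj] Ck_function_const continuous_intros)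

lemma Ck_function_power:
  assumes "Ck_function k f"
  shows "Ck_function k (\<lambda>z. f z ^ n)"
proof (induction n)
  case 0
  show ?case by (simp only: power_0 Ck_function_const)
next
  case (Suc n)
  show ?case unfolding power_Suc by (rule Ck_function_mult[OF assms Suc.IH])
qed

lemma of_real_weight: "complex_of_real (1 - (cmod z)\<^sup>2) = 1 - z * cnj z"
  by (simp only: of_real_diff complex_norm_square of_real_1)

lemma Ck_function_weight: "Ck_function k (\<lambda>z. complex_of_real (1 - (cmod z)\<^sup>2))"
proof -
  have "Ck_function k (\<lambda>z. 1 + (-1) * (z * cnj z))"
    by (intro Ck_function_add Ck_function_mult Ck_function_const Ck_function_id Ck_function_cnj)
  moreover have "1 + (-1) * (z * cnj z) = complex_of_real (1 - (cmod z)\<^sup>2)" for z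
    by (simp only: of_real_weight) simp
  ultimately show ?thesis by (simp only:)
qed

lemma Ck_function_wirtinger_dz:
  assumes "Ck_function (Suc k) f" shows "Ck_function k (wirtinger_dz f)"
proof -
  have "Ck_function k (\<lambda>z. (frechet_derivative f (at z) 1 + (-\<i>) * frechet_derivative f (at z) \<i>) * (1/2))"
    using assms by (intro Ck_function_mult Ck_function_add Ck_function_const) auto
  then show ?thesis by (simp add: wirtinger_dz_def[abs_def])
qed

lemma Ck_function_wirtinger_dzbar:
  assumes "Ck_function (Suc k) f" shows "Ck_function k (wirtinger_dzbar f)"
proof -
  have "Ck_function k (\<lambda>z. (frechet_derivative f (at z) 1 + \<i> * frechet_derivative f (at z) \<i>) * (1/2))"
    using assms by (intro Ck_function_mult Ck_function_add Ck_function_const) auto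
  then show ?thesis by (simp add: wirtinger_dzbar_def[abs_def])
qed

section \<open>Test functions on the disk\<close>

lemma test_functionI:
  assumes "\<And>k. Ck_function k f" "closed K" "K \<subseteq> unit_disk" "\<And>z. z \<notin> K \<Longrightarrow> f z = 0"
  shows "test_function f"
proof -
  have "{z. f z \<noteq> 0} \<subseteq> K" using assms(4) by auto
  then have "closure {z. f z \<noteq> 0} \<subseteq> K" using assms(2) by (rule closure_minimal)
  moreover have "bounded K" using assms(3) bounded_subset bounded_ball by blast
  ultimately show ?thesis
    using assms(1,3) by (auto simp: test_function_def compact_eq_bounded_closed intro: bounded_subset)
qed

lemma test_function_Ck: "test_function f \<Longrightarrow> Ck_function k f"
  by (simp add: test_function_def)

lemma test_function_mult:
  assumes "test_function f" "\<And>k. Ck_function k g"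
  shows "test_function (\<lambda>z. g z * f z)"
proof (rule test_functionI)
  show "closed (closure {z. f z \<noteq> 0})" by simp
  show "closure {z. f z \<noteq> 0} \<subseteq> unit_disk"
    using assms(1) by (simp add: test_function_def)
  show "g z * f z = 0" if "z \<notin> closure {z. f z \<noteq> 0}" for z
    using that closure_subset[of "{z. f z \<noteq> 0}"] by auto
qed (intro Ck_function_mult assms test_function_Ck)

lemma test_function_has_wirtinger:
  assumes "test_function f"
  shows "has_wirtinger f (wirtinger_dz f z) (wirtinger_dzbar f z) z"
  using test_function_Ck[OF assms, of 1] by (auto intro: differentiable_imp_has_wirtinger)

lemma test_function_eq_0:
  assumes "test_function f" "z \<notin> closure {z. f z \<noteq> 0}"
  shows "f z = 0" "wirtinger_dz f z = 0" "wirtinger_dzbar f z = 0"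
proof -
  let ?K = "closure {z. f z \<noteq> 0}"
  have *: "f w = 0" if "w \<in> - ?K" for w
    using that closure_subset[of "{z. f z \<noteq> 0}"] by blast
  have z: "z \<in> - ?K" using assms(2) by blast
  then show "f z = 0" by (rule *)
  have "open (- ?K)" by (rule open_Compl) simp
  then have "has_wirtinger f 0 0 z"
    by (rule has_wirtinger_eventually_eq_0[OF _ z *])
  then show "wirtinger_dz f z = 0" "wirtinger_dzbar f z = 0"
    by (rule has_wirtinger_imp)+
qed

text \<open>Needed to iterate distributional derivatives, which feed the derivative of a test
  function back into a functional.\<close>

lemma test_function_wirtinger:
  assumes "test_function f"
  shows "test_function (wirtinger_dz f)" "test_function (wirtinger_dzbar f)"
proof -
  let ?K = "closure {z. f z \<noteq> 0}"
  have K: "closed ?K" "?K \<subseteq> unit_disk"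
    using assms by (auto simp: test_function_def)
  show "test_function (wirtinger_dz f)"
    by (rule test_functionI[OF Ck_function_wirtinger_dz[OF test_function_Ck[OF assms]] K])
      (rule test_function_eq_0[OF assms])
  show "test_function (wirtinger_dzbar f)"
    by (rule test_functionI[OF Ck_function_wirtinger_dzbar[OF test_function_Ck[OF assms]] K])
      (rule test_function_eq_0[OF assms])
qed

section \<open>Smooth radial cutoffs\<close>

text \<open>The factor \<open>exp (- \<epsilon> / (x - \<epsilon>))\<close> is flat at \<open>x = \<epsilon>\<close>; the powers of \<open>1 / (x - \<epsilon>)\<close> make the
  family closed under differentiation, which gives smoothness by induction.\<close>

definition bump :: "real \<Rightarrow> real \<Rightarrow> nat \<Rightarrow> real \<Rightarrow> real" where
  "bump \<epsilon> \<beta> n x = (if x > \<epsilon> then x powr \<beta> * (1 / (x - \<epsilon>)) ^ n * exp (- \<epsilon> / (x - \<epsilon>)) else 0)"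

text \<open>The product rule with Y = 1/(x - \<epsilon>), for which Y' = -Y^2: differentiating Y^n
  gives -n Y^(n+1), and differentiating exp(-\<epsilon> Y) gives the factor \<epsilon> Y^2. The
  formula also fits x \<le> \<epsilon>, where every term is 0.\<close>

definition bump_deriv :: "real \<Rightarrow> real \<Rightarrow> nat \<Rightarrow> real \<Rightarrow> real" where
  "bump_deriv \<epsilon> \<beta> n x =
     \<beta> * bump \<epsilon> (\<beta> - 1) n x - real n * bump \<epsilon> \<beta> (n + 1) x + \<epsilon> * bump \<epsilon> \<beta> (n + 2) x"

lemma bump_nonneg: "bump \<epsilon> \<beta> n x \<ge> 0"
  by (simp add: bump_def)

text \<open>The exponential beats every power of y = 1/(x - \<epsilon>). The restriction to distance
  less than \<epsilon> keeps x in (0, 2 \<epsilon>), which bounds x powr \<beta> above \<epsilon>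
  for either sign of \<beta>.\<close>

lemma bump_quadratic_bound:
  assumes "\<epsilon> > 0"
  obtains C where "\<And>x. \<bar>x - \<epsilon>\<bar> < \<epsilon> \<Longrightarrow> \<bar>bump \<epsilon> \<beta> n x\<bar> \<le> C * (x - \<epsilon>)\<^sup>2"
proof
  \<comment> \<open>The exponential absorbs m powers of y: n of them occur in \<open>bump\<close>,
    and the other two are left over as (x - \<epsilon>)^2.\<close>
  define m where "m = n + 2"
  fix x :: real assume x: "\<bar>x - \<epsilon>\<bar> < \<epsilon>"
  show "\<bar>bump \<epsilon> \<beta> n x\<bar> \<le> ((\<epsilon> powr \<beta> + (2 * \<epsilon>) powr \<beta>) * (real m / \<epsilon>) ^ m) * (x - \<epsilon>)\<^sup>2"
  proof (cases "x > \<epsilon>")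
    case True
    define y where "y = 1 / (x - \<epsilon>)"
    have y: "y > 0" using True by (simp add: y_def)
    have "x powr \<beta> \<le> \<epsilon> powr \<beta> + (2 * \<epsilon>) powr \<beta>"
    proof (cases "\<beta> \<ge> 0")
      case True
      have "x powr \<beta> \<le> (2 * \<epsilon>) powr \<beta>"
        using x assms True by (intro powr_mono2) auto
      then show ?thesis by (simp add: add_increasing)
    next
      case False
      have "x powr \<beta> \<le> \<epsilon> powr \<beta>"
        using assms False \<open>x > \<epsilon>\<close> by (intro powr_mono2') auto
      then show ?thesis by (simp add: add_increasing2)
    qed
    moreover have "y ^ n * exp (- \<epsilon> * y) \<le> (real m / \<epsilon>) ^ m * (x - \<epsilon>)\<^sup>2"
    proof -
      have "(\<epsilon> * y / real m) ^ m \<le> (1 + \<epsilon> * y / real m) ^ m"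
        using y assms by (intro power_mono) auto
      also have "\<dots> \<le> exp (\<epsilon> * y)"
        using y assms mult_pos_pos[OF assms y]
        by (intro exp_ge_one_plus_x_over_n_power_n) (auto simp: m_def intro: order_trans[of _ 0])
      finally have "(\<epsilon> * y / real m) ^ m * exp (- \<epsilon> * y) \<le> exp (\<epsilon> * y) * exp (- \<epsilon> * y)"
        by (rule mult_right_mono) simp
      then have "(\<epsilon> * y / real m) ^ m * exp (- \<epsilon> * y) \<le> 1"
        by (simp flip: exp_add)
      then have "(real m / \<epsilon>) ^ m * ((\<epsilon> * y / real m) ^ m * exp (- \<epsilon> * y)) \<le> (real m / \<epsilon>) ^ m * 1"
        using assms by (intro mult_left_mono) auto
      also have "(real m / \<epsilon>) ^ m * ((\<epsilon> * y / real m) ^ m * exp (- \<epsilon> * y)) = y ^ m * exp (- \<epsilon> * y)"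
      proof -
        have "real m / \<epsilon> * (\<epsilon> * y / real m) = y"
          using assms by (simp add: m_def)
        then show ?thesis by (metis mult.assoc power_mult_distrib)
      qed
      finally have "y ^ n * exp (- \<epsilon> * y) * y\<^sup>2 \<le> (real m / \<epsilon>) ^ m"
        unfolding m_def by (simp only: power_add mult_ac)
      then show ?thesis
        using True by (simp add: y_def field_simps)
    qed
    ultimately have "x powr \<beta> * (y ^ n * exp (- \<epsilon> * y)) \<le>
        (\<epsilon> powr \<beta> + (2 * \<epsilon>) powr \<beta>) * ((real m / \<epsilon>) ^ m * (x - \<epsilon>)\<^sup>2)"
      using y by (rule_tac mult_mono) auto
    then show ?thesis
      using True bump_nonneg[of \<epsilon> \<beta> n x] by (simp add: bump_def y_def mult.assoc)
  next
    case False
    then show ?thesis using assms by (simp add: bump_def)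
  qed
qed

text \<open>Away from x = \<epsilon> this is calculus on an open half-line. At x = \<epsilon> the
  value and the claimed derivative are both 0, and the quadratic bound makes the difference quotient
  O(|h|).\<close>

lemma bump_has_derivative:
  assumes "\<epsilon> > 0"
  shows "(bump \<epsilon> \<beta> n has_real_derivative bump_deriv \<epsilon> \<beta> n x) (at x)"
proof -
  consider "x > \<epsilon>" | "x < \<epsilon>" | "x = \<epsilon>" by linarith
  then show ?thesis
  proof cases
    case 1
    define Y where "Y = (\<lambda>x. 1 / (x - \<epsilon>))"
    have Y: "(Y has_real_derivative - (Y x)\<^sup>2) (at x)"
      using 1 unfolding Y_def by (auto intro!: derivative_eq_intros simp: power2_eq_square)
    have pow: "((\<lambda>x. Y x ^ n) has_real_derivative - real n * Y x ^ (n + 1)) (at x)"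
      by (rule DERIV_cong[OF DERIV_power[OF Y, of n]]; cases n) (simp_all add: power2_eq_square algebra_simps)
    have exp: "((\<lambda>x. exp (- \<epsilon> * Y x)) has_real_derivative exp (- \<epsilon> * Y x) * (\<epsilon> * (Y x)\<^sup>2)) (at x)"
      by (rule derivative_eq_intros Y refl)+ simp
    have "((\<lambda>x. x powr \<beta>) has_real_derivative \<beta> * x powr (\<beta> - 1)) (at x)"
      using 1 assms by (intro has_real_derivative_powr) auto
    from DERIV_mult[OF DERIV_mult[OF this pow] exp]
    have "((\<lambda>x. x powr \<beta> * Y x ^ n * exp (- \<epsilon> * Y x)) has_real_derivative
        bump_deriv \<epsilon> \<beta> n x) (at x)"
      using 1 by (rule_tac DERIV_cong) (auto simp: bump_deriv_def bump_def Y_def power2_eq_square algebra_simps)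
    then show ?thesis
      by (rule has_field_derivative_transform_within_open[where S = "{\<epsilon><..}"])
        (use 1 in \<open>auto simp: bump_def Y_def\<close>)
  next
    case 2
    have "((\<lambda>_. 0) has_real_derivative bump_deriv \<epsilon> \<beta> n x) (at x)"
      using 2 by (simp add: bump_deriv_def bump_def)
    then show ?thesis
      by (rule has_field_derivative_transform_within_open[where S = "{..<\<epsilon>}"])
        (use 2 in \<open>auto simp: bump_def\<close>)
  next
    case 3
    obtain C where C: "\<And>x. \<bar>x - \<epsilon>\<bar> < \<epsilon> \<Longrightarrow> \<bar>bump \<epsilon> \<beta> n x\<bar> \<le> C * (x - \<epsilon>)\<^sup>2"
      using bump_quadratic_bound[OF assms] by metis
    have "((\<lambda>h. (bump \<epsilon> \<beta> n (\<epsilon> + h) - bump \<epsilon> \<beta> n \<epsilon>) / h) \<longlongrightarrow> 0) (at 0)"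
    proof (rule Lim_null_comparison)
      have "\<forall>\<^sub>F h in at 0. h \<noteq> 0 \<and> \<bar>h\<bar> < \<epsilon>"
        unfolding eventually_at using assms by (intro exI[of _ \<epsilon>]) auto
      then show "\<forall>\<^sub>F h in at 0. norm ((bump \<epsilon> \<beta> n (\<epsilon> + h) - bump \<epsilon> \<beta> n \<epsilon>) / h) \<le> C * \<bar>h\<bar>"
      proof eventually_elim
        case (elim h)
        have "\<bar>bump \<epsilon> \<beta> n (\<epsilon> + h)\<bar> \<le> C * \<bar>h\<bar> * \<bar>h\<bar>"
          using C[of "\<epsilon> + h"] elim by (simp add: power2_eq_square)
        then show ?case
          using elim by (simp add: bump_def[of \<epsilon> \<beta> n \<epsilon>] field_simps)
      qed
      show "((\<lambda>h. C * \<bar>h\<bar>) \<longlongrightarrow> 0) (at 0)"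
        by (auto intro!: tendsto_eq_intros)
    qed
    then show ?thesis
      using 3 by (simp add: DERIV_def bump_deriv_def bump_def[of _ _ _ \<epsilon>])
  qed
qed

definition cutoff :: "real \<Rightarrow> real \<Rightarrow> nat \<Rightarrow> complex \<Rightarrow> complex" where
  "cutoff \<epsilon> \<beta> n z = complex_of_real (bump \<epsilon> \<beta> n (1 - (cmod z)\<^sup>2))"

text \<open>This is \<open>bump_deriv\<close> at 1 - |z|^2, written as a combination of cutoffs so
  that a smoothness induction can apply to it again.\<close>

definition cutoff' :: "real \<Rightarrow> real \<Rightarrow> nat \<Rightarrow> complex \<Rightarrow> complex" where
  "cutoff' \<epsilon> \<beta> n z = complex_of_real \<beta> * cutoff \<epsilon> (\<beta> - 1) n z
     - of_nat n * cutoff \<epsilon> \<beta> (n + 1) z + complex_of_real \<epsilon> * cutoff \<epsilon> \<beta> (n + 2) z"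

text \<open>Chain rule for 1 - z cnj z, whose Wirtinger derivatives are -cnj z and -z.\<close>

lemma cutoff_has_wirtinger:
  assumes "\<epsilon> > 0"
  shows "has_wirtinger (cutoff \<epsilon> \<beta> n) (- cnj z * cutoff' \<epsilon> \<beta> n z) (- z * cutoff' \<epsilon> \<beta> n z) z"
proof -
  have "((\<lambda>z::complex. 1 - z \<bullet> z) has_derivative (\<lambda>v. - (z \<bullet> v + v \<bullet> z))) (at z)"
    by (auto intro!: derivative_eq_intros)
  then have "((\<lambda>z::complex. 1 - (cmod z)\<^sup>2) has_derivative (\<lambda>v. - (z \<bullet> v + v \<bullet> z))) (at z)"
    by (simp add: power2_norm_eq_inner)
  from DERIV_compose_FDERIV[OF bump_has_derivative[OF assms] this]
  have "((\<lambda>z. bump \<epsilon> \<beta> n (1 - (cmod z)\<^sup>2)) has_derivative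
      (\<lambda>v. - (z \<bullet> v + v \<bullet> z) * bump_deriv \<epsilon> \<beta> n (1 - (cmod z)\<^sup>2))) (at z)" .
  from bounded_linear.has_derivative[OF bounded_linear_of_real this]
  have d: "(cutoff \<epsilon> \<beta> n has_derivative
      (\<lambda>v. complex_of_real (- (z \<bullet> v + v \<bullet> z) * bump_deriv \<epsilon> \<beta> n (1 - (cmod z)\<^sup>2)))) (at z)"
    by (simp add: cutoff_def[abs_def])
  have c: "cutoff' \<epsilon> \<beta> n z = complex_of_real (bump_deriv \<epsilon> \<beta> n (1 - (cmod z)\<^sup>2))"
    by (simp add: cutoff'_def bump_deriv_def cutoff_def)
  show ?thesis
    by (rule has_wirtinger_transform[OF d]) (simp add: c complex_eq_iff inner_complex_def algebra_simps)
qed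

text \<open>Differentiation lowers \<beta> by one or raises n by one or two, so the induction over k
  has to range over all \<beta> and n at once.\<close>

lemma Ck_function_cutoff:
  assumes "\<epsilon> > 0" shows "Ck_function k (cutoff \<epsilon> \<beta> n)"
proof (induction k arbitrary: \<beta> n)
  case 0
  have "isCont (cutoff \<epsilon> \<beta> n) z" for z
    using has_wirtinger_imp(1)[OF cutoff_has_wirtinger[OF assms]]
    by (rule differentiable_imp_continuous_within)
  then show ?case by (simp add: continuous_on_eq_continuous_at)
next
  case (Suc k)
  have c: "Ck_function k (\<lambda>z. complex_of_real \<beta> * cutoff \<epsilon> (\<beta> - 1) n z
     + (- of_nat n) * cutoff \<epsilon> \<beta> (n + 1) z + complex_of_real \<epsilon> * cutoff \<epsilon> \<beta> (n + 2) z)"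
    by (intro Ck_function_add Ck_function_mult Ck_function_const Suc.IH)
  have e: "(\<lambda>z. complex_of_real \<beta> * cutoff \<epsilon> (\<beta> - 1) n z
     + (- of_nat n) * cutoff \<epsilon> \<beta> (n + 1) z + complex_of_real \<epsilon> * cutoff \<epsilon> \<beta> (n + 2) z)
     = cutoff' \<epsilon> \<beta> n"
    by (simp add: cutoff'_def fun_eq_iff)
  have "Ck_function k (\<lambda>z. (-1) * cnj z * cutoff' \<epsilon> \<beta> n z)" "Ck_function k (\<lambda>z. (-1) * z * cutoff' \<epsilon> \<beta> n z)"
    by (intro Ck_function_mult Ck_function_const Ck_function_cnj Ck_function_id c[unfolded e])+
  then show ?case
    by (intro Ck_function_wirtingerI[OF cutoff_has_wirtinger[OF assms]]) (simp_all only: mult_minus1)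
qed

lemma Ck_function_monomial: "Ck_function k (\<lambda>z. z ^ a * cnj z ^ b)"
  by (intro Ck_function_mult Ck_function_power Ck_function_id Ck_function_cnj)

lemma test_function_cutoff:
  assumes "\<epsilon> > 0" shows "test_function (cutoff \<epsilon> \<beta> n)"
proof (rule test_functionI[OF Ck_function_cutoff[OF assms]])
  have "closed ((\<lambda>z::complex. 1 - (cmod z)\<^sup>2) -` {\<epsilon>..})"
    by (intro closed_vimage continuous_intros)
  then show "closed {z::complex. 1 - (cmod z)\<^sup>2 \<ge> \<epsilon>}"
    by (simp add: vimage_def)
  show "{z::complex. 1 - (cmod z)\<^sup>2 \<ge> \<epsilon>} \<subseteq> unit_disk"
  proof
    fix z :: complex assume "z \<in> {z. 1 - (cmod z)\<^sup>2 \<ge> \<epsilon>}"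
    then have "(cmod z)\<^sup>2 < 1\<^sup>2" using assms by auto
    then show "z \<in> unit_disk" by (simp add: power2_less_imp_less)
  qed
qed (auto simp: cutoff_def bump_def)

lemma cutoff_mult_weight:
  "complex_of_real (1 - (cmod z)\<^sup>2) * cutoff \<epsilon> \<beta> n z = cutoff \<epsilon> (\<beta> + 1) n z" if "\<epsilon> > 0"
  using that by (simp add: cutoff_def bump_def powr_add)

section \<open>Integration by parts on the disk\<close>

text \<open>Translation invariance of Lebesgue measure makes the integral of every difference
  quotient of g along v vanish. The quotients converge to the directional derivative, and dominated
  convergence carries the value 0 to the limit.\<close>

lemma integral_directional_derivative_eq_0:
  fixes g :: "complex \<Rightarrow> complex"
  assumes der: "\<And>z. (g has_derivative g' z) (at z)"
    and cont: "continuous_on UNIV (\<lambda>z. g' z v)"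
    and supp: "\<And>z. z \<notin> cball 0 R \<Longrightarrow> g z = 0"
  shows "(\<integral>z. g' z v \<partial>lborel) = 0"
proof -
  have contg: "continuous_on UNIV g"
    using has_derivative_continuous[OF der] by (simp add: continuous_on_eq_continuous_at)
  have g'0: "g' z v = 0" if z: "z \<notin> cball 0 R" for z
  proof -
    have "((\<lambda>_. 0) has_derivative g' z) (at z)"
      by (rule has_derivative_transform_within_open[OF der[of z], of "- cball 0 R"])
        (use z supp in auto)
    then have "g' z = (\<lambda>_. 0)"
      by (rule has_derivative_unique) simp
    then show ?thesis by simp
  qed
  obtain B where B: "\<And>z. norm (g' z v) \<le> B"
  proof -
    have "bounded ((\<lambda>z. g' z v) ` cball 0 R)"
      by (intro compact_imp_bounded compact_continuous_image continuous_on_subset[OF cont]) auto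
    then obtain b where b: "\<And>z. z \<in> cball 0 R \<Longrightarrow> norm (g' z v) \<le> b"
      unfolding bounded_iff by blast
    have "norm (g' z v) \<le> max b 0" for z
      using b[of z] g'0[of z] by (cases "z \<in> cball 0 R") auto
    then show ?thesis using that by blast
  qed
  \<comment> \<open>The step sizes 1/(k+1) are at most 1, so all quotients vanish outside the ball
    of radius R + |v|; the mean value inequality bounds them by \<open>B\<close>.\<close>
  define s where "s k z = (g (z + v /\<^sub>R real (Suc k)) - g z) * of_nat (Suc k)" for k z
  have lineder: "((\<lambda>t::real. g (z + t *\<^sub>R v)) has_derivative (\<lambda>h. h *\<^sub>R g' (z + t *\<^sub>R v) v)) (at t within S)" for z t S
  proof -
    have "((\<lambda>t. z + t *\<^sub>R v) has_derivative (\<lambda>h. h *\<^sub>R v)) (at t within S)"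
      by (auto intro!: derivative_eq_intros)
    from has_derivative_compose[OF this der]
    have "((\<lambda>t::real. g (z + t *\<^sub>R v)) has_derivative (\<lambda>h. g' (z + t *\<^sub>R v) (h *\<^sub>R v))) (at t within S)" .
    then show ?thesis
      by (simp add: linear_scale[OF bounded_linear.linear[OF has_derivative_bounded_linear[OF der]]])
  qed
  have bound: "norm (s k z) \<le> B" for k z
  proof -
    have "norm (g (z + (1 / real (Suc k)) *\<^sub>R v) - g (z + 0 *\<^sub>R v)) \<le> B * norm (1 / real (Suc k) - 0)"
    proof (rule differentiable_bound[where S = "UNIV :: real set"])
      show "onorm (\<lambda>h::real. h *\<^sub>R g' (z + t *\<^sub>R v) v) \<le> B" for t
        by (rule onorm_le) (use B[of "z + t *\<^sub>R v"] in \<open>simp add: mult.commute[of B] mult_left_mono\<close>)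
    qed (auto intro: lineder)
    moreover have "norm (s k z) =
        norm (g (z + (1 / real (Suc k)) *\<^sub>R v) - g (z + 0 *\<^sub>R v)) * real (Suc k)"
      unfolding s_def norm_mult by (simp add: inverse_eq_divide del: of_nat_Suc)
    ultimately show ?thesis
      by (simp add: field_simps del: of_nat_Suc)
  qed
  have int_g: "integrable lborel g"
  proof -
    have "integrable lborel (\<lambda>z. indicator (cball 0 R) z *\<^sub>R g z)"
      by (intro borel_integrable_compact continuous_on_subset[OF contg]) auto
    also have "(\<lambda>z. indicator (cball 0 R) z *\<^sub>R g z) = g"
      using supp by (auto simp: indicator_def fun_eq_iff)
    finally show ?thesis .
  qed
  have int_s: "(\<integral>z. s k z \<partial>lborel) = 0" for k
  proof -
    define w where "w = v /\<^sub>R real (Suc k)"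
    have d: "distr lborel borel ((+) w) = lborel" by (rule lborel_distr_plus)
    have i: "integrable lborel (\<lambda>z. g (w + z))"
      using int_g by (subst (asm) d[symmetric], subst (asm) integrable_distr_eq) auto
    have "(\<integral>z. g z \<partial>lborel) = (\<integral>z. g (w + z) \<partial>lborel)"
      using int_g by (subst d[symmetric], subst integral_distr) auto
    then have "(\<integral>z. g (w + z) - g z \<partial>lborel) = 0"
      using int_g i by simp
    then show ?thesis
      by (simp add: s_def w_def add.commute)
  qed
  have "(\<lambda>k. \<integral>z. s k z \<partial>lborel) \<longlonglongrightarrow> (\<integral>z. g' z v \<partial>lborel)"
  proof (rule integral_dominated_convergence)
    show "integrable lborel (\<lambda>z. B * indicator (cball 0 (R + norm v)) z :: real)"
      by (intro integrable_mult_right integrable_real_indicator)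
        (auto simp: emeasure_bounded_finite[OF bounded_cball, unfolded infinity_ennreal_def])
    show "(\<lambda>z. g' z v) \<in> borel_measurable lborel"
      using cont by (simp add: borel_measurable_continuous_onI)
    show "s k \<in> borel_measurable lborel" for k
    proof -
      have "continuous_on UNIV (s k)"
        unfolding s_def by (intro continuous_intros continuous_on_compose2[OF contg]) auto
      then show ?thesis by (simp add: borel_measurable_continuous_onI)
    qed
    show "AE z in lborel. norm (s k z) \<le> B * indicator (cball 0 (R + norm v)) z" for k
    proof (rule AE_I2)
      fix z
      show "norm (s k z) \<le> B * indicator (cball 0 (R + norm v)) z"
      proof (cases "z \<in> cball 0 (R + norm v)")
        case True then show ?thesis using bound by simp
      next
        case False
        have "norm (v /\<^sub>R real (Suc k)) \<le> norm v"
          by (simp add: field_simps)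
        then have "norm (z + v /\<^sub>R real (Suc k)) > R"
          using False norm_triangle_ineq4[of "z + v /\<^sub>R real (Suc k)" "v /\<^sub>R real (Suc k)"] by auto
        moreover have "norm z > R"
          using False norm_ge_zero[of v] by (simp add: not_le del: norm_ge_zero)
        ultimately show ?thesis
          using supp order_trans[OF norm_ge_zero B[of z]] by (simp add: s_def)
      qed
    qed
    show "AE z in lborel. (\<lambda>k. s k z) \<longlonglongrightarrow> g' z v"
    proof (rule AE_I2)
      fix z
      have "(\<lambda>t::real. norm (g (z + (0 + t) *\<^sub>R v) - g (z + 0 *\<^sub>R v) - t *\<^sub>R g' z v) / norm t) \<midarrow>0\<rightarrow> 0"
        using lineder[of z 0 UNIV] unfolding has_derivative_at by simp
      moreover have "filterlim (\<lambda>k. 1 / real (Suc k)) (at 0) sequentially"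
        unfolding filterlim_at using LIMSEQ_Suc[OF lim_1_over_n] by (simp del: of_nat_Suc)
      ultimately have "(\<lambda>k. norm (g (z + (0 + 1 / real (Suc k)) *\<^sub>R v) - g (z + 0 *\<^sub>R v)
          - (1 / real (Suc k)) *\<^sub>R g' z v) / norm (1 / real (Suc k))) \<longlonglongrightarrow> 0"
        by (rule filterlim_compose)
      moreover have "norm (g (z + (0 + 1 / real (Suc k)) *\<^sub>R v) - g (z + 0 *\<^sub>R v)
          - (1 / real (Suc k)) *\<^sub>R g' z v) / norm (1 / real (Suc k)) = norm (s k z - g' z v)" for k
      proof -
        have "s k z - g' z v = (g (z + (0 + 1 / real (Suc k)) *\<^sub>R v) - g (z + 0 *\<^sub>R v)
          - (1 / real (Suc k)) *\<^sub>R g' z v) * of_nat (Suc k)"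
          by (simp add: s_def scaleR_conv_of_real inverse_eq_divide left_diff_distrib del: of_nat_Suc)
        then show ?thesis
          by (simp add: norm_mult del: of_nat_Suc)
      qed
      ultimately have "(\<lambda>k. norm (s k z - g' z v)) \<longlonglongrightarrow> 0"
        by (simp only:)
      then show "(\<lambda>k. s k z) \<longlonglongrightarrow> g' z v"
        by (simp add: LIM_zero_iff tendsto_norm_zero_iff)
    qed
  qed
  then show ?thesis
    unfolding int_s using LIMSEQ_unique tendsto_const by blast
qed

lemma integral_lebesgue_on_disk:
  fixes g :: "complex \<Rightarrow> complex"
  assumes "continuous_on UNIV g" "\<And>z. z \<notin> unit_disk \<Longrightarrow> g z = 0"
  shows "(\<integral>z. g z \<partial>lebesgue_on unit_disk) = (\<integral>z. g z \<partial>lborel)"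
proof -
  have "(\<integral>z. g z \<partial>lebesgue_on unit_disk) = (\<integral>z. indicator unit_disk z *\<^sub>R g z \<partial>lebesgue)"
    by (rule integral_restrict_space) auto
  also have "(\<lambda>z. indicator unit_disk z *\<^sub>R g z) = g"
    using assms(2) by (auto simp: indicator_def fun_eq_iff)
  also have "(\<integral>z. g z \<partial>lebesgue) = (\<integral>z. g z \<partial>lborel)"
    using assms(1) by (intro integral_completion) (simp add: borel_measurable_continuous_onI)
  finally show ?thesis .
qed

lemma integrable_compact_support:
  fixes g :: "complex \<Rightarrow> complex"
  assumes "continuous_on UNIV g" "closed K" "K \<subseteq> unit_disk" "\<And>z. z \<notin> K \<Longrightarrow> g z = 0"
  shows "integrable lborel g" "integrable (lebesgue_on unit_disk) g"
proof -
  have "compact K"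
    using assms(2,3) bounded_subset bounded_ball by (auto simp: compact_eq_bounded_closed)
  then have "integrable lborel (\<lambda>z. indicator K z *\<^sub>R g z)"
    by (rule borel_integrable_compact) (use assms(1) continuous_on_subset in blast)
  also have "(\<lambda>z. indicator K z *\<^sub>R g z) = g"
    using assms(4) by (auto simp: indicator_def fun_eq_iff)
  finally show i: "integrable lborel g" .
  then have "integrable lebesgue g"
    by (auto simp: integrable_completion)
  moreover have "g z = 0" if "z \<notin> unit_disk" for z
    using that assms(3) by (intro assms(4)) blast
  then have "(\<lambda>z. indicator unit_disk z *\<^sub>R g z) = g"
    by (auto simp: indicator_def fun_eq_iff)
  ultimately show "integrable (lebesgue_on unit_disk) g"
    by (subst integrable_restrict_space) auto
qed

text \<open>With P and Q the integrals of p and q, the directions v = 1 and v = i give P + Q = 0 and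
  i P - i Q = 0.\<close>

lemma integral_wirtinger_eq_0:
  assumes w: "\<And>z. has_wirtinger g (p z) (q z) z"
    and cont: "continuous_on UNIV p" "continuous_on UNIV q"
    and K: "closed K" "K \<subseteq> unit_disk" "\<And>z. z \<notin> K \<Longrightarrow> g z = 0"
  shows "(\<integral>z. p z \<partial>lebesgue_on unit_disk) = 0" "(\<integral>z. q z \<partial>lebesgue_on unit_disk) = 0"
proof -
  have 0: "p z = 0" "q z = 0" if "z \<notin> K" for z
  proof -
    have "has_wirtinger g 0 0 z"
      using that K by (intro has_wirtinger_eventually_eq_0[where S = "- K"]) auto
    then show "p z = 0" "q z = 0"
      using has_wirtinger_imp(3,4)[OF w[of z]] has_wirtinger_imp(3,4)[of g 0 0 z] by auto
  qed
  have ip: "integrable lborel p" and iq: "integrable lborel q"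
    using integrable_compact_support(1)[OF cont(1) K(1,2) 0(1)]
      integrable_compact_support(1)[OF cont(2) K(1,2) 0(2)] by auto
  have supp: "g z = 0" if "z \<notin> cball 0 1" for z
    using that K by force
  have *: "(\<integral>z. p z * v + q z * cnj v \<partial>lborel) = 0" for v
    by (rule integral_directional_derivative_eq_0[OF _ _ supp])
      (use w in \<open>auto simp: has_wirtinger_def intro!: continuous_intros cont\<close>)
  have 1: "(\<integral>z. p z \<partial>lborel) + (\<integral>z. q z \<partial>lborel) = 0"
    using *[of 1] ip iq by simp
  have 2: "(\<integral>z. p z \<partial>lborel) * \<i> - (\<integral>z. q z \<partial>lborel) * \<i> = 0"
    using *[of \<i>] ip iq by simp
  have "(\<integral>z. p z \<partial>lborel) = 0" "(\<integral>z. q z \<partial>lborel) = 0"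
    using 1 2 by (auto simp: left_diff_distrib[symmetric] add_eq_0_iff)
  moreover have "p z = 0" "q z = 0" if "z \<notin> unit_disk" for z
    using that 0[of z] K(2) by blast+
  ultimately show "(\<integral>z. p z \<partial>lebesgue_on unit_disk) = 0" "(\<integral>z. q z \<partial>lebesgue_on unit_disk) = 0"
    using integral_lebesgue_on_disk[OF cont(1)] integral_lebesgue_on_disk[OF cont(2)] by auto
qed

text \<open>The factor h may blow up at the unit circle. The disk and the complement of K are open
  and cover the plane; the product is continuous on the first and zero on the second.\<close>

lemma continuous_on_mult_compact_support:
  fixes h :: "complex \<Rightarrow> complex"
  assumes "continuous_on unit_disk h" "continuous_on UNIV g"
    and K: "closed K" "K \<subseteq> unit_disk" "\<And>z. z \<notin> K \<Longrightarrow> g z = 0"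
  shows "continuous_on UNIV (\<lambda>z. h z * g z)"
proof -
  have "continuous_on unit_disk (\<lambda>z. h z * g z)"
    by (intro continuous_intros assms(1) continuous_on_subset[OF assms(2)]) auto
  moreover have "continuous_on (- K) (\<lambda>z. h z * g z)"
    by (rule continuous_on_eq[where f = "\<lambda>_. 0"]) (use K in auto)
  moreover have "unit_disk \<union> - K = UNIV" using K by auto
  ultimately show ?thesis
    using continuous_on_open_Un[of unit_disk "- K"] K(1) by auto
qed

lemma continuous_on_test_function: "test_function \<phi> \<Longrightarrow> continuous_on UNIV \<phi>"
  using test_function_Ck[of \<phi> 0] by simp

lemma test_function_support:
  assumes "test_function \<phi>"
  obtains K where "closed K" "K \<subseteq> unit_disk" "\<And>z. z \<notin> K \<Longrightarrow> \<phi> z = 0"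
    "\<And>z. z \<notin> K \<Longrightarrow> wirtinger_dz \<phi> z = 0" "\<And>z. z \<notin> K \<Longrightarrow> wirtinger_dzbar \<phi> z = 0"
proof (rule that)
  show "closure {z. \<phi> z \<noteq> 0} \<subseteq> unit_disk"
    using assms by (simp add: test_function_def)
qed (use test_function_eq_0[OF assms] in \<open>simp_all only: closed_closure\<close>)

lemma integrable_mult_test_function:
  assumes "continuous_on unit_disk h" "test_function \<phi>"
  shows "integrable (lebesgue_on unit_disk) (\<lambda>z. h z * \<phi> z)"
proof -
  obtain K where K: "closed K" "K \<subseteq> unit_disk" "\<And>z. z \<notin> K \<Longrightarrow> \<phi> z = 0"
    using test_function_support[OF assms(2)] by metis
  have "continuous_on UNIV (\<lambda>z. h z * \<phi> z)"
    by (rule continuous_on_mult_compact_support[OF assms(1) continuous_on_test_function[OF assms(2)] K])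
  then show ?thesis
    using K(1,2) by (rule integrable_compact_support(2)) (simp add: K(3))
qed

text \<open>Only the product h \<phi> has to be differentiable on the whole plane, and off the
  support of \<phi> it is zero whatever h is. Its Wirtinger derivatives integrate to 0, and the
  product rule splits them.\<close>

lemma integration_by_parts_disk:
  assumes w: "\<And>z. z \<in> unit_disk \<Longrightarrow> has_wirtinger h (p z) (q z) z"
    and cont: "continuous_on unit_disk p" "continuous_on unit_disk q"
    and \<phi>: "test_function \<phi>"
  shows "(\<integral>z. h z * wirtinger_dz \<phi> z \<partial>lebesgue_on unit_disk) = - (\<integral>z. p z * \<phi> z \<partial>lebesgue_on unit_disk)"
    and "(\<integral>z. h z * wirtinger_dzbar \<phi> z \<partial>lebesgue_on unit_disk) = - (\<integral>z. q z * \<phi> z \<partial>lebesgue_on unit_disk)"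
proof -
  obtain K where K: "closed K" "K \<subseteq> unit_disk" "\<And>z. z \<notin> K \<Longrightarrow> \<phi> z = 0"
    "\<And>z. z \<notin> K \<Longrightarrow> wirtinger_dz \<phi> z = 0" "\<And>z. z \<notin> K \<Longrightarrow> wirtinger_dzbar \<phi> z = 0"
    using test_function_support[OF \<phi>] by metis
  have conth: "continuous_on unit_disk h"
    using differentiable_imp_continuous_within[OF has_wirtinger_imp(1)[OF w]]
    by (simp add: continuous_on_eq_continuous_at)
  note \<phi>' = test_function_wirtinger[OF \<phi>]
  note c = continuous_on_mult_compact_support[OF _ continuous_on_test_function K(1,2)]
  have prod: "has_wirtinger (\<lambda>z. h z * \<phi> z) (p z * \<phi> z + h z * wirtinger_dz \<phi> z)
      (q z * \<phi> z + h z * wirtinger_dzbar \<phi> z) z" for z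
  proof (cases "z \<in> unit_disk")
    case True
    then show ?thesis
      by (rule has_wirtinger_mult[OF w test_function_has_wirtinger[OF \<phi>]])
  next
    case False
    then have z: "z \<in> - K" using K by auto
    have "has_wirtinger (\<lambda>z. h z * \<phi> z) 0 0 z"
      by (rule has_wirtinger_eventually_eq_0[OF open_Compl[OF K(1)] z]) (simp add: K)
    then show ?thesis using z K by simp
  qed
  have 0: "h z * \<phi> z = 0" if "z \<notin> K" for z using that K by simp
  have cp: "continuous_on UNIV (\<lambda>z. p z * \<phi> z + h z * wirtinger_dz \<phi> z)"
    by (intro continuous_on_add c cont conth \<phi> \<phi>' K(3,4))
  have cq: "continuous_on UNIV (\<lambda>z. q z * \<phi> z + h z * wirtinger_dzbar \<phi> z)"
    by (intro continuous_on_add c cont conth \<phi> \<phi>' K(3,5))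
  note i = integrable_mult_test_function[OF cont(1) \<phi>] integrable_mult_test_function[OF cont(2) \<phi>]
    integrable_mult_test_function[OF conth \<phi>'(1)] integrable_mult_test_function[OF conth \<phi>'(2)]
  have "(\<integral>z. p z * \<phi> z + h z * wirtinger_dz \<phi> z \<partial>lebesgue_on unit_disk) = 0"
    "(\<integral>z. q z * \<phi> z + h z * wirtinger_dzbar \<phi> z \<partial>lebesgue_on unit_disk) = 0"
    by (rule integral_wirtinger_eq_0[OF prod cp cq K(1,2) 0]; assumption)+
  then show "(\<integral>z. h z * wirtinger_dz \<phi> z \<partial>lebesgue_on unit_disk) = - (\<integral>z. p z * \<phi> z \<partial>lebesgue_on unit_disk)"
    "(\<integral>z. h z * wirtinger_dzbar \<phi> z \<partial>lebesgue_on unit_disk) = - (\<integral>z. q z * \<phi> z \<partial>lebesgue_on unit_disk)"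
    using i by (simp_all add: add_eq_0_iff)
qed

section \<open>Weights and square-integrable functions\<close>

abbreviation wt :: "real \<Rightarrow> complex \<Rightarrow> real" where
  "wt \<beta> z \<equiv> (1 - (cmod z)\<^sup>2) powr \<beta>"

lemma borel_measurable_disk: "f \<in> borel_measurable borel \<Longrightarrow> f \<in> borel_measurable (lebesgue_on unit_disk)"
  by (intro measurable_restrict_space1 measurable_completion) simp

lemma wt_measurable [measurable]: "wt \<beta> \<in> borel_measurable (lebesgue_on unit_disk)"
  by (intro borel_measurable_disk) measurable

lemma monomial_measurable [measurable]:
  "(\<lambda>z. z ^ a * cnj z ^ b) \<in> borel_measurable (lebesgue_on unit_disk)"
  by (intro borel_measurable_disk borel_measurable_continuous_onI continuous_intros)

lemma weight_pos: "z \<in> unit_disk \<Longrightarrow> 1 - (cmod z)\<^sup>2 > 0"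
  by (simp add: abs_square_less_1)

lemma finite_measure_disk: "finite_measure (lebesgue_on unit_disk)"
  by (intro finite_measure_lebesgue_on) (simp add: lmeasurable_ball)

lemma integrable_const_disk [simp]: "integrable (lebesgue_on unit_disk) (\<lambda>z. c :: 'a :: {banach, second_countable_topology})"
  by (rule finite_measure.integrable_const[OF finite_measure_disk])

text \<open>Fatou's lemma for real integrands with a common bound. It removes cutoffs from uniform
  estimates and later passes from partial sums to the power series.\<close>

lemma Fatou_integrable:
  fixes f :: "nat \<Rightarrow> 'a \<Rightarrow> real"
  assumes int: "\<And>k. integrable M (f k)" and nn: "\<And>k x. x \<in> space M \<Longrightarrow> f k x \<ge> 0"
    and lim: "\<And>x. x \<in> space M \<Longrightarrow> (\<lambda>k. f k x) \<longlonglongrightarrow> g x"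
    and bound: "\<And>k. (\<integral>x. f k x \<partial>M) \<le> B"
  shows "integrable M g" "(\<integral>x. g x \<partial>M) \<le> B"
proof -
  have meas: "g \<in> borel_measurable M"
    by (rule borel_measurable_LIMSEQ_real[OF lim]) (use int in auto)
  have g0: "g x \<ge> 0" if "x \<in> space M" for x
    using lim[OF that] nn[OF that] by (intro LIMSEQ_le_const) auto
  have B: "B \<ge> 0"
    by (rule order_trans[OF _ bound[of 0]]) (auto intro!: integral_nonneg_AE AE_I2 nn)
  have "(\<integral>\<^sup>+x. ennreal (g x) \<partial>M) = (\<integral>\<^sup>+x. liminf (\<lambda>k. ennreal (f k x)) \<partial>M)"
  proof (rule nn_integral_cong)
    fix x assume "x \<in> space M"
    then have "(\<lambda>k. ennreal (f k x)) \<longlonglongrightarrow> ennreal (g x)"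
      by (intro tendsto_ennrealI lim)
    then show "ennreal (g x) = liminf (\<lambda>k. ennreal (f k x))"
      using lim_imp_Liminf by (metis sequentially_bot)
  qed
  also have "\<dots> \<le> liminf (\<lambda>k. \<integral>\<^sup>+x. ennreal (f k x) \<partial>M)"
    by (rule nn_integral_liminf) (use int in auto)
  also have "\<dots> \<le> ennreal B"
  proof -
    have "(\<integral>\<^sup>+x. ennreal (f k x) \<partial>M) \<le> ennreal B" for k
      using nn_integral_eq_integral[OF int, of k] nn bound[of k] by (simp add: ennreal_leI)
    then show ?thesis
      by (intro Liminf_le) auto
  qed
  finally have le: "(\<integral>\<^sup>+x. ennreal (g x) \<partial>M) \<le> ennreal B" .
  then show i: "integrable M g"
    using g0 by (intro integrableI_nonneg meas) (auto intro: le_less_trans)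
  have "ennreal (\<integral>x. g x \<partial>M) \<le> ennreal B"
    using le nn_integral_eq_integral[OF i] g0 by simp
  then show "(\<integral>x. g x \<partial>M) \<le> B"
    using B by simp
qed

text \<open>For u = \<epsilon>/(x - \<epsilon>) one has x/(x - \<epsilon>) = 1 + u, so the left side
  is at most x^\<alpha> u^i (1 + u)^(n-i) exp(-u), where the last three factors are bounded
  independently of \<epsilon>. Each of the n poles is paid for by a factor \<epsilon> or by a power
  of x, hence the condition on \<beta>. Two derivatives of a cutoff with n = 0 reach n = 4.\<close>

lemma bump_bound:
  assumes \<epsilon>: "\<epsilon> > 0" and x: "x \<le> 1" and i: "i \<le> n" "n \<le> 4" and \<beta>: "\<beta> \<ge> \<alpha> + real (n - i)"
  shows "\<epsilon> ^ i * bump \<epsilon> \<beta> n x \<le> 256 * x powr \<alpha>"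
proof (cases "x > \<epsilon>")
  case False
  then show ?thesis by (simp add: bump_def)
next
  case True
  define u where "u = \<epsilon> / (x - \<epsilon>)"
  have u: "u > 0" using True \<epsilon> by (simp add: u_def)
  have x0: "x > 0" using True \<epsilon> by simp
  have xu: "x * (1 / (x - \<epsilon>)) = 1 + u"
    using True by (simp add: u_def field_simps)
  have "x powr \<beta> \<le> x powr (\<alpha> + real (n - i))"
    using x0 x \<beta> by (intro powr_mono') auto
  also have "\<dots> = x powr \<alpha> * x ^ (n - i)"
    using x0 by (simp add: powr_add powr_realpow)
  finally have 1: "x powr \<beta> \<le> x powr \<alpha> * x ^ (n - i)" .
  have "(1 / (x - \<epsilon>)) ^ n = (1 / (x - \<epsilon>)) ^ i * (1 / (x - \<epsilon>)) ^ (n - i)"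
    using i by (simp flip: power_add)
  then have "\<epsilon> ^ i * bump \<epsilon> \<beta> n x = x powr \<beta> * (u ^ i * (1 / (x - \<epsilon>)) ^ (n - i) * exp (- u))"
    using True by (simp add: bump_def u_def power_divide)
  also have "\<dots> \<le> (x powr \<alpha> * x ^ (n - i)) * (u ^ i * (1 / (x - \<epsilon>)) ^ (n - i) * exp (- u))"
    using 1 u True by (intro mult_right_mono) auto
  also have "\<dots> = x powr \<alpha> * (u ^ i * (x * (1 / (x - \<epsilon>))) ^ (n - i) * exp (- u))"
    by (simp only: power_mult_distrib mult_ac)
  also have "\<dots> = x powr \<alpha> * (u ^ i * (1 + u) ^ (n - i) * exp (- u))"
    by (simp only: xu)
  also have "\<dots> \<le> x powr \<alpha> * ((1 + u) ^ 4 * exp (- u))"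
  proof -
    have "u ^ i * (1 + u) ^ (n - i) \<le> (1 + u) ^ i * (1 + u) ^ (n - i)"
      using u by (intro mult_right_mono power_mono) auto
    also have "\<dots> = (1 + u) ^ n"
      using i by (simp flip: power_add)
    also have "\<dots> \<le> (1 + u) ^ 4"
      using u i by (intro power_increasing) auto
    finally show ?thesis
      by (intro mult_left_mono mult_right_mono) auto
  qed
  also have "\<dots> \<le> x powr \<alpha> * 256"
  proof (rule mult_left_mono)
    \<comment> \<open>Since (1 + u)/4 \<le> 1 + u/4, the inequality (1 + u/4)^4 \<le> exp u gives
      the constant 256 = 4^4.\<close>
    have "((1 + u) / 4) ^ 4 \<le> (1 + u / real 4) ^ 4"
      using u by (intro power_mono) auto
    also have "\<dots> \<le> exp u"
      using u by (intro exp_ge_one_plus_x_over_n_power_n) auto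
    finally have "(1 + u) ^ 4 \<le> 256 * exp u"
      by (simp add: power_divide)
    then show "(1 + u) ^ 4 * exp (- u) \<le> 256"
      by (simp add: exp_minus divide_simps mult.commute)
  qed simp
  finally show ?thesis by (simp add: mult.commute)
qed

lemma bump_le_powr:
  assumes "\<epsilon> > 0" shows "bump \<epsilon> \<beta> 0 x \<le> x powr \<beta>"
  using assms by (auto simp: bump_def intro!: mult_left_le divide_nonneg_pos)

text \<open>The factor \<open>0 ^ i\<close> serves both uses: it is 1 for i = 0, where the cutoff
  disappears in the limit, and 0 for i > 0, where \<epsilon> stems from differentiating the
  cutoff.\<close>

lemma bump_tendsto:
  assumes "x > 0" "e \<longlonglongrightarrow> 0" "\<And>k. e k > 0"
  shows "(\<lambda>k. e k ^ i * bump (e k) \<beta> n x) \<longlonglongrightarrow> 0 ^ i * (x powr \<beta> * (1 / x) ^ n)"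
proof -
  have "(\<lambda>k. e k ^ i * (x powr \<beta> * (1 / (x - e k)) ^ n * exp (- e k / (x - e k))))
      \<longlonglongrightarrow> 0 ^ i * (x powr \<beta> * (1 / (x - 0)) ^ n * exp (- 0 / (x - 0)))"
    using assms(1) by (intro tendsto_intros assms(2)) auto
  moreover have "\<forall>\<^sub>F k in sequentially. e k ^ i * (x powr \<beta> * (1 / (x - e k)) ^ n * exp (- e k / (x - e k)))
      = e k ^ i * bump (e k) \<beta> n x"
    using order_tendstoD(2)[OF assms(2,1)] by eventually_elim (simp add: bump_def)
  ultimately have "(\<lambda>k. e k ^ i * bump (e k) \<beta> n x)
      \<longlonglongrightarrow> 0 ^ i * (x powr \<beta> * (1 / (x - 0)) ^ n * exp (- 0 / (x - 0)))"
    by (rule Lim_transform_eventually)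
  then show ?thesis by simp
qed

definition eps :: "nat \<Rightarrow> real" where "eps k = 1 / real (Suc k)"

lemma eps_pos [simp]: "eps k > 0" by (simp add: eps_def)

lemma eps_tendsto: "eps \<longlonglongrightarrow> 0"
  unfolding eps_def using LIMSEQ_Suc[OF lim_1_over_n] by simp

lemma cmod_cutoff: "cmod (cutoff \<epsilon> \<beta> n z) = bump \<epsilon> \<beta> n (1 - (cmod z)\<^sup>2)"
  by (simp add: cutoff_def bump_nonneg)

lemma integrable_mult_cutoff:
  assumes "continuous_on unit_disk h" "\<epsilon> > 0"
  shows "integrable (lebesgue_on unit_disk) (\<lambda>z. h z * cutoff \<epsilon> \<beta> n z)"
  by (rule integrable_mult_test_function[OF assms(1) test_function_cutoff[OF assms(2)]])

lemma integrable_mult_bump: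
  assumes "continuous_on unit_disk (h :: complex \<Rightarrow> real)" "\<epsilon> > 0"
  shows "integrable (lebesgue_on unit_disk) (\<lambda>z. h z * bump \<epsilon> \<beta> n (1 - (cmod z)\<^sup>2))"
proof -
  have "integrable (lebesgue_on unit_disk) (\<lambda>z. complex_of_real (h z) * cutoff \<epsilon> \<beta> n z)"
    by (intro integrable_mult_cutoff assms continuous_intros)
  from integrable_Re[OF this] show ?thesis
    by (simp add: cutoff_def)
qed

text \<open>Integrating the divergence of \<open>z (1 - |z|\<^sup>2)\<^sup>\<beta>\<^sup>+\<^sup>1\<close>, cut off, bounds the integral of
  \<open>|z|\<^sup>2 (1 - |z|\<^sup>2)\<^sup>\<beta>\<close>; polar coordinates are not needed.\<close>

lemma integrable_wt:
  assumes "\<beta> > -1"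
  shows "integrable (lebesgue_on unit_disk) (wt \<beta>)"
proof -
  let ?M = "lebesgue_on unit_disk"
  have bound: "(\<integral>z. (cmod z)\<^sup>2 * bump \<epsilon> \<beta> 0 (1 - (cmod z)\<^sup>2) \<partial>?M) \<le> measure ?M unit_disk / (\<beta> + 1)"
    if \<epsilon>: "\<epsilon> > 0" for \<epsilon>
  proof -
    let ?\<phi> = "cutoff \<epsilon> (\<beta> + 1) 0"
    have c: "continuous_on unit_disk (\<lambda>z::complex. (cmod z)\<^sup>2)"
      by (intro continuous_intros)
    have i0: "integrable ?M (\<lambda>z. bump \<epsilon> (\<beta> + 1) 0 (1 - (cmod z)\<^sup>2))"
      using integrable_mult_bump[of "\<lambda>_. 1" \<epsilon>] \<epsilon> by simp
    have "(\<integral>z. z * wirtinger_dz ?\<phi> z \<partial>?M) = - (\<integral>z. 1 * ?\<phi> z \<partial>?M)"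
      by (rule integration_by_parts_disk[OF has_wirtinger_id]) (auto intro: test_function_cutoff \<epsilon>)
    also have "(\<lambda>z. z * wirtinger_dz ?\<phi> z) = (\<lambda>z. - complex_of_real ((\<beta> + 1) * ((cmod z)\<^sup>2 * bump \<epsilon> \<beta> 0 (1 - (cmod z)\<^sup>2))
        + \<epsilon> * ((cmod z)\<^sup>2 * bump \<epsilon> (\<beta> + 1) 2 (1 - (cmod z)\<^sup>2))))"
    proof
      fix z
      have "wirtinger_dz ?\<phi> z = - cnj z * cutoff' \<epsilon> (\<beta> + 1) 0 z"
        by (rule has_wirtinger_imp(3)[OF cutoff_has_wirtinger[OF \<epsilon>]])
      then have "z * wirtinger_dz ?\<phi> z = - complex_of_real ((cmod z)\<^sup>2) * cutoff' \<epsilon> (\<beta> + 1) 0 z"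
        by (simp only: complex_norm_square) (simp add: mult_ac)
      then show "z * wirtinger_dz ?\<phi> z = - complex_of_real ((\<beta> + 1) * ((cmod z)\<^sup>2 * bump \<epsilon> \<beta> 0 (1 - (cmod z)\<^sup>2))
        + \<epsilon> * ((cmod z)\<^sup>2 * bump \<epsilon> (\<beta> + 1) 2 (1 - (cmod z)\<^sup>2)))"
        by (simp add: cutoff'_def cutoff_def algebra_simps numeral_2_eq_2)
    qed
    also have "(\<integral>z. - complex_of_real ((\<beta> + 1) * ((cmod z)\<^sup>2 * bump \<epsilon> \<beta> 0 (1 - (cmod z)\<^sup>2))
        + \<epsilon> * ((cmod z)\<^sup>2 * bump \<epsilon> (\<beta> + 1) 2 (1 - (cmod z)\<^sup>2))) \<partial>?M) =
        - complex_of_real ((\<beta> + 1) * (\<integral>z. (cmod z)\<^sup>2 * bump \<epsilon> \<beta> 0 (1 - (cmod z)\<^sup>2) \<partial>?M)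
        + \<epsilon> * (\<integral>z. (cmod z)\<^sup>2 * bump \<epsilon> (\<beta> + 1) 2 (1 - (cmod z)\<^sup>2) \<partial>?M))"
      using integrable_mult_bump[OF c \<epsilon>]
      by (simp only: integral_minus integral_complex_of_real Bochner_Integration.integral_add
            Bochner_Integration.integrable_mult_right Bochner_Integration.integral_mult_right_zero)
    also have "(\<integral>z. 1 * ?\<phi> z \<partial>?M) = complex_of_real (\<integral>z. bump \<epsilon> (\<beta> + 1) 0 (1 - (cmod z)\<^sup>2) \<partial>?M)"
      by (simp add: cutoff_def)
    finally have "(\<beta> + 1) * (\<integral>z. (cmod z)\<^sup>2 * bump \<epsilon> \<beta> 0 (1 - (cmod z)\<^sup>2) \<partial>?M)
        + \<epsilon> * (\<integral>z. (cmod z)\<^sup>2 * bump \<epsilon> (\<beta> + 1) 2 (1 - (cmod z)\<^sup>2) \<partial>?M) =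
        (\<integral>z. bump \<epsilon> (\<beta> + 1) 0 (1 - (cmod z)\<^sup>2) \<partial>?M)"
      by (simp only: neg_equal_iff_equal of_real_eq_iff)
    \<comment> \<open>This term comes from differentiating the exponential in the cutoff. Its sign
      is favourable, so it is dropped.\<close>
    moreover have "\<epsilon> * (\<integral>z. (cmod z)\<^sup>2 * bump \<epsilon> (\<beta> + 1) 2 (1 - (cmod z)\<^sup>2) \<partial>?M) \<ge> 0"
      using \<epsilon> by (intro mult_nonneg_nonneg integral_nonneg_AE AE_I2) (auto simp: bump_nonneg)
    moreover have "(\<integral>z. bump \<epsilon> (\<beta> + 1) 0 (1 - (cmod z)\<^sup>2) \<partial>?M) \<le> (\<integral>z. 1 \<partial>?M)"
    proof (rule integral_mono[OF i0])
      fix z assume "z \<in> space ?M"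
      then have x: "1 - (cmod z)\<^sup>2 > 0" by (intro weight_pos) simp
      have "bump \<epsilon> (\<beta> + 1) 0 (1 - (cmod z)\<^sup>2) \<le> (1 - (cmod z)\<^sup>2) powr (\<beta> + 1)"
        by (rule bump_le_powr[OF \<epsilon>])
      also have "\<dots> \<le> 1 powr (\<beta> + 1)"
        using assms x by (intro powr_mono2) auto
      finally show "bump \<epsilon> (\<beta> + 1) 0 (1 - (cmod z)\<^sup>2) \<le> 1" by simp
    qed simp
    ultimately have "(\<beta> + 1) * (\<integral>z. (cmod z)\<^sup>2 * bump \<epsilon> \<beta> 0 (1 - (cmod z)\<^sup>2) \<partial>?M) \<le> measure ?M unit_disk"
      by simp
    then show ?thesis
      using assms by (simp add: field_simps)
  qed
  have "integrable ?M (\<lambda>z. (cmod z)\<^sup>2 * wt \<beta> z)"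
  proof (rule Fatou_integrable(1)[where B = "measure ?M unit_disk / (\<beta> + 1)"])
    show "integrable ?M (\<lambda>z. (cmod z)\<^sup>2 * bump (eps k) \<beta> 0 (1 - (cmod z)\<^sup>2))" for k
      by (intro integrable_mult_bump continuous_intros) auto
    show "(\<lambda>k. (cmod z)\<^sup>2 * bump (eps k) \<beta> 0 (1 - (cmod z)\<^sup>2)) \<longlonglongrightarrow> (cmod z)\<^sup>2 * wt \<beta> z"
      if "z \<in> space ?M" for z
      using bump_tendsto[OF weight_pos eps_tendsto eps_pos, of z 0 \<beta> 0] that
      by (intro tendsto_mult_left) simp
  qed (auto simp: bump_nonneg intro!: bound)
  \<comment> \<open>Since |z|^2 + x = 1 for x = 1 - |z|^2, adding x^(\<beta>+1) removes the factor
    |z|^2 from the integrand.\<close>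
  moreover have "integrable ?M (wt (\<beta> + 1))"
  proof (rule finite_measure.integrable_const_bound[OF finite_measure_disk])
    show "AE z in ?M. norm (wt (\<beta> + 1) z) \<le> 1"
    proof (rule AE_I2)
      fix z assume "z \<in> space ?M"
      then have x: "1 - (cmod z)\<^sup>2 > 0" by (intro weight_pos) simp
      have "(1 - (cmod z)\<^sup>2) powr (\<beta> + 1) \<le> 1 powr (\<beta> + 1)"
        using assms x by (intro powr_mono2) auto
      then show "norm (wt (\<beta> + 1) z) \<le> 1" by simp
    qed
  qed measurable
  ultimately have "integrable ?M (\<lambda>z. (cmod z)\<^sup>2 * wt \<beta> z + wt (\<beta> + 1) z)"
    by (rule Bochner_Integration.integrable_add)
  moreover have "integrable ?M (\<lambda>z. (cmod z)\<^sup>2 * wt \<beta> z + wt (\<beta> + 1) z) = integrable ?M (wt \<beta>)"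
  proof (rule Bochner_Integration.integrable_cong)
    show "(cmod z)\<^sup>2 * wt \<beta> z + wt (\<beta> + 1) z = wt \<beta> z" if "z \<in> space ?M" for z
      using weight_pos[of z] that by (simp add: powr_add algebra_simps)
  qed simp
  ultimately show ?thesis by simp
qed

lemma L2_weighted_iff:
  "F \<in> L2_weighted \<alpha> \<longleftrightarrow> F \<in> borel_measurable (lebesgue_on unit_disk) \<and>
     integrable (lebesgue_on unit_disk) (\<lambda>z. (cmod (F z))\<^sup>2 * wt \<alpha> z)"
proof (cases "F \<in> borel_measurable (lebesgue_on unit_disk)")
  case True
  have m: "(\<lambda>z. (cmod (F z))\<^sup>2 * wt \<alpha> z) \<in> borel_measurable (lebesgue_on unit_disk)"
    using True by measurable
  have "integrable (lebesgue_on unit_disk) (\<lambda>z. (cmod (F z))\<^sup>2 * wt \<alpha> z) \<longleftrightarrow>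
      (\<integral>\<^sup>+ z. ennreal ((cmod (F z))\<^sup>2 * wt \<alpha> z) \<partial>lebesgue_on unit_disk) < \<infinity>"
    using m by (subst integrable_iff_bounded) simp
  with True show ?thesis by (simp add: L2_weighted_def)
qed (simp add: L2_weighted_def)

text \<open>From a \<le> 1 + a^2, |F| x^\<alpha> is at most x^\<alpha> + |F|^2 x^\<alpha>. The
  hypothesis \<alpha> > -1 enters through the first summand.\<close>

lemma L2_weighted_imp_integrable:
  assumes "F \<in> L2_weighted \<alpha>" "\<alpha> > -1"
  shows "integrable (lebesgue_on unit_disk) (\<lambda>z. F z * complex_of_real (wt \<alpha> z))"
proof (rule Bochner_Integration.integrable_bound)
  show "integrable (lebesgue_on unit_disk) (\<lambda>z. wt \<alpha> z + (cmod (F z))\<^sup>2 * wt \<alpha> z)"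
    using assms by (intro Bochner_Integration.integrable_add integrable_wt) (auto simp: L2_weighted_iff)
  show "(\<lambda>z. F z * complex_of_real (wt \<alpha> z)) \<in> borel_measurable (lebesgue_on unit_disk)"
    using assms by (auto simp: L2_weighted_def)
  have "a \<le> 1 + a\<^sup>2" for a :: real
    using zero_le_power2[of "a - 1/2"] by (simp add: power2_eq_square algebra_simps)
  then have "a * w \<le> w + a\<^sup>2 * w" if "w \<ge> 0" for a w :: real
    using mult_right_mono[of a "1 + a\<^sup>2" w] that by (simp add: algebra_simps)
  then show "AE z in lebesgue_on unit_disk. norm (F z * complex_of_real (wt \<alpha> z)) \<le> norm (wt \<alpha> z + (cmod (F z))\<^sup>2 * wt \<alpha> z)"
    by (intro AE_I2) (simp add: norm_mult)
qed

section \<open>Integrability of a holomorphic function from its derivatives\<close>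

lemma holomorphic_has_wirtinger:
  assumes "f holomorphic_on unit_disk" "z \<in> unit_disk"
  shows "has_wirtinger f (deriv f z) 0 z"
  using assms by (intro has_wirtinger_field_derivative holomorphic_derivI[OF _ open_ball])

lemma holomorphic_measurable_disk:
  assumes "f holomorphic_on unit_disk"
  shows "f \<in> borel_measurable (lebesgue_on unit_disk)"
  by (intro continuous_imp_measurable_on_sets_lebesgue holomorphic_on_imp_continuous_on assms) simp

lemma continuous_on_disk_bounded_by:
  assumes "continuous_on unit_disk (f :: complex \<Rightarrow> real)" "x0 > 0"
  obtains A where "A \<ge> 0" "\<And>z. 1 - (cmod z)\<^sup>2 \<ge> x0 \<Longrightarrow> \<bar>f z\<bar> \<le> A"
proof -
  let ?K = "{z::complex. 1 - (cmod z)\<^sup>2 \<ge> x0}"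
  have sub: "?K \<subseteq> unit_disk"
  proof
    fix z assume "z \<in> ?K"
    then have "(cmod z)\<^sup>2 < 1\<^sup>2" using assms(2) by auto
    then show "z \<in> unit_disk" by (simp add: power2_less_imp_less)
  qed
  have "closed ((\<lambda>z::complex. 1 - (cmod z)\<^sup>2) -` {x0..})"
    by (intro closed_vimage continuous_intros)
  then have "closed ?K" by (simp add: vimage_def)
  then have "compact ?K"
    using sub bounded_subset[OF bounded_ball] by (auto simp: compact_eq_bounded_closed)
  then have "bounded (f ` ?K)"
    by (intro compact_imp_bounded compact_continuous_image continuous_on_subset[OF assms(1) sub])
  then obtain A where "\<forall>x \<in> f ` ?K. norm x \<le> A"
    unfolding bounded_iff by blast
  then have "\<bar>f z\<bar> \<le> max A 0" if "1 - (cmod z)\<^sup>2 \<ge> x0" for z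
    using that by fastforce
  then show ?thesis using that[of "max A 0"] by simp
qed

text \<open>A Hardy-type argument: the divergence of \<open>z |f|\<^sup>2 (1 - |z|\<^sup>2)\<^sup>\<alpha>\<^sup>+\<^sup>1\<close>, cut off, controls \<open>|f|\<^sup>2\<close>
  near the boundary, while \<open>f\<close> is bounded on the remaining compact disk.\<close>

lemma L2_deriv_imp_L2:
  assumes hol: "f holomorphic_on unit_disk" and \<alpha>: "\<alpha> > -1"
    and int': "integrable (lebesgue_on unit_disk) (\<lambda>z. (cmod (deriv f z))\<^sup>2 * wt \<alpha> z)"
  shows "integrable (lebesgue_on unit_disk) (\<lambda>z. (cmod (f z))\<^sup>2 * wt \<alpha> z)"
proof -
  let ?M = "lebesgue_on unit_disk"
  define c where "c = \<alpha> + 1"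
  have c: "c > 0" using \<alpha> by (simp add: c_def)
  have cont: "continuous_on unit_disk f" "continuous_on unit_disk (deriv f)"
    using hol by (auto intro: holomorphic_on_imp_continuous_on holomorphic_deriv)
  \<comment> \<open>Chosen so that (c + 3/2) x \<le> c/2 for x \<le> x0; there the gain c (1 - x)
    exceeds the error 3/2 x by at least c/2.\<close>
  define x0 where "x0 = c / (2 * (c + 3/2))"
  have x0: "x0 > 0" using c by (simp add: x0_def)
  obtain A where A: "A \<ge> 0" "\<And>z. 1 - (cmod z)\<^sup>2 \<ge> x0 \<Longrightarrow> \<bar>(cmod (f z))\<^sup>2\<bar> \<le> A"
    by (rule continuous_on_disk_bounded_by[of "\<lambda>z. (cmod (f z))\<^sup>2" x0])
      (use x0 in \<open>auto intro!: continuous_intros cont\<close>)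
  \<comment> \<open>Two contributions: half the weighted integral of |f'|^2, from the
    arithmetic-geometric inequality, and the region x > x0, where |f|^2 \<le> A.\<close>
  define B where "B = 1/2 * (\<integral>z. (cmod (deriv f z))\<^sup>2 * wt \<alpha> z \<partial>?M) + (c / 2 + 3/2) * A * (\<integral>z. wt \<alpha> z \<partial>?M)"
  have bound: "(\<integral>z. (cmod (f z))\<^sup>2 * bump \<epsilon> \<alpha> 0 (1 - (cmod z)\<^sup>2) \<partial>?M) \<le> 2 / c * B"
    if \<epsilon>: "\<epsilon> > 0" for \<epsilon>
  proof -
    let ?\<phi> = "cutoff \<epsilon> (\<alpha> + 1) 0"
    define b where "b z = bump \<epsilon> \<alpha> 0 (1 - (cmod z)\<^sup>2)" for z
    have b0: "b z \<ge> 0" for z by (simp add: b_def bump_nonneg)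
    have b1: "bump \<epsilon> (\<alpha> + 1) 0 (1 - (cmod z)\<^sup>2) = (1 - (cmod z)\<^sup>2) * b z" for z
      using \<epsilon> by (simp add: b_def bump_def powr_add)
    define p where "p z = (deriv f z * cnj (f z)) * z + (f z * cnj (f z))" for z
    define q where "q z = (f z * cnj (deriv f z)) * z" for z
    have w: "has_wirtinger (\<lambda>z. (f z * cnj (f z)) * z) (p z) (q z) z" if "z \<in> unit_disk" for z
      using has_wirtinger_mult[OF has_wirtinger_mult[OF holomorphic_has_wirtinger[OF hol that]
            has_wirtinger_cnj_comp[OF holomorphic_has_wirtinger[OF hol that]]] has_wirtinger_id]
      by (simp add: p_def q_def)
    have cpq: "continuous_on unit_disk p" "continuous_on unit_disk q"
      unfolding p_def q_def by (intro continuous_intros cont)+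
    \<comment> \<open>\<open>L\<close> is minus z |f|^2 times the z-derivative of the cutoff. Its
      second summand, from the exponential, is nonnegative and is discarded in the lower bound for
      \<open>L\<close>.\<close>
    define L where "L z = c * ((cmod z)\<^sup>2 * (cmod (f z))\<^sup>2 * b z)
        + \<epsilon> * ((cmod z)\<^sup>2 * (cmod (f z))\<^sup>2 * bump \<epsilon> (\<alpha> + 1) 2 (1 - (cmod z)\<^sup>2))" for z
    have L: "f z * cnj (f z) * z * wirtinger_dz ?\<phi> z = - complex_of_real (L z)" for z
    proof -
      have "wirtinger_dz ?\<phi> z = - cnj z * cutoff' \<epsilon> (\<alpha> + 1) 0 z"
        by (rule has_wirtinger_imp(3)[OF cutoff_has_wirtinger[OF \<epsilon>]])
      then have "f z * cnj (f z) * z * wirtinger_dz ?\<phi> z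
          = - complex_of_real ((cmod z)\<^sup>2) * complex_of_real ((cmod (f z))\<^sup>2) * cutoff' \<epsilon> (\<alpha> + 1) 0 z"
        by (simp only: complex_norm_square) (simp add: mult_ac)
      then show ?thesis
        by (simp add: cutoff'_def cutoff_def L_def b_def c_def algebra_simps numeral_2_eq_2)
    qed
    have Lint: "integrable ?M L"
      unfolding L_def b_def
      by (intro Bochner_Integration.integrable_add Bochner_Integration.integrable_mult_right
          integrable_mult_bump \<epsilon> continuous_intros cont)
    have "(\<integral>z. f z * cnj (f z) * z * wirtinger_dz ?\<phi> z \<partial>?M) = - (\<integral>z. p z * ?\<phi> z \<partial>?M)"
      by (rule integration_by_parts_disk[OF w cpq test_function_cutoff[OF \<epsilon>]])
    then have "complex_of_real (\<integral>z. L z \<partial>?M) = (\<integral>z. p z * ?\<phi> z \<partial>?M)"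
      unfolding L by simp
    then have "(\<integral>z. L z \<partial>?M) = Re (\<integral>z. p z * ?\<phi> z \<partial>?M)"
      by (metis Re_complex_of_real)
    also have "\<dots> = (\<integral>z. Re (p z * ?\<phi> z) \<partial>?M)"
      by (rule integral_Re[symmetric]) (intro integrable_mult_cutoff cpq \<epsilon>)
    finally have eq: "(\<integral>z. L z \<partial>?M) = (\<integral>z. Re (p z * ?\<phi> z) \<partial>?M)" .
    have pint: "integrable ?M (\<lambda>z. Re (p z * ?\<phi> z))"
      by (intro integrable_Re integrable_mult_cutoff cpq \<epsilon>)
    have bint: "integrable ?M (\<lambda>z. (cmod (f z))\<^sup>2 * b z)"
      unfolding b_def by (intro integrable_mult_bump \<epsilon> continuous_intros cont)
    have wint: "integrable ?M (wt \<alpha>)" by (rule integrable_wt[OF \<alpha>])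
    \<comment> \<open>The pointwise inequality behind the bound: after integration the bracket
      \<open>L z - Re (p z * ?\<phi> z)\<close> contributes 0 by \<open>eq\<close>.\<close>
    have le: "c / 2 * ((cmod (f z))\<^sup>2 * b z) \<le> (L z - Re (p z * ?\<phi> z))
        + (1/2 * ((cmod (deriv f z))\<^sup>2 * wt \<alpha> z) + (c / 2 + 3/2) * A * wt \<alpha> z)" if "z \<in> space ?M" for z
    proof -
      define x where "x = 1 - (cmod z)\<^sup>2"
      have x: "x > 0" "x \<le> 1" using weight_pos[of z] that by (auto simp: x_def)
      have z1: "cmod z \<le> 1" using that by simp
      define u where "u = (cmod (f z))\<^sup>2"
      define v where "v = (cmod (deriv f z))\<^sup>2"
      have u: "u \<ge> 0" and v: "v \<ge> 0" by (auto simp: u_def v_def)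
      have bw: "b z \<le> wt \<alpha> z"
        unfolding b_def by (rule bump_le_powr[OF \<epsilon>])
      have "L z \<ge> c * ((1 - x) * u * b z)"
        using \<epsilon> bump_nonneg by (simp add: L_def x_def u_def)
      \<comment> \<open>Here |f f'| \<le> (|f|^2 + |f'|^2)/2, and the summand |f|^2 of
        \<open>p\<close> raises the coefficient of |f|^2 to 3/2.\<close>
      moreover have "Re (p z * ?\<phi> z) \<le> (3/2 * u + 1/2 * v) * (x * b z)"
      proof -
        have "Re (p z) \<le> cmod (p z)" by (rule complex_Re_le_cmod)
        also have "\<dots> \<le> cmod (deriv f z * cnj (f z) * z) + cmod (f z * cnj (f z))"
          unfolding p_def by (rule norm_triangle_ineq)
        also have "\<dots> \<le> cmod (deriv f z) * cmod (f z) * 1 + u"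
          by (simp add: norm_mult u_def power2_eq_square mult_left_le z1)
        also have "cmod (deriv f z) * cmod (f z) * 1 \<le> (u + v) / 2"
          using sum_squares_bound[of "cmod (deriv f z)" "cmod (f z)"] by (simp add: u_def v_def)
        finally have "Re (p z) \<le> 3/2 * u + 1/2 * v" by (simp add: field_simps)
        then have "Re (p z) * (x * b z) \<le> (3/2 * u + 1/2 * v) * (x * b z)"
          using x b0 by (intro mult_right_mono) auto
        moreover have "?\<phi> z = complex_of_real (x * b z)"
          by (simp add: cutoff_def b1 x_def)
        ultimately show ?thesis by simp
      qed
      moreover have "1/2 * v * (x * b z) \<le> 1/2 * (v * wt \<alpha> z)"
      proof -
        have "x * b z \<le> 1 * wt \<alpha> z"
          using x b0 bw by (intro mult_mono) auto
        then show ?thesis using v by (simp add: mult_left_mono)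
      qed
      moreover have "c / 2 * (u * b z) \<le> c * ((1 - x) * u * b z) - 3/2 * u * (x * b z) + (c / 2 + 3/2) * A * wt \<alpha> z"
      \<comment> \<open>Near the circle 1 - x is close to 1 and the main term wins; in the interior
        |f|^2 \<le> A, and the constant absorbs everything.\<close>
      proof (cases "x \<le> x0")
        case True
        have "(c + 3/2) * x \<le> (c + 3/2) * x0" using True c by (intro mult_left_mono) auto
        also have "\<dots> = c / 2" using c by (simp add: x0_def field_simps)
        finally have "c / 2 \<le> c * (1 - x) - 3/2 * x" by (simp add: algebra_simps)
        then have "c / 2 * (u * b z) \<le> (c * (1 - x) - 3/2 * x) * (u * b z)"
          using u b0 by (intro mult_right_mono) auto
        also have "\<dots> = c * ((1 - x) * u * b z) - 3/2 * u * (x * b z)"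
          by (simp add: algebra_simps)
        moreover have "0 \<le> (c / 2 + 3/2) * A * wt \<alpha> z" using c A by simp
        ultimately show ?thesis by linarith
      next
        case False
        then have "u \<le> A" using A(2)[of z] by (simp add: x_def u_def)
        then have "u * b z \<le> A * wt \<alpha> z"
          using u b0 bw A(1) by (intro mult_mono) auto
        then have "(c / 2 + 3/2) * (u * b z) \<le> (c / 2 + 3/2) * (A * wt \<alpha> z)"
          using c by (intro mult_left_mono) auto
        moreover have "3/2 * (x * (u * b z)) \<le> 3/2 * (1 * (u * b z))"
          using x u b0 by (intro mult_left_mono mult_right_mono) auto
        moreover have "0 \<le> c * ((1 - x) * u * b z)"
          using x u b0 c by simp
        ultimately show ?thesis by (simp add: algebra_simps)
      qed
      ultimately show ?thesis
        unfolding u_def[symmetric] v_def[symmetric] by (simp add: algebra_simps)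
    qed
    have "(\<integral>z. c / 2 * ((cmod (f z))\<^sup>2 * b z) \<partial>?M) \<le> (\<integral>z. (L z - Re (p z * ?\<phi> z))
        + (1/2 * ((cmod (deriv f z))\<^sup>2 * wt \<alpha> z) + (c / 2 + 3/2) * A * wt \<alpha> z) \<partial>?M)"
      by (intro integral_mono le Bochner_Integration.integrable_add Bochner_Integration.integrable_diff
          Bochner_Integration.integrable_mult_right bint Lint pint int' wint)
    also have "\<dots> = (\<integral>z. L z \<partial>?M) - (\<integral>z. Re (p z * ?\<phi> z) \<partial>?M) + B"
      unfolding B_def
      by (simp only: Bochner_Integration.integral_add Bochner_Integration.integral_diff
          Bochner_Integration.integrable_add Bochner_Integration.integrable_diff
          Bochner_Integration.integrable_mult_right bint Lint pint int' wint Bochner_Integration.integral_mult_right_zero)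
    finally have "c / 2 * (\<integral>z. (cmod (f z))\<^sup>2 * b z \<partial>?M) \<le> B"
      using eq by simp
    then show ?thesis
      using c by (simp add: b_def field_simps)
  qed
  show ?thesis
  proof (rule Fatou_integrable(1)[where B = "2 / c * B"])
    show "integrable ?M (\<lambda>z. (cmod (f z))\<^sup>2 * bump (eps k) \<alpha> 0 (1 - (cmod z)\<^sup>2))" for k
      by (intro integrable_mult_bump continuous_intros cont) auto
    show "(\<lambda>k. (cmod (f z))\<^sup>2 * bump (eps k) \<alpha> 0 (1 - (cmod z)\<^sup>2)) \<longlonglongrightarrow> (cmod (f z))\<^sup>2 * wt \<alpha> z"
      if "z \<in> space ?M" for z
      using bump_tendsto[OF weight_pos eps_tendsto eps_pos, of z 0 \<alpha> 0] that
      by (intro tendsto_mult_left) simp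
    show "(\<integral>z. (cmod (f z))\<^sup>2 * bump (eps k) \<alpha> 0 (1 - (cmod z)\<^sup>2) \<partial>?M) \<le> 2 / c * B" for k
      by (rule bound) simp
  qed (simp add: bump_nonneg)
qed

lemma L2_higher_deriv_imp_L2:
  assumes "f holomorphic_on unit_disk" "\<alpha> > -1"
    and "integrable (lebesgue_on unit_disk) (\<lambda>z. (cmod ((deriv ^^ m) f z))\<^sup>2 * wt \<alpha> z)"
  shows "integrable (lebesgue_on unit_disk) (\<lambda>z. (cmod (f z))\<^sup>2 * wt \<alpha> z)"
  using assms(3)
proof (induction m)
  case (Suc m)
  have "integrable (lebesgue_on unit_disk) (\<lambda>z. (cmod ((deriv ^^ m) f z))\<^sup>2 * wt \<alpha> z)"
    using Suc.prems
    by (intro L2_deriv_imp_L2[OF holomorphic_higher_deriv[OF assms(1) open_ball] assms(2)]) simp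
  then show ?case by (rule Suc.IH)
qed simp

section \<open>Moments of weak solutions\<close>

text \<open>Multiplications and derivatives are transposed onto the test function in reverse order.
  Two derivatives leave the sign unchanged; in the subtracted first-order term the single derivative
  turns the minus into a plus.\<close>

lemma Delta_op_eq:
  "Delta_op \<alpha> T \<phi> =
     T (wirtinger_dzbar (wirtinger_dz (\<lambda>z. complex_of_real (1 - (cmod z)\<^sup>2) * (- 4 * complex_of_real (1 - (cmod z)\<^sup>2) * \<phi> z))))
     + T (wirtinger_dzbar (\<lambda>z. complex_of_real (\<alpha> + 2) * cnj z * (- 4 * complex_of_real (1 - (cmod z)\<^sup>2) * \<phi> z)))"
  unfolding Delta_op_def distr_mult_def distr_diff_def distr_dz_def distr_dzbar_def by simp

section \<open>Distributions given by holomorphic functions\<close>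

lemma distr_dzbar_holomorphic:
  assumes "f holomorphic_on unit_disk" "test_function \<phi>"
  shows "distr_of f (wirtinger_dzbar \<phi>) = 0"
proof -
  have "(\<integral>z. f z * wirtinger_dzbar \<phi> z \<partial>lebesgue_on unit_disk) = - (\<integral>z. 0 * \<phi> z \<partial>lebesgue_on unit_disk)"
    by (rule integration_by_parts_disk(2)[OF holomorphic_has_wirtinger[OF assms(1)] _ _ assms(2)])
      (auto intro: holomorphic_on_imp_continuous_on holomorphic_deriv assms(1))
  then show ?thesis by (simp add: distr_of_def)
qed

lemma distr_dz_holomorphic:
  assumes "f holomorphic_on unit_disk" "test_function \<phi>"
  shows "distr_of f (wirtinger_dz \<phi>) = - distr_of (deriv f) \<phi>"
  unfolding distr_of_def
  by (rule integration_by_parts_disk(1)[OF holomorphic_has_wirtinger[OF assms(1)] _ _ assms(2)])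
    (auto intro: holomorphic_on_imp_continuous_on holomorphic_deriv assms(1))

lemma distr_dz_power_holomorphic:
  assumes "f holomorphic_on unit_disk" "test_function \<phi>"
  shows "(distr_dz ^^ m) (distr_of f) \<phi> = distr_of ((deriv ^^ m) f) \<phi>"
  using assms(2)
proof (induction m arbitrary: \<phi>)
  case (Suc m)
  have "(distr_dz ^^ Suc m) (distr_of f) \<phi> = - distr_of ((deriv ^^ m) f) (wirtinger_dz \<phi>)"
    using Suc.IH[OF test_function_wirtinger(1)[OF Suc.prems]]
    by (simp add: distr_dz_def[of "(distr_dz ^^ m) (distr_of f)"])
  also have "\<dots> = distr_of ((deriv ^^ Suc m) f) \<phi>"
    using distr_dz_holomorphic[OF holomorphic_higher_deriv[OF assms(1) open_ball] Suc.prems]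
    by simp
  finally show ?case .
qed simp

lemma distr_dz_power_cong:
  assumes "distr_eq S T" shows "distr_eq ((distr_dz ^^ m) S) ((distr_dz ^^ m) T)"
proof (induction m)
  case (Suc m)
  then show ?case
    by (auto simp: distr_eq_def distr_dz_def test_function_wirtinger(1))
qed (use assms in simp)

text \<open>Both terms of the transposed operator have an outer d/dzbar of a test function, and a
  holomorphic function annihilates these.\<close>

lemma Delta_op_holomorphic:
  assumes "f holomorphic_on unit_disk"
  shows "distr_eq (Delta_op \<alpha> (distr_of f)) (\<lambda>\<phi>. 0)"
  unfolding distr_eq_def Delta_op_eq
proof (intro allI impI)
  fix \<phi> assume \<phi>: "test_function \<phi>"
  have a: "test_function (\<lambda>z. - 4 * complex_of_real (1 - (cmod z)\<^sup>2) * \<phi> z)"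
    by (intro test_function_mult \<phi> Ck_function_mult Ck_function_const Ck_function_weight)
  have b: "test_function (\<lambda>z. complex_of_real (1 - (cmod z)\<^sup>2) * (- 4 * complex_of_real (1 - (cmod z)\<^sup>2) * \<phi> z))"
    by (intro test_function_mult[OF a] Ck_function_weight)
  have c: "test_function (\<lambda>z. complex_of_real (\<alpha> + 2) * cnj z * (- 4 * complex_of_real (1 - (cmod z)\<^sup>2) * \<phi> z))"
    by (intro test_function_mult[OF a] Ck_function_mult Ck_function_const Ck_function_cnj)
  show "distr_of f (wirtinger_dzbar (wirtinger_dz (\<lambda>z. complex_of_real (1 - (cmod z)\<^sup>2) * (- 4 * complex_of_real (1 - (cmod z)\<^sup>2) * \<phi> z))))
     + distr_of f (wirtinger_dzbar (\<lambda>z. complex_of_real (\<alpha> + 2) * cnj z * (- 4 * complex_of_real (1 - (cmod z)\<^sup>2) * \<phi> z))) = 0"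
    by (simp only: distr_dzbar_holomorphic[OF assms test_function_wirtinger(1)[OF b]]
        distr_dzbar_holomorphic[OF assms c] add_0)
qed

lemma integrable_disk_cong:
  assumes "integrable (lebesgue_on unit_disk) f" "\<And>z. z \<in> unit_disk \<Longrightarrow> f z = g z"
  shows "integrable (lebesgue_on unit_disk) g"
proof -
  have "integrable (lebesgue_on unit_disk) f = integrable (lebesgue_on unit_disk) g"
    by (rule Bochner_Integration.integrable_cong) (use assms(2) in auto)
  then show ?thesis using assms(1) by simp
qed

lemma wt_mult_minus:
  assumes "z \<in> unit_disk"
  shows "complex_of_real (wt \<gamma> z) * complex_of_real (wt (- \<gamma>) z) = 1"
proof -
  have "wt \<gamma> z * wt (- \<gamma>) z = 1"
    using weight_pos[OF assms] by (simp flip: powr_add)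
  then show ?thesis by (metis of_real_1 of_real_mult)
qed

text \<open>F \<phi> = (F x^\<alpha>) (x^(-\<alpha>) \<phi>) with x = 1 - |z|^2: the first factor is
  integrable, the second is continuous with compact support inside the disk, hence bounded.\<close>

lemma integrable_L2_test_function:
  assumes "F \<in> L2_weighted \<alpha>" "\<alpha> > -1" "test_function \<phi>"
  shows "integrable (lebesgue_on unit_disk) (\<lambda>z. F z * \<phi> z)"
proof -
  obtain K where K: "closed K" "K \<subseteq> unit_disk" "\<And>z. z \<notin> K \<Longrightarrow> \<phi> z = 0"
    using test_function_support[OF assms(3)] by metis
  define g where "g z = complex_of_real (wt (- \<alpha>) z) * \<phi> z" for z
  have "continuous_on unit_disk (\<lambda>z. complex_of_real (wt (- \<alpha>) z))"
    by (intro continuous_intros) (auto dest: weight_pos)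
  then have cont: "continuous_on UNIV g"
    unfolding g_def
    by (rule continuous_on_mult_compact_support[OF _ continuous_on_test_function[OF assms(3)] K])
  have "compact K"
    using K(1,2) bounded_subset[OF bounded_ball] by (auto simp: compact_eq_bounded_closed)
  then have "bounded (g ` K)"
    by (intro compact_imp_bounded compact_continuous_image continuous_on_subset[OF cont]) auto
  then obtain B where B: "\<forall>x \<in> g ` K. norm x \<le> B"
    unfolding bounded_iff by blast
  have gB: "norm (g z) \<le> max B 0" for z
  proof (cases "z \<in> K")
    case True
    then show ?thesis using B by fastforce
  next
    case False
    then show ?thesis using K(3) by (simp add: g_def)
  qed
  have meas: "g \<in> borel_measurable (lebesgue_on unit_disk)"
    by (intro borel_measurable_disk borel_measurable_continuous_onI cont)
  have i: "integrable (lebesgue_on unit_disk) (\<lambda>z. F z * complex_of_real (wt \<alpha> z))"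
    by (rule L2_weighted_imp_integrable[OF assms(1,2)])
  have "integrable (lebesgue_on unit_disk) (\<lambda>z. F z * complex_of_real (wt \<alpha> z) * g z)"
  proof (rule Bochner_Integration.integrable_bound)
    show "integrable (lebesgue_on unit_disk) (\<lambda>z. max B 0 * norm (F z * complex_of_real (wt \<alpha> z)))"
      using i by (intro Bochner_Integration.integrable_mult_right integrable_norm)
    show "(\<lambda>z. F z * complex_of_real (wt \<alpha> z) * g z) \<in> borel_measurable (lebesgue_on unit_disk)"
      by (intro borel_measurable_times borel_measurable_integrable[OF i] meas)
    show "AE z in lebesgue_on unit_disk. norm (F z * complex_of_real (wt \<alpha> z) * g z)
        \<le> norm (max B 0 * norm (F z * complex_of_real (wt \<alpha> z)))"
    proof (rule AE_I2)
      fix z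
      have "norm (F z * complex_of_real (wt \<alpha> z)) * norm (g z) \<le> norm (F z * complex_of_real (wt \<alpha> z)) * max B 0"
        by (intro mult_left_mono gB) auto
      then show "norm (F z * complex_of_real (wt \<alpha> z) * g z) \<le> norm (max B 0 * norm (F z * complex_of_real (wt \<alpha> z)))"
        by (simp add: norm_mult[of _ "g z"] mult.commute[of "max B 0"] abs_mult)
    qed
  qed
  then show ?thesis
  proof (rule integrable_disk_cong)
    fix z assume "z \<in> unit_disk"
    have "F z * complex_of_real (wt \<alpha> z) * g z =
        F z * (complex_of_real (wt \<alpha> z) * complex_of_real (wt (- \<alpha>) z)) * \<phi> z"
      by (simp add: g_def)
    then show "F z * complex_of_real (wt \<alpha> z) * g z = F z * \<phi> z"
      unfolding wt_mult_minus[OF \<open>z \<in> unit_disk\<close>] by simp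
  qed
qed

section \<open>Cut-off monomials and their limits\<close>

definition moncut :: "real \<Rightarrow> real \<Rightarrow> nat \<Rightarrow> nat \<Rightarrow> nat \<Rightarrow> complex \<Rightarrow> complex" where
  "moncut \<epsilon> \<beta> n a b z = z ^ a * cnj z ^ b * cutoff \<epsilon> \<beta> n z"

lemma test_function_moncut: "\<epsilon> > 0 \<Longrightarrow> test_function (moncut \<epsilon> \<beta> n a b)"
  unfolding moncut_def[abs_def] by (intro test_function_mult test_function_cutoff Ck_function_monomial)

text \<open>The truncated exponents a - 1 and b - 1 are harmless at 0, since the factor in front is
  then 0.\<close>

lemma wirtinger_moncut:
  assumes "\<epsilon> > 0"
  shows "wirtinger_dz (moncut \<epsilon> \<beta> n a b) z = of_nat a * moncut \<epsilon> \<beta> n (a - 1) b z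
      - complex_of_real \<beta> * moncut \<epsilon> (\<beta> - 1) n a (b + 1) z + of_nat n * moncut \<epsilon> \<beta> (n + 1) a (b + 1) z
      - complex_of_real \<epsilon> * moncut \<epsilon> \<beta> (n + 2) a (b + 1) z"
    and "wirtinger_dzbar (moncut \<epsilon> \<beta> n a b) z = of_nat b * moncut \<epsilon> \<beta> n a (b - 1) z
      - complex_of_real \<beta> * moncut \<epsilon> (\<beta> - 1) n (a + 1) b z + of_nat n * moncut \<epsilon> \<beta> (n + 1) (a + 1) b z
      - complex_of_real \<epsilon> * moncut \<epsilon> \<beta> (n + 2) (a + 1) b z"
proof -
  have "has_wirtinger (moncut \<epsilon> \<beta> n a b)
      (of_nat a * z ^ (a - 1) * cnj z ^ b * cutoff \<epsilon> \<beta> n z + z ^ a * cnj z ^ b * (- cnj z * cutoff' \<epsilon> \<beta> n z))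
      (of_nat b * z ^ a * cnj z ^ (b - 1) * cutoff \<epsilon> \<beta> n z + z ^ a * cnj z ^ b * (- z * cutoff' \<epsilon> \<beta> n z)) z"
    unfolding moncut_def[abs_def]
    by (rule has_wirtinger_mult[OF has_wirtinger_monomial cutoff_has_wirtinger[OF assms]])
  from has_wirtinger_imp(3,4)[OF this] show
    "wirtinger_dz (moncut \<epsilon> \<beta> n a b) z = of_nat a * moncut \<epsilon> \<beta> n (a - 1) b z
      - complex_of_real \<beta> * moncut \<epsilon> (\<beta> - 1) n a (b + 1) z + of_nat n * moncut \<epsilon> \<beta> (n + 1) a (b + 1) z
      - complex_of_real \<epsilon> * moncut \<epsilon> \<beta> (n + 2) a (b + 1) z"
    "wirtinger_dzbar (moncut \<epsilon> \<beta> n a b) z = of_nat b * moncut \<epsilon> \<beta> n a (b - 1) z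
      - complex_of_real \<beta> * moncut \<epsilon> (\<beta> - 1) n (a + 1) b z + of_nat n * moncut \<epsilon> \<beta> (n + 1) (a + 1) b z
      - complex_of_real \<epsilon> * moncut \<epsilon> \<beta> (n + 2) (a + 1) b z"
    by (simp_all add: moncut_def cutoff'_def algebra_simps)
qed

lemma moncut_bound:
  assumes "\<epsilon> > 0" "z \<in> unit_disk" "i \<le> n" "n \<le> 4" "\<beta> \<ge> \<gamma> + real (n - i)"
  shows "cmod (complex_of_real (\<epsilon> ^ i) * moncut \<epsilon> \<beta> n a b z) \<le> 256 * wt \<gamma> z"
proof -
  have z: "cmod z \<le> 1" using assms(2) by simp
  have "cmod (complex_of_real (\<epsilon> ^ i) * moncut \<epsilon> \<beta> n a b z) =
      cmod z ^ (a + b) * (\<epsilon> ^ i * bump \<epsilon> \<beta> n (1 - (cmod z)\<^sup>2))"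
    using assms(1) by (simp add: moncut_def norm_mult norm_power cmod_cutoff power_add)
  also have "\<dots> \<le> 1 * (256 * wt \<gamma> z)"
    using z assms(1) by (intro mult_mono power_le_one bump_bound assms) (auto simp: bump_nonneg)
  finally show ?thesis by simp
qed

definition moment :: "real \<Rightarrow> (complex \<Rightarrow> complex) \<Rightarrow> nat \<Rightarrow> nat \<Rightarrow> complex" where
  "moment \<beta> F a b = (\<integral>z. F z * (z ^ a * cnj z ^ b * complex_of_real (wt \<beta> z)) \<partial>lebesgue_on unit_disk)"

text \<open>Dominated convergence with the majorant 256 |F| x^\<gamma>, which does not depend on the
  cutoff parameter. The case i = 0 produces moments, the case i > 0 shows that error terms
  vanish.\<close>

lemma integral_moncut_tendsto:
  assumes F: "integrable (lebesgue_on unit_disk) (\<lambda>z. F z * complex_of_real (wt \<gamma> z))"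
    and n: "i \<le> n" "n \<le> 4" "\<beta> \<ge> \<gamma> + real (n - i)"
  shows "(\<lambda>k. \<integral>z. F z * (complex_of_real (eps k ^ i) * moncut (eps k) \<beta> n a b z) \<partial>lebesgue_on unit_disk)
    \<longlonglongrightarrow> (\<integral>z. F z * (z ^ a * cnj z ^ b * complex_of_real (0 ^ i * (wt \<beta> z * (1 / (1 - (cmod z)\<^sup>2)) ^ n))) \<partial>lebesgue_on unit_disk)"
proof (rule integral_dominated_convergence)
  let ?M = "lebesgue_on unit_disk"
  have Fm: "F \<in> borel_measurable ?M"
  proof -
    \<comment> \<open>Measurability of F is recovered from that of F x^\<gamma>, since x^\<gamma> is
      nonzero on the disk.\<close>
    have "(\<lambda>z. F z * complex_of_real (wt \<gamma> z) * complex_of_real (wt (- \<gamma>) z)) \<in> borel_measurable ?M"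
      using borel_measurable_integrable[OF F] by measurable
    also have "?this \<longleftrightarrow> F \<in> borel_measurable ?M"
    proof (rule measurable_cong)
      fix z assume "z \<in> space ?M"
      then have "complex_of_real (wt \<gamma> z) * complex_of_real (wt (- \<gamma>) z) = 1"
        by (intro wt_mult_minus) simp
      then show "F z * complex_of_real (wt \<gamma> z) * complex_of_real (wt (- \<gamma>) z) = F z"
        by (simp only: mult.assoc mult_1_right)
    qed
    finally show ?thesis .
  qed
  show "integrable ?M (\<lambda>z. 256 * norm (F z * complex_of_real (wt \<gamma> z)))"
    using F by (intro Bochner_Integration.integrable_mult_right integrable_norm)
  show "(\<lambda>z. F z * (z ^ a * cnj z ^ b * complex_of_real (0 ^ i * (wt \<beta> z * (1 / (1 - (cmod z)\<^sup>2)) ^ n)))) \<in> borel_measurable ?M"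
  proof -
    have "(\<lambda>z::complex. complex_of_real (0 ^ i * (wt \<beta> z * (1 / (1 - (cmod z)\<^sup>2)) ^ n))) \<in> borel_measurable ?M"
      by (intro borel_measurable_disk) measurable
    then show ?thesis
      using Fm by (intro borel_measurable_times monomial_measurable)
  qed
  show "(\<lambda>z. F z * (complex_of_real (eps k ^ i) * moncut (eps k) \<beta> n a b z)) \<in> borel_measurable ?M" for k
    by (intro borel_measurable_times Fm borel_measurable_disk borel_measurable_const
        borel_measurable_continuous_onI continuous_on_test_function test_function_moncut eps_pos)
  show "AE z in ?M. (\<lambda>k. F z * (complex_of_real (eps k ^ i) * moncut (eps k) \<beta> n a b z))
      \<longlonglongrightarrow> F z * (z ^ a * cnj z ^ b * complex_of_real (0 ^ i * (wt \<beta> z * (1 / (1 - (cmod z)\<^sup>2)) ^ n)))"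
  proof (rule AE_I2)
    fix z assume "z \<in> space ?M"
    then have "(\<lambda>k. eps k ^ i * bump (eps k) \<beta> n (1 - (cmod z)\<^sup>2)) \<longlonglongrightarrow> 0 ^ i * (wt \<beta> z * (1 / (1 - (cmod z)\<^sup>2)) ^ n)"
      by (intro bump_tendsto weight_pos eps_tendsto eps_pos) simp
    then have "(\<lambda>k. F z * (z ^ a * cnj z ^ b * complex_of_real (eps k ^ i * bump (eps k) \<beta> n (1 - (cmod z)\<^sup>2))))
      \<longlonglongrightarrow> F z * (z ^ a * cnj z ^ b * complex_of_real (0 ^ i * (wt \<beta> z * (1 / (1 - (cmod z)\<^sup>2)) ^ n)))"
      by (intro tendsto_mult_left tendsto_of_real)
    then show "(\<lambda>k. F z * (complex_of_real (eps k ^ i) * moncut (eps k) \<beta> n a b z))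
      \<longlonglongrightarrow> F z * (z ^ a * cnj z ^ b * complex_of_real (0 ^ i * (wt \<beta> z * (1 / (1 - (cmod z)\<^sup>2)) ^ n)))"
      by (simp only: moncut_def cutoff_def of_real_mult mult_ac)
  qed
  show "AE z in ?M. norm (F z * (complex_of_real (eps k ^ i) * moncut (eps k) \<beta> n a b z))
      \<le> 256 * norm (F z * complex_of_real (wt \<gamma> z))" for k
  proof (rule AE_I2)
    fix z assume "z \<in> space ?M"
    then have "cmod (complex_of_real (eps k ^ i) * moncut (eps k) \<beta> n a b z) \<le> 256 * wt \<gamma> z"
      by (intro moncut_bound n eps_pos) simp
    then have "cmod (F z) * cmod (complex_of_real (eps k ^ i) * moncut (eps k) \<beta> n a b z) \<le> cmod (F z) * (256 * wt \<gamma> z)"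
      by (intro mult_left_mono) auto
    then show "norm (F z * (complex_of_real (eps k ^ i) * moncut (eps k) \<beta> n a b z)) \<le> 256 * norm (F z * complex_of_real (wt \<gamma> z))"
      unfolding norm_mult[of "F z"] by simp
  qed
qed

lemma integral_moncut_tendsto_moment:
  assumes "integrable (lebesgue_on unit_disk) (\<lambda>z. F z * complex_of_real (wt \<gamma> z))" "\<beta> \<ge> \<gamma>"
  shows "(\<lambda>k. \<integral>z. F z * moncut (eps k) \<beta> 0 a b z \<partial>lebesgue_on unit_disk) \<longlonglongrightarrow> moment \<beta> F a b"
  using integral_moncut_tendsto[OF assms(1), of 0 0 \<beta> a b] assms(2) by (simp add: moment_def)

lemma integral_moncut_tendsto_0:
  assumes "integrable (lebesgue_on unit_disk) (\<lambda>z. F z * complex_of_real (wt \<gamma> z))"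
    and "0 < i" "i \<le> n" "n \<le> 4" "\<beta> \<ge> \<gamma> + real (n - i)"
  shows "(\<lambda>k. \<integral>z. F z * (complex_of_real (eps k ^ i) * moncut (eps k) \<beta> n a b z) \<partial>lebesgue_on unit_disk) \<longlonglongrightarrow> 0"
  using integral_moncut_tendsto[OF assms(1,3-5), of a b] assms(2) by (simp add: zero_power)

lemma integrable_moment:
  assumes "integrable (lebesgue_on unit_disk) (\<lambda>z. F z * complex_of_real (wt \<beta> z))"
  shows "integrable (lebesgue_on unit_disk) (\<lambda>z. F z * (z ^ a * cnj z ^ b * complex_of_real (wt \<beta> z)))"
proof -
  have "integrable (lebesgue_on unit_disk) (\<lambda>z. F z * complex_of_real (wt \<beta> z) * (z ^ a * cnj z ^ b))"
  proof (rule Bochner_Integration.integrable_bound[OF assms])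
    show "(\<lambda>z. F z * complex_of_real (wt \<beta> z) * (z ^ a * cnj z ^ b)) \<in> borel_measurable (lebesgue_on unit_disk)"
      by (intro borel_measurable_times borel_measurable_integrable[OF assms] monomial_measurable)
    show "AE z in lebesgue_on unit_disk. norm (F z * complex_of_real (wt \<beta> z) * (z ^ a * cnj z ^ b))
        \<le> norm (F z * complex_of_real (wt \<beta> z))"
    proof (rule AE_I2)
      fix z assume "z \<in> space (lebesgue_on unit_disk)"
      then have "norm (z ^ a * cnj z ^ b) \<le> 1"
        by (simp add: norm_mult norm_power power_le_one mult_le_one)
      then show "norm (F z * complex_of_real (wt \<beta> z) * (z ^ a * cnj z ^ b)) \<le> norm (F z * complex_of_real (wt \<beta> z))"
        unfolding norm_mult[of _ "z ^ a * cnj z ^ b"] by (intro mult_left_le) auto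
    qed
  qed
  then show ?thesis by (simp only: mult_ac)
qed

text \<open>The test function is \<open>- 1/4 (1 - |z|\<^sup>2)\<^sup>\<alpha> z\<^sup>a\<^sup>+\<^sup>1 cnj z\<^sup>b\<close>, cut off. The terms in which the cutoff is
  differentiated tend to 0 by dominated convergence, since \<open>F (1 - |z|\<^sup>2)\<^sup>\<alpha>\<close> is integrable.\<close>

lemma moment_recursion:
  assumes F: "F \<in> L2_weighted \<alpha>" and \<alpha>: "\<alpha> > -1"
    and weak: "distr_eq (Delta_op \<alpha> (distr_of F)) (\<lambda>\<phi>. 0)"
  shows "of_nat b * moment (\<alpha> + 1) F a (b - 1) = complex_of_real (real b + \<alpha> + 2) * moment (\<alpha> + 1) F (Suc a) b"
proof -
  let ?M = "lebesgue_on unit_disk"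
  define I where "I \<epsilon> i \<beta> n a b = (\<integral>z. F z * (complex_of_real (\<epsilon> ^ i) * moncut \<epsilon> \<beta> n a b z) \<partial>?M)" for \<epsilon> i \<beta> n a b
  have Fw: "integrable ?M (\<lambda>z. F z * complex_of_real (wt \<alpha> z))"
    by (rule L2_weighted_imp_integrable[OF F \<alpha>])
  \<comment> \<open>The exact identity for each \<epsilon>. The integrals with i = 0 become moments;
    those with n = 2, 3, 4 arise where the exponential of the cutoff was differentiated.\<close>
  have key: "of_nat (Suc a) * (of_nat b * I \<epsilon> 0 (\<alpha> + 2) 0 a (b - 1) - complex_of_real (\<alpha> + 2) * I \<epsilon> 0 (\<alpha> + 1) 0 (Suc a) b
        - I \<epsilon> 1 (\<alpha> + 2) 2 (Suc a) b)
      - (of_nat (Suc b) * I \<epsilon> 1 (\<alpha> + 2) 2 (Suc a) b - complex_of_real (\<alpha> + 2) * I \<epsilon> 1 (\<alpha> + 1) 2 (Suc (Suc a)) (Suc b)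
        + 2 * I \<epsilon> 1 (\<alpha> + 2) 3 (Suc (Suc a)) (Suc b) - I \<epsilon> 2 (\<alpha> + 2) 4 (Suc (Suc a)) (Suc b)) = 0"
    if \<epsilon>: "\<epsilon> > 0" for \<epsilon>
  proof -
    \<comment> \<open>The factor -1/4 cancels the -4 of the operator.\<close>
    define \<phi> where "\<phi> z = (- 1 / 4) * moncut \<epsilon> \<alpha> 0 (Suc a) b z" for z
    have \<phi>: "test_function \<phi>"
      unfolding \<phi>_def[abs_def] by (intro test_function_mult test_function_moncut \<epsilon> Ck_function_const)
    have cw: "complex_of_real (1 - (cmod z)\<^sup>2) * moncut \<epsilon> \<beta> n p q z = moncut \<epsilon> (\<beta> + 1) n p q z" for \<beta> n p q z
      using cutoff_mult_weight[OF \<epsilon>, of z \<beta> n] by (simp only: moncut_def mult_ac)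
    have a\<phi>: "- 4 * complex_of_real (1 - (cmod z)\<^sup>2) * \<phi> z = moncut \<epsilon> (\<alpha> + 1) 0 (Suc a) b z" for z
    proof -
      have "- 4 * w * ((- 1 / 4) * m) = w * m" for w m :: complex by simp
      then show ?thesis unfolding \<phi>_def cw[symmetric] .
    qed
    have b\<phi>: "complex_of_real (1 - (cmod z)\<^sup>2) * moncut \<epsilon> (\<alpha> + 1) 0 (Suc a) b z = moncut \<epsilon> (\<alpha> + 2) 0 (Suc a) b z" for z
      using cw[of z "\<alpha> + 1"] by (simp add: add.assoc)
    have c\<phi>: "complex_of_real (\<alpha> + 2) * cnj z * moncut \<epsilon> (\<alpha> + 1) 0 (Suc a) b z
        = complex_of_real (\<alpha> + 2) * moncut \<epsilon> (\<alpha> + 1) 0 (Suc a) (Suc b) z" for z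
      by (simp add: moncut_def)
    define X1 where "X1 = wirtinger_dzbar (moncut \<epsilon> (\<alpha> + 2) 0 a b)"
    define X2 where "X2 = wirtinger_dzbar (moncut \<epsilon> (\<alpha> + 1) 0 (Suc a) (Suc b))"
    define X3 where "X3 = wirtinger_dzbar (moncut \<epsilon> (\<alpha> + 2) 2 (Suc a) (Suc b))"
    have hw: "has_wirtinger (moncut \<epsilon> \<beta> n p q) (wirtinger_dz (moncut \<epsilon> \<beta> n p q) z) (wirtinger_dzbar (moncut \<epsilon> \<beta> n p q) z) z"
      for \<beta> n p q z by (rule test_function_has_wirtinger[OF test_function_moncut[OF \<epsilon>]])
    have dz: "wirtinger_dz (moncut \<epsilon> (\<alpha> + 2) 0 (Suc a) b) =
        (\<lambda>z. of_nat (Suc a) * moncut \<epsilon> (\<alpha> + 2) 0 a b z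
          + ((- complex_of_real (\<alpha> + 2)) * moncut \<epsilon> (\<alpha> + 1) 0 (Suc a) (Suc b) z
          + (- complex_of_real \<epsilon>) * moncut \<epsilon> (\<alpha> + 2) 2 (Suc a) (Suc b) z))"
      using wirtinger_moncut(1)[OF \<epsilon>, of "\<alpha> + 2" 0 "Suc a" b]
      by (simp add: fun_eq_iff numeral_2_eq_2 algebra_simps)
    have dzz: "wirtinger_dzbar (wirtinger_dz (moncut \<epsilon> (\<alpha> + 2) 0 (Suc a) b)) z =
        of_nat (Suc a) * X1 z - complex_of_real (\<alpha> + 2) * X2 z - complex_of_real \<epsilon> * X3 z" for z
      unfolding dz X1_def X2_def X3_def
      by (subst has_wirtinger_imp(4)[OF has_wirtinger_add[OF has_wirtinger_mult[OF has_wirtinger_const hw]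
            has_wirtinger_add[OF has_wirtinger_mult[OF has_wirtinger_const hw] has_wirtinger_mult[OF has_wirtinger_const hw]]]])
        (simp add: algebra_simps)
    have dc: "wirtinger_dzbar (\<lambda>z. complex_of_real (\<alpha> + 2) * moncut \<epsilon> (\<alpha> + 1) 0 (Suc a) (Suc b) z) z
        = complex_of_real (\<alpha> + 2) * X2 z" for z
      unfolding X2_def by (subst has_wirtinger_imp(4)[OF has_wirtinger_mult[OF has_wirtinger_const hw]]) simp
    have it: "integrable ?M (\<lambda>z. F z * X1 z)" "integrable ?M (\<lambda>z. F z * X2 z)" "integrable ?M (\<lambda>z. F z * X3 z)"
      unfolding X1_def X2_def X3_def
      by (intro integrable_L2_test_function[OF F \<alpha>] test_function_wirtinger test_function_moncut \<epsilon>)+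
    have im: "integrable ?M (\<lambda>z. F z * (complex_of_real (\<epsilon> ^ i) * moncut \<epsilon> \<beta> n p q z))" for i \<beta> n p q
      by (intro integrable_L2_test_function[OF F \<alpha>] test_function_mult test_function_moncut \<epsilon> Ck_function_const)
    have "Delta_op \<alpha> (distr_of F) \<phi> = 0"
      using weak \<phi> by (simp add: distr_eq_def)
    then have "distr_of F (wirtinger_dzbar (wirtinger_dz (moncut \<epsilon> (\<alpha> + 2) 0 (Suc a) b)))
        + distr_of F (wirtinger_dzbar (\<lambda>z. complex_of_real (\<alpha> + 2) * moncut \<epsilon> (\<alpha> + 1) 0 (Suc a) (Suc b) z)) = 0"
      unfolding Delta_op_eq a\<phi> b\<phi> c\<phi> .
    then have "(\<integral>z. of_nat (Suc a) * (F z * X1 z) - complex_of_real (\<alpha> + 2) * (F z * X2 z) - complex_of_real \<epsilon> * (F z * X3 z) \<partial>?M)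
        + (\<integral>z. complex_of_real (\<alpha> + 2) * (F z * X2 z) \<partial>?M) = 0"
      unfolding distr_of_def dzz dc by (simp only: right_diff_distrib mult_ac)
    \<comment> \<open>The two integrals of \<open>F z * X2 z\<close> cancel, which is the divergence
      form of the operator at work. What remains comes from d/dz acting on z^(a+1) and on the
      exponential.\<close>
    then have 1: "of_nat (Suc a) * (\<integral>z. F z * X1 z \<partial>?M) - complex_of_real \<epsilon> * (\<integral>z. F z * X3 z \<partial>?M) = 0"
      using it by (simp del: of_nat_Suc)
    have "(\<integral>z. F z * X1 z \<partial>?M) = (\<integral>z. of_nat b * (F z * (complex_of_real (\<epsilon> ^ 0) * moncut \<epsilon> (\<alpha> + 2) 0 a (b - 1) z))
        - complex_of_real (\<alpha> + 2) * (F z * (complex_of_real (\<epsilon> ^ 0) * moncut \<epsilon> (\<alpha> + 1) 0 (Suc a) b z))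
        - F z * (complex_of_real (\<epsilon> ^ 1) * moncut \<epsilon> (\<alpha> + 2) 2 (Suc a) b z) \<partial>?M)"
      unfolding X1_def wirtinger_moncut(2)[OF \<epsilon>]
      by (intro Bochner_Integration.integral_cong refl) (simp add: algebra_simps numeral_2_eq_2)
    also have "\<dots> = of_nat b * I \<epsilon> 0 (\<alpha> + 2) 0 a (b - 1) - complex_of_real (\<alpha> + 2) * I \<epsilon> 0 (\<alpha> + 1) 0 (Suc a) b
        - I \<epsilon> 1 (\<alpha> + 2) 2 (Suc a) b"
      unfolding I_def
      by (simp only: Bochner_Integration.integral_diff Bochner_Integration.integrable_diff
          integrable_mult_right im integral_mult_right_zero)
    finally have 2: "(\<integral>z. F z * X1 z \<partial>?M) = \<dots>" .
    have "complex_of_real \<epsilon> * (\<integral>z. F z * X3 z \<partial>?M) = (\<integral>z. complex_of_real \<epsilon> * (F z * X3 z) \<partial>?M)"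
      by simp
    also have "\<dots> = (\<integral>z. of_nat (Suc b) * (F z * (complex_of_real (\<epsilon> ^ 1) * moncut \<epsilon> (\<alpha> + 2) 2 (Suc a) b z))
        - complex_of_real (\<alpha> + 2) * (F z * (complex_of_real (\<epsilon> ^ 1) * moncut \<epsilon> (\<alpha> + 1) 2 (Suc (Suc a)) (Suc b) z))
        + 2 * (F z * (complex_of_real (\<epsilon> ^ 1) * moncut \<epsilon> (\<alpha> + 2) 3 (Suc (Suc a)) (Suc b) z))
        - F z * (complex_of_real (\<epsilon> ^ 2) * moncut \<epsilon> (\<alpha> + 2) 4 (Suc (Suc a)) (Suc b) z) \<partial>?M)"
      unfolding X3_def wirtinger_moncut(2)[OF \<epsilon>]
      by (intro Bochner_Integration.integral_cong refl) (simp add: algebra_simps power2_eq_square flip: numeral_3_eq_3)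
    also have "\<dots> = of_nat (Suc b) * I \<epsilon> 1 (\<alpha> + 2) 2 (Suc a) b - complex_of_real (\<alpha> + 2) * I \<epsilon> 1 (\<alpha> + 1) 2 (Suc (Suc a)) (Suc b)
        + 2 * I \<epsilon> 1 (\<alpha> + 2) 3 (Suc (Suc a)) (Suc b) - I \<epsilon> 2 (\<alpha> + 2) 4 (Suc (Suc a)) (Suc b)"
      unfolding I_def
      by (simp only: Bochner_Integration.integral_diff Bochner_Integration.integral_add
          Bochner_Integration.integrable_diff Bochner_Integration.integrable_add
          integrable_mult_right im integral_mult_right_zero)
    finally have 3: "complex_of_real \<epsilon> * (\<integral>z. F z * X3 z \<partial>?M) = \<dots>" .
    show ?thesis
      using 1 unfolding 2 3 .
  qed
  \<comment> \<open>For (\<beta>, n, i) = (\<alpha>+1, 2, 1), (\<alpha>+2, 3, 1) and (\<alpha>+2, 4,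
    2) the condition on \<beta> is an equality, so integrability of F x^\<alpha> is just
    enough.\<close>
  have lim0: "(\<lambda>k. I (eps k) i \<beta> n p q) \<longlonglongrightarrow> 0" if "0 < i" "i \<le> n" "n \<le> 4" "\<beta> \<ge> \<alpha> + real (n - i)" for i \<beta> n p q
    unfolding I_def by (rule integral_moncut_tendsto_0[OF Fw that])
  have limm: "(\<lambda>k. I (eps k) 0 \<beta> 0 p q) \<longlonglongrightarrow> moment \<beta> F p q" if "\<beta> \<ge> \<alpha>" for \<beta> p q
    unfolding I_def using integral_moncut_tendsto_moment[OF Fw that] by simp
  have "(\<lambda>k. of_nat (Suc a) * (of_nat b * I (eps k) 0 (\<alpha> + 2) 0 a (b - 1) - complex_of_real (\<alpha> + 2) * I (eps k) 0 (\<alpha> + 1) 0 (Suc a) b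
        - I (eps k) 1 (\<alpha> + 2) 2 (Suc a) b)
      - (of_nat (Suc b) * I (eps k) 1 (\<alpha> + 2) 2 (Suc a) b - complex_of_real (\<alpha> + 2) * I (eps k) 1 (\<alpha> + 1) 2 (Suc (Suc a)) (Suc b)
        + 2 * I (eps k) 1 (\<alpha> + 2) 3 (Suc (Suc a)) (Suc b) - I (eps k) 2 (\<alpha> + 2) 4 (Suc (Suc a)) (Suc b)))
    \<longlonglongrightarrow> of_nat (Suc a) * (of_nat b * moment (\<alpha> + 2) F a (b - 1) - complex_of_real (\<alpha> + 2) * moment (\<alpha> + 1) F (Suc a) b - 0)
      - (of_nat (Suc b) * 0 - complex_of_real (\<alpha> + 2) * 0 + 2 * 0 - 0)"
    by (intro tendsto_diff tendsto_add tendsto_mult_left lim0 limm) auto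
  then have "of_nat (Suc a) * (of_nat b * moment (\<alpha> + 2) F a (b - 1) - complex_of_real (\<alpha> + 2) * moment (\<alpha> + 1) F (Suc a) b - 0)
      - (of_nat (Suc b) * 0 - complex_of_real (\<alpha> + 2) * 0 + 2 * 0 - 0) = (0 :: complex)"
    unfolding key[OF eps_pos] by (rule LIMSEQ_unique[OF _ tendsto_const])
  \<comment> \<open>Division by a + 1, which is nonzero because the test function carries z^(a+1)
    rather than z^a.\<close>
  then have main: "of_nat b * moment (\<alpha> + 2) F a (b - 1) = complex_of_real (\<alpha> + 2) * moment (\<alpha> + 1) F (Suc a) b"
    by (simp del: of_nat_Suc)
  show ?thesis
  proof (cases b)
    case 0
    then show ?thesis using main by simp
  next
    case (Suc c)
    have Fw1: "integrable ?M (\<lambda>z. F z * complex_of_real (wt (\<alpha> + 1) z))"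
    proof (rule integrable_disk_cong)
      show "integrable ?M (\<lambda>z. F z * (z ^ 0 * cnj z ^ 0 * complex_of_real (wt \<alpha> z)) - F z * (z ^ 1 * cnj z ^ 1 * complex_of_real (wt \<alpha> z)))"
        by (intro Bochner_Integration.integrable_diff integrable_moment Fw)
      fix z assume "z \<in> unit_disk"
      then have "wt (\<alpha> + 1) z = (1 - (cmod z)\<^sup>2) * wt \<alpha> z"
        using weight_pos[of z] by (simp add: powr_add)
      then have w: "complex_of_real (wt (\<alpha> + 1) z) = (1 - z * cnj z) * complex_of_real (wt \<alpha> z)"
        by (simp only: of_real_mult of_real_weight)
      show "F z * (z ^ 0 * cnj z ^ 0 * complex_of_real (wt \<alpha> z)) - F z * (z ^ 1 * cnj z ^ 1 * complex_of_real (wt \<alpha> z))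
          = F z * complex_of_real (wt (\<alpha> + 1) z)"
        unfolding w by (simp add: algebra_simps)
    qed
    \<comment> \<open>The identity x^(\<alpha>+2) = x^(\<alpha>+1) (1 - z cnj z) trades the higher
      weight for a difference of two moments with weight x^(\<alpha>+1); the shifted one joins the
      right-hand side and turns \<alpha> + 2 into b + \<alpha> + 2.\<close>
    have "moment (\<alpha> + 2) F a c = (\<integral>z. F z * (z ^ a * cnj z ^ c * complex_of_real (wt (\<alpha> + 1) z))
        - F z * (z ^ Suc a * cnj z ^ Suc c * complex_of_real (wt (\<alpha> + 1) z)) \<partial>?M)"
      unfolding moment_def
    proof (rule Bochner_Integration.integral_cong[OF refl])
      fix z assume "z \<in> space ?M"
      then have "wt (\<alpha> + 2) z = (1 - (cmod z)\<^sup>2) * wt (\<alpha> + 1) z"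
        using weight_pos[of z] powr_add[of "1 - (cmod z)\<^sup>2" 1 "\<alpha> + 1"] by (simp add: algebra_simps)
      then have w: "complex_of_real (wt (\<alpha> + 2) z) = (1 - z * cnj z) * complex_of_real (wt (\<alpha> + 1) z)"
        by (simp only: of_real_mult of_real_weight)
      show "F z * (z ^ a * cnj z ^ c * complex_of_real (wt (\<alpha> + 2) z)) =
          F z * (z ^ a * cnj z ^ c * complex_of_real (wt (\<alpha> + 1) z))
        - F z * (z ^ Suc a * cnj z ^ Suc c * complex_of_real (wt (\<alpha> + 1) z))"
        unfolding w by (simp add: algebra_simps)
    qed
    also have "\<dots> = moment (\<alpha> + 1) F a c - moment (\<alpha> + 1) F (Suc a) (Suc c)"
      unfolding moment_def by (intro Bochner_Integration.integral_diff integrable_moment Fw1)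
    finally have "of_nat (Suc c) * (moment (\<alpha> + 1) F a c - moment (\<alpha> + 1) F (Suc a) (Suc c))
        = complex_of_real (\<alpha> + 2) * moment (\<alpha> + 1) F (Suc a) (Suc c)"
      using main Suc by simp
    then show ?thesis
      using Suc by (simp add: algebra_simps)
  qed
qed

section \<open>Functions with vanishing moments\<close>

text \<open>H is the density of a complex measure that annihilates all polynomials in z and cnj z.
  Any weight or cutoff is absorbed into H, so that plain integrability suffices.\<close>

definition moment_free :: "(complex \<Rightarrow> complex) \<Rightarrow> bool" where
  "moment_free H \<longleftrightarrow> integrable (lebesgue_on unit_disk) H \<and>
     (\<forall>a b. (\<integral>z. H z * (z ^ a * cnj z ^ b) \<partial>lebesgue_on unit_disk) = 0)"

lemma integrable_mult_monomial:
  assumes "integrable (lebesgue_on unit_disk) H"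
  shows "integrable (lebesgue_on unit_disk) (\<lambda>z. H z * (z ^ a * cnj z ^ b))"
proof (rule Bochner_Integration.integrable_bound[OF assms])
  show "(\<lambda>z. H z * (z ^ a * cnj z ^ b)) \<in> borel_measurable (lebesgue_on unit_disk)"
    by (intro borel_measurable_times borel_measurable_integrable[OF assms] monomial_measurable)
  show "AE z in lebesgue_on unit_disk. norm (H z * (z ^ a * cnj z ^ b)) \<le> norm (H z)"
  proof (rule AE_I2)
    fix z assume "z \<in> space (lebesgue_on unit_disk)"
    then have "norm (z ^ a * cnj z ^ b) \<le> 1"
      by (simp add: norm_mult norm_power power_le_one mult_le_one)
    then show "norm (H z * (z ^ a * cnj z ^ b)) \<le> norm (H z)"
      unfolding norm_mult[of _ "z ^ a * cnj z ^ b"] by (intro mult_left_le) auto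
  qed
qed

lemma moment_free_add:
  assumes "moment_free H" "moment_free G" shows "moment_free (\<lambda>z. H z + G z)"
  using assms integrable_mult_monomial[of H] integrable_mult_monomial[of G]
  by (simp add: moment_free_def distrib_right)

lemma moment_free_scale:
  assumes "moment_free H" shows "moment_free (\<lambda>z. H z * c)"
proof -
  have "(\<integral>z. H z * c * (z ^ a * cnj z ^ b) \<partial>lebesgue_on unit_disk) = 0" for a b
  proof -
    have "(\<integral>z. H z * c * (z ^ a * cnj z ^ b) \<partial>lebesgue_on unit_disk)
        = (\<integral>z. c * (H z * (z ^ a * cnj z ^ b)) \<partial>lebesgue_on unit_disk)"
      by (simp only: mult_ac)
    then show ?thesis using assms by (simp add: moment_free_def)
  qed
  then show ?thesis using assms by (simp add: moment_free_def)
qed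

lemma moment_free_mult_id:
  assumes "moment_free H"
  shows "moment_free (\<lambda>z. H z * z)" "moment_free (\<lambda>z. H z * cnj z)"
proof -
  have i: "integrable (lebesgue_on unit_disk) H"
    and 0: "(\<integral>z. H z * (z ^ a * cnj z ^ b) \<partial>lebesgue_on unit_disk) = 0" for a b
    using assms by (auto simp: moment_free_def)
  show "moment_free (\<lambda>z. H z * z)"
    using integrable_mult_monomial[OF i, of 1 0] 0[of "Suc _" _]
    by (simp add: moment_free_def mult_ac)
  show "moment_free (\<lambda>z. H z * cnj z)"
    using integrable_mult_monomial[OF i, of 0 1] 0[of _ "Suc _"]
    by (simp add: moment_free_def mult_ac)
qed

text \<open>A real-linear function of z is a combination of z and cnj z, and multiplication by
  either keeps all moments zero. The induction ranges over H because the product case multiplies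
  first by f and then by g.\<close>

lemma moment_free_mult_polynomial:
  fixes p :: "complex \<Rightarrow> real"
  assumes "real_polynomial_function p" "moment_free H"
  shows "moment_free (\<lambda>z. H z * complex_of_real (p z))"
  using assms
proof (induction p arbitrary: H rule: real_polynomial_function.induct)
  case (linear f)
  then interpret bounded_linear f by simp
  define p q where "p = f 1" and "q = f \<i>"
  have f: "f z = Re z * p + Im z * q" for z
  proof -
    have "z = Re z *\<^sub>R 1 + Im z *\<^sub>R \<i>" by (simp add: complex_eq_iff)
    then have "f z = f (Re z *\<^sub>R 1 + Im z *\<^sub>R \<i>)" by (rule arg_cong)
    also have "\<dots> = Re z * p + Im z * q" by (simp only: add scale real_scaleR_def p_def q_def)
    finally show ?thesis .
  qed
  have "complex_of_real (f z) = z * ((complex_of_real p - \<i> * complex_of_real q) / 2)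
      + cnj z * ((complex_of_real p + \<i> * complex_of_real q) / 2)" for z
    unfolding f by (simp add: complex_eq_iff field_simps)
  then have "(\<lambda>z. H z * complex_of_real (f z)) = (\<lambda>z. H z * z * ((complex_of_real p - \<i> * complex_of_real q) / 2)
      + H z * cnj z * ((complex_of_real p + \<i> * complex_of_real q) / 2))"
    by (simp add: distrib_left mult.assoc)
  then show ?case
    using linear.prems by (simp only:) (intro moment_free_add moment_free_scale moment_free_mult_id)
next
  case (const c)
  then show ?case by (intro moment_free_scale)
next
  case (add f g)
  then show ?case by (simp add: distrib_left moment_free_add)
next
  case (mult f g)
  have "moment_free (\<lambda>z. H z * complex_of_real (f z) * complex_of_real (g z))"
    by (intro mult.IH mult.prems)
  then show ?case by (simp add: mult.assoc)
qed

text \<open>Stone-Weierstrass on the closed disk: replacing g by a polynomial changes the integral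
  by at most e times the L^1 norm of H, and the polynomial contributes 0.\<close>

lemma moment_free_integral_continuous:
  fixes g :: "complex \<Rightarrow> real"
  assumes H: "moment_free H" and g: "continuous_on UNIV g"
  shows "(\<integral>z. H z * complex_of_real (g z) \<partial>lebesgue_on unit_disk) = 0"
proof -
  let ?M = "lebesgue_on unit_disk"
  have i: "integrable ?M H" using H by (simp add: moment_free_def)
  have gm: "(\<lambda>z. complex_of_real (g z)) \<in> borel_measurable ?M"
    by (intro borel_measurable_disk borel_measurable_continuous_onI continuous_intros g)
  define A where "A = (\<integral>z. norm (H z) \<partial>?M)"
  have A: "A \<ge> 0" by (simp add: A_def)
  have *: "norm (\<integral>z. H z * complex_of_real (g z) \<partial>?M) \<le> A * e" if e: "e > 0" for e
  proof -
    obtain p where p: "polynomial_function p" "\<And>z. z \<in> cball 0 1 \<Longrightarrow> norm (g z - p z) < e"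
      using Stone_Weierstrass_polynomial_function[of "cball 0 1" g e] continuous_on_subset[OF g] e by auto
    have rp: "real_polynomial_function p"
      using p(1) by (simp add: real_polynomial_function_eq)
    have mp: "moment_free (\<lambda>z. H z * complex_of_real (p z))"
      by (rule moment_free_mult_polynomial[OF rp H])
    have ip: "integrable ?M (\<lambda>z. H z * complex_of_real (p z))"
      and p0: "(\<integral>z. H z * complex_of_real (p z) \<partial>?M) = 0"
      using mp[unfolded moment_free_def, THEN conjunct1]
        mp[unfolded moment_free_def, THEN conjunct2, rule_format, of 0 0] by simp_all
    have le: "norm (H z * complex_of_real (g z) - H z * complex_of_real (p z)) \<le> norm (H z) * e"
      if "z \<in> space ?M" for z
    proof -
      have "\<bar>g z - p z\<bar> \<le> e" using p(2)[of z] that by simp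
      then have "norm (H z) * norm (complex_of_real (g z - p z)) \<le> norm (H z) * e"
        unfolding norm_of_real by (intro mult_left_mono) auto
      then show ?thesis by (simp only: of_real_diff right_diff_distrib[symmetric] norm_mult)
    qed
    have ie: "integrable ?M (\<lambda>z. norm (H z) * e)" using i by simp
    have idiff: "integrable ?M (\<lambda>z. H z * complex_of_real (g z) - H z * complex_of_real (p z))"
    proof (rule Bochner_Integration.integrable_bound[OF ie])
      show "(\<lambda>z. H z * complex_of_real (g z) - H z * complex_of_real (p z)) \<in> borel_measurable ?M"
        by (intro borel_measurable_diff borel_measurable_times gm borel_measurable_integrable[OF i]
            borel_measurable_integrable[OF ip])
      show "AE z in ?M. norm (H z * complex_of_real (g z) - H z * complex_of_real (p z)) \<le> norm (norm (H z) * e)"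
        using le e by (intro AE_I2) (simp add: abs_mult)
    qed
    have "(\<integral>z. H z * complex_of_real (g z) \<partial>?M) =
        (\<integral>z. (H z * complex_of_real (g z) - H z * complex_of_real (p z)) + H z * complex_of_real (p z) \<partial>?M)"
      by simp
    also have "\<dots> = (\<integral>z. H z * complex_of_real (g z) - H z * complex_of_real (p z) \<partial>?M)"
      unfolding Bochner_Integration.integral_add[OF idiff ip] p0 by simp
    also have "norm \<dots> \<le> (\<integral>z. norm (H z) * e \<partial>?M)"
      by (intro Bochner_Integration.integral_norm_bound_integral idiff ie le)
    also have "\<dots> = A * e" by (simp add: A_def)
    finally show ?thesis .
  qed
  have "norm (\<integral>z. H z * complex_of_real (g z) \<partial>?M) \<le> 0 + d" if "d > 0" for d
  proof -
    \<comment> \<open>A + 1 in place of A, which may be 0.\<close>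
    have "A * (d / (A + 1)) \<le> d" using A that by (simp add: field_simps)
    then show ?thesis using *[of "d / (A + 1)"] A that by (simp add: order_trans)
  qed
  then have "norm (\<integral>z. H z * complex_of_real (g z) \<partial>?M) \<le> 0"
    by (rule field_le_epsilon)
  then show ?thesis by simp
qed

text \<open>The indicator is the pointwise limit of the tents max 0 (1 - n dist(z, C)). The empty
  set is treated apart because \<open>infdist\<close> to it is 0 by convention.\<close>

lemma moment_free_integral_closed:
  assumes H: "moment_free H" and C: "closed C"
  shows "(\<integral>z. H z * complex_of_real (indicator C z) \<partial>lebesgue_on unit_disk) = 0"
proof (cases "C = {}")
  case False
  let ?M = "lebesgue_on unit_disk"
  have i: "integrable ?M H" using H by (simp add: moment_free_def)
  define g :: "nat \<Rightarrow> complex \<Rightarrow> real" where "g n z = max 0 (1 - real n * infdist z C)" for n z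
  have gc: "continuous_on UNIV (g n)" for n
    unfolding g_def by (intro continuous_intros)
  have "(\<lambda>n. \<integral>z. H z * complex_of_real (g n z) \<partial>?M) \<longlonglongrightarrow> (\<integral>z. H z * complex_of_real (indicator C z) \<partial>?M)"
  proof (rule integral_dominated_convergence)
    show "integrable ?M (\<lambda>z. norm (H z))" using i by simp
    show "(\<lambda>z. H z * complex_of_real (indicator C z)) \<in> borel_measurable ?M"
    proof -
      have "(\<lambda>z. complex_of_real (indicator C z)) \<in> borel_measurable ?M"
        using C by (intro borel_measurable_disk) measurable
      then show ?thesis by (intro borel_measurable_times borel_measurable_integrable[OF i])
    qed
    show "(\<lambda>z. H z * complex_of_real (g n z)) \<in> borel_measurable ?M" for n
      by (intro borel_measurable_times borel_measurable_integrable[OF i] borel_measurable_disk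
          borel_measurable_continuous_onI continuous_on_of_real gc)
    show "AE z in ?M. (\<lambda>n. H z * complex_of_real (g n z)) \<longlonglongrightarrow> H z * complex_of_real (indicator C z)"
    proof (rule AE_I2)
      fix z
      have "(\<lambda>n. g n z) \<longlonglongrightarrow> indicator C z"
      proof (cases "z \<in> C")
        case True
        then show ?thesis by (simp add: g_def)
      next
        case False
        then have d: "infdist z C > 0"
          using C \<open>C \<noteq> {}\<close> infdist_nonneg[of z C] in_closed_iff_infdist_zero[of C z] by linarith
        obtain N :: nat where N: "1 / infdist z C < real N" using reals_Archimedean2 by blast
        have "g n z = 0" if "n \<ge> N" for n
        proof -
          have "1 / infdist z C < real n" using N that by linarith
          then show ?thesis using d by (simp add: g_def field_simps)
        qed
        then have "\<forall>\<^sub>F n in sequentially. g n z = 0" by (auto simp: eventually_sequentially)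
        then show ?thesis using False by (simp add: tendsto_eventually)
      qed
      then show "(\<lambda>n. H z * complex_of_real (g n z)) \<longlonglongrightarrow> H z * complex_of_real (indicator C z)"
        by (intro tendsto_mult_left tendsto_of_real)
    qed
    show "AE z in ?M. norm (H z * complex_of_real (g n z)) \<le> norm (H z)" for n
    proof (rule AE_I2)
      fix z
      have "\<bar>g n z\<bar> \<le> 1" by (simp add: g_def infdist_nonneg)
      then show "norm (H z * complex_of_real (g n z)) \<le> norm (H z)"
        unfolding norm_mult norm_of_real by (intro mult_left_le) auto
    qed
  qed
  then show ?thesis
    unfolding moment_free_integral_continuous[OF H gc] by (rule LIMSEQ_unique[OF _ tendsto_const])
qed simp

text \<open>Inner regularity: a closed T inside {Re H > 0} exhausts it up to measure e. The integral
  of Re H over T is 0 while Re H > 0 on T, so T is null and the whole set has measure at most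
  e.\<close>

lemma moment_free_AE_Re_le_0:
  assumes H: "moment_free H"
  shows "AE z in lebesgue_on unit_disk. Re (H z) \<le> 0"
proof -
  let ?M = "lebesgue_on unit_disk"
  have i: "integrable ?M H" using H by (simp add: moment_free_def)
  define S where "S = {z \<in> unit_disk. Re (H z) > 0}"
  have S: "S \<in> sets lebesgue"
  proof -
    have "(\<lambda>z. Re (H z)) \<in> borel_measurable ?M"
      using i by measurable
    then have "{z \<in> space ?M. Re (H z) > 0} \<in> sets ?M" by measurable
    then have "S \<in> sets ?M" by (simp add: S_def)
    then show ?thesis by (auto simp: sets_restrict_space)
  qed
  have small: "emeasure lebesgue S \<le> ennreal e" if "e > 0" for e
  proof -
    obtain T where T: "closed T" "T \<subseteq> S" "emeasure lebesgue (S - T) < ennreal e"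
      using sets_lebesgue_inner_closed[OF S \<open>e > 0\<close>] by metis
    have Tm: "indicator T \<in> borel_measurable ?M" "T \<in> sets ?M"
      using T(1,2) by (auto intro!: borel_measurable_disk simp: sets_restrict_space_iff S_def)
    have iT: "integrable ?M (\<lambda>z. H z * complex_of_real (indicator T z))"
    proof (rule Bochner_Integration.integrable_bound[OF i])
      show "(\<lambda>z. H z * complex_of_real (indicator T z)) \<in> borel_measurable ?M"
        using Tm borel_measurable_integrable[OF i] by measurable
      show "AE z in ?M. norm (H z * complex_of_real (indicator T z)) \<le> norm (H z)"
        by (intro AE_I2) (simp add: indicator_def)
    qed
    have "(\<integral>z. Re (H z) * indicator T z \<partial>?M) = 0"
      using integral_Re[OF iT] moment_free_integral_closed[OF H T(1)] by simp
    moreover have "integrable ?M (\<lambda>z. Re (H z) * indicator T z)"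
      using integrable_Re[OF iT] by simp
    ultimately have "AE z in ?M. Re (H z) * indicator T z = 0"
      by (subst (asm) integral_nonneg_eq_0_iff_AE) (use T(2) in \<open>auto simp: S_def indicator_def intro!: AE_I2\<close>)
    then have "AE z in ?M. z \<notin> T"
      by eventually_elim (use T(2) in \<open>auto simp: S_def indicator_def split: if_splits\<close>)
    then have "emeasure ?M T = 0"
      using Tm(2) by (subst (asm) AE_iff_measurable[of T]) (use T(2) in \<open>auto simp: S_def\<close>)
    then have "emeasure lebesgue T = 0"
      using T(2) Tm(2) by (subst (asm) emeasure_restrict_space) (auto simp: S_def)
    moreover have "emeasure lebesgue S \<le> emeasure lebesgue (S - T) + emeasure lebesgue T"
    proof -
      have Tl: "T \<in> sets lebesgue" using T(1) by auto
      have "emeasure lebesgue ((S - T) \<union> T) \<le> emeasure lebesgue (S - T) + emeasure lebesgue T"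
        by (intro emeasure_subadditive sets.Diff S Tl)
      moreover have "(S - T) \<union> T = S" using T(2) by blast
      ultimately show ?thesis by simp
    qed
    ultimately show ?thesis using T(3) by simp
  qed
  have "emeasure lebesgue S \<le> 0"
    by (rule ennreal_le_epsilon) (use small in simp)
  then have "S \<in> null_sets lebesgue"
    using S by (simp add: null_sets_def)
  then have "AE z in lebesgue. z \<notin> S"
    by (rule AE_not_in)
  then have "AE z in lebesgue. z \<in> unit_disk \<longrightarrow> Re (H z) \<le> 0"
    by eventually_elim (auto simp: S_def not_less)
  then show ?thesis
    by (subst AE_restrict_space_iff) simp_all
qed

text \<open>The multiples of H by 1, -1, i and -i bound Re H and Im H from both sides.\<close>

lemma moment_free_AE_0:
  assumes "moment_free H"
  shows "AE z in lebesgue_on unit_disk. H z = 0"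
proof -
  have 1: "AE z in lebesgue_on unit_disk. Re (H z) \<le> 0"
    by (rule moment_free_AE_Re_le_0[OF assms])
  have 2: "AE z in lebesgue_on unit_disk. Re (H z * c) \<le> 0" for c
    by (rule moment_free_AE_Re_le_0[OF moment_free_scale[OF assms]])
  from 1 2[of "-1"] 2[of "\<i>"] 2[of "- \<i>"] show ?thesis
  proof eventually_elim
    case (elim z)
    then have "Re (H z) = 0" "Im (H z) = 0" by simp_all
    then show ?case by (simp only: complex_eq_iff zero_complex.sel simp_thms)
  qed
qed

section \<open>Moments of power series\<close>

text \<open>For a radial cutoff C the functions z^(a+1) cnj z^b dC/dz and z^a cnj z^(b+1) dC/dzbar
  coincide. Integrating each by parts gives (a+1) X = (b+1) X, which takes the place of rotation
  invariance.\<close>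

lemma moncut_orthogonal:
  assumes \<epsilon>: "\<epsilon> > 0" and "a \<noteq> b"
  shows "(\<integral>z. moncut \<epsilon> \<beta> n a b z \<partial>lebesgue_on unit_disk) = 0"
proof -
  let ?M = "lebesgue_on unit_disk"
  let ?X = "\<integral>z. moncut \<epsilon> \<beta> n a b z \<partial>?M"
  let ?C = "cutoff \<epsilon> \<beta> n"
  have dz: "wirtinger_dz ?C z = - cnj z * cutoff' \<epsilon> \<beta> n z" "wirtinger_dzbar ?C z = - z * cutoff' \<epsilon> \<beta> n z" for z
    by (rule has_wirtinger_imp(3,4)[OF cutoff_has_wirtinger[OF \<epsilon>]])+
  have "(\<integral>z. z ^ Suc a * cnj z ^ b * wirtinger_dz ?C z \<partial>?M)
      = - (\<integral>z. of_nat (Suc a) * z ^ (Suc a - 1) * cnj z ^ b * ?C z \<partial>?M)"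
    by (rule integration_by_parts_disk(1)[OF has_wirtinger_monomial _ _ test_function_cutoff[OF \<epsilon>]])
      (intro continuous_intros)+
  also have "\<dots> = - (\<integral>z. of_nat (Suc a) * moncut \<epsilon> \<beta> n a b z \<partial>?M)"
    by (simp only: moncut_def mult.assoc diff_Suc_1)
  finally have 1: "(\<integral>z. z ^ Suc a * cnj z ^ b * wirtinger_dz ?C z \<partial>?M) = - (of_nat (Suc a) * ?X)"
    by simp
  have "(\<integral>z. z ^ a * cnj z ^ Suc b * wirtinger_dzbar ?C z \<partial>?M)
      = - (\<integral>z. of_nat (Suc b) * z ^ a * cnj z ^ (Suc b - 1) * ?C z \<partial>?M)"
    by (rule integration_by_parts_disk(2)[OF has_wirtinger_monomial _ _ test_function_cutoff[OF \<epsilon>]])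
      (intro continuous_intros)+
  also have "\<dots> = - (\<integral>z. of_nat (Suc b) * moncut \<epsilon> \<beta> n a b z \<partial>?M)"
    by (simp only: moncut_def mult.assoc diff_Suc_1)
  finally have 2: "(\<integral>z. z ^ a * cnj z ^ Suc b * wirtinger_dzbar ?C z \<partial>?M) = - (of_nat (Suc b) * ?X)"
    by simp
  have eq: "z ^ Suc a * cnj z ^ b * wirtinger_dz ?C z = z ^ a * cnj z ^ Suc b * wirtinger_dzbar ?C z" for z
    by (simp add: dz)
  have "of_nat (Suc a) * ?X = of_nat (Suc b) * ?X"
    using 1 2 unfolding eq by (simp only: neg_equal_iff_equal)
  then show ?thesis
    using assms(2) by (simp del: of_nat_Suc)
qed

text \<open>Convergence at a point s between r and 1 gives absolute convergence at r, and the sum of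
  absolute values bounds all partial sums at once.\<close>

lemma power_series_absolute_bound:
  fixes c :: "nat \<Rightarrow> complex"
  assumes "\<And>z. z \<in> unit_disk \<Longrightarrow> (\<lambda>n. c n * z ^ n) sums f z" "0 \<le> r" "r < 1"
  obtains A where "\<And>N z. cmod z \<le> r \<Longrightarrow> cmod (\<Sum>j<N. c j * z ^ j) \<le> A"
proof -
  define s where "s = (1 + r) / 2"
  have s: "r < s" "s < 1" "0 < s" using assms(2,3) by (auto simp: s_def)
  have "summable (\<lambda>n. c n * complex_of_real s ^ n)"
    using assms(1)[of "complex_of_real s"] s by (auto simp: sums_iff)
  then have sm: "summable (\<lambda>n. norm (c n * complex_of_real r ^ n))"
    by (rule powser_insidea) (use s assms(2) in simp)
  have "cmod (\<Sum>j<N. c j * z ^ j) \<le> (\<Sum>n. norm (c n * complex_of_real r ^ n))" if "cmod z \<le> r" for N z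
  proof -
    have "cmod (\<Sum>j<N. c j * z ^ j) \<le> (\<Sum>j<N. cmod (c j * z ^ j))" by (rule norm_sum)
    also have "\<dots> \<le> (\<Sum>j<N. norm (c j * complex_of_real r ^ j))"
      using that assms(2) by (intro sum_mono) (simp add: norm_mult norm_power mult_left_mono power_mono)
    also have "\<dots> \<le> (\<Sum>n. norm (c n * complex_of_real r ^ n))"
      by (intro sum_le_suminf sm) auto
    finally show ?thesis .
  qed
  then show ?thesis using that by blast
qed

lemma power_series_disk_holomorphic:
  assumes "\<And>z. z \<in> unit_disk \<Longrightarrow> (\<lambda>n. c n * z ^ n) sums f z"
  shows "f holomorphic_on unit_disk"
  by (rule power_series_holomorphic[where a = c]) (use assms in simp)

text \<open>The cutoff lives on a disk of radius less than 1, where the partial sums are uniformly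
  bounded, so integration term by term is legitimate; orthogonality leaves only the index j = b -
  a.\<close>

lemma integral_power_series_moncut:
  assumes f: "\<And>z. z \<in> unit_disk \<Longrightarrow> (\<lambda>n. c n * z ^ n) sums f z" and \<epsilon>: "\<epsilon> > 0"
  shows "(\<integral>z. f z * moncut \<epsilon> \<beta> n a b z \<partial>lebesgue_on unit_disk) =
    (if a \<le> b then c (b - a) * (\<integral>z. moncut \<epsilon> \<beta> n b b z \<partial>lebesgue_on unit_disk) else 0)"
proof -
  let ?M = "lebesgue_on unit_disk"
  \<comment> \<open>The cutoff vanishes unless |z|^2 < 1 - \<epsilon>. The maximum with 0 covers
    \<epsilon> \<ge> 1, where the cutoff is identically zero.\<close>
  define r where "r = sqrt (max 0 (1 - \<epsilon>))"
  have r: "0 \<le> r" "r < 1" using \<epsilon> by (auto simp: r_def)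
  obtain A where A: "\<And>N z. cmod z \<le> r \<Longrightarrow> cmod (\<Sum>j<N. c j * z ^ j) \<le> A"
    using power_series_absolute_bound[OF f r] by metis
  have zr: "cmod z \<le> r" if "moncut \<epsilon> \<beta> n a b z \<noteq> 0" for z
  proof -
    have "1 - (cmod z)\<^sup>2 > \<epsilon>"
      using that by (auto simp: moncut_def cutoff_def bump_def split: if_splits)
    then have "(cmod z)\<^sup>2 \<le> max 0 (1 - \<epsilon>)" by simp
    then show ?thesis unfolding r_def by (rule real_le_rsqrt)
  qed
  have int: "integrable ?M (moncut \<epsilon> \<beta> n p q)" for p q
    using integrable_mult_test_function[OF continuous_on_const test_function_moncut[OF \<epsilon>], of 1] by simp
  have m: "moncut \<epsilon> \<beta> n p q \<in> borel_measurable ?M" for p q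
    using int by (rule borel_measurable_integrable)
  have "(\<lambda>N. \<integral>z. (\<Sum>j<N. c j * z ^ j) * moncut \<epsilon> \<beta> n a b z \<partial>?M) \<longlonglongrightarrow> (\<integral>z. f z * moncut \<epsilon> \<beta> n a b z \<partial>?M)"
  proof (rule integral_dominated_convergence)
    show "integrable ?M (\<lambda>z. A * norm (moncut \<epsilon> \<beta> n a b z))"
      by (intro Bochner_Integration.integrable_mult_right integrable_norm int)
    show "(\<lambda>z. f z * moncut \<epsilon> \<beta> n a b z) \<in> borel_measurable ?M"
      by (intro borel_measurable_times m holomorphic_measurable_disk power_series_disk_holomorphic[OF f])
    show "(\<lambda>z. (\<Sum>j<N. c j * z ^ j) * moncut \<epsilon> \<beta> n a b z) \<in> borel_measurable ?M" for N
      by (intro borel_measurable_times m borel_measurable_disk borel_measurable_continuous_onI continuous_intros)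
    show "AE z in ?M. (\<lambda>N. (\<Sum>j<N. c j * z ^ j) * moncut \<epsilon> \<beta> n a b z) \<longlonglongrightarrow> f z * moncut \<epsilon> \<beta> n a b z"
      using f by (intro AE_I2 tendsto_mult_right) (simp add: sums_def)
    show "AE z in ?M. norm ((\<Sum>j<N. c j * z ^ j) * moncut \<epsilon> \<beta> n a b z) \<le> A * norm (moncut \<epsilon> \<beta> n a b z)" for N
    proof (rule AE_I2)
      fix z
      show "norm ((\<Sum>j<N. c j * z ^ j) * moncut \<epsilon> \<beta> n a b z) \<le> A * norm (moncut \<epsilon> \<beta> n a b z)"
        using A[OF zr] by (cases "moncut \<epsilon> \<beta> n a b z = 0") (auto simp: norm_mult intro: mult_right_mono)
    qed
  qed
  moreover have "(\<integral>z. (\<Sum>j<N. c j * z ^ j) * moncut \<epsilon> \<beta> n a b z \<partial>?M) =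
      (if a \<le> b then c (b - a) * (\<integral>z. moncut \<epsilon> \<beta> n b b z \<partial>?M) else 0)" if N: "N > b" for N
  proof -
    have "(\<integral>z. (\<Sum>j<N. c j * z ^ j) * moncut \<epsilon> \<beta> n a b z \<partial>?M) = (\<integral>z. (\<Sum>j<N. c j * moncut \<epsilon> \<beta> n (j + a) b z) \<partial>?M)"
      unfolding moncut_def sum_distrib_right power_add by (simp only: mult_ac)
    also have "\<dots> = (\<Sum>j<N. c j * (\<integral>z. moncut \<epsilon> \<beta> n (j + a) b z \<partial>?M))"
      using int by (simp add: Bochner_Integration.integral_sum)
    also have "\<dots> = (\<Sum>j<N. if a \<le> b \<and> j = b - a then c (b - a) * (\<integral>z. moncut \<epsilon> \<beta> n b b z \<partial>?M) else 0)"
    proof (rule sum.cong[OF refl])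
      fix j
      show "c j * (\<integral>z. moncut \<epsilon> \<beta> n (j + a) b z \<partial>?M) =
          (if a \<le> b \<and> j = b - a then c (b - a) * (\<integral>z. moncut \<epsilon> \<beta> n b b z \<partial>?M) else 0)"
      proof (cases "j + a = b")
        case False
        then have "\<not> (a \<le> b \<and> j = b - a)" by auto
        then show ?thesis
          by (simp only: moncut_orthogonal[OF \<epsilon> False] mult_zero_right if_False)
      qed auto
    qed
    also have "\<dots> = (if a \<le> b then c (b - a) * (\<integral>z. moncut \<epsilon> \<beta> n b b z \<partial>?M) else 0)"
      using N by (cases "a \<le> b") auto
    finally show ?thesis .
  qed
  then have "\<forall>\<^sub>F N in sequentially. (\<integral>z. (\<Sum>j<N. c j * z ^ j) * moncut \<epsilon> \<beta> n a b z \<partial>?M) =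
      (if a \<le> b then c (b - a) * (\<integral>z. moncut \<epsilon> \<beta> n b b z \<partial>?M) else 0)"
    unfolding eventually_sequentially by (intro exI[of _ "Suc b"]) auto
  then have "(\<lambda>N. \<integral>z. (\<Sum>j<N. c j * z ^ j) * moncut \<epsilon> \<beta> n a b z \<partial>?M) \<longlonglongrightarrow>
      (if a \<le> b then c (b - a) * (\<integral>z. moncut \<epsilon> \<beta> n b b z \<partial>?M) else 0)"
    by (rule tendsto_eventually)
  ultimately show ?thesis by (rule LIMSEQ_unique)
qed

section \<open>Moments and norms in the weighted space\<close>

lemma moment_one_orthogonal:
  assumes "\<beta> > -1" "a \<noteq> b" shows "moment \<beta> (\<lambda>_. 1) a b = 0"
proof -
  have "integrable (lebesgue_on unit_disk) (\<lambda>z. 1 * complex_of_real (wt \<beta> z))"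
    using integrable_wt[OF assms(1)] by simp
  from integral_moncut_tendsto_moment[OF this order_refl, of a b]
  have "(\<lambda>k. 0) \<longlonglongrightarrow> moment \<beta> (\<lambda>_. 1) a b"
    using moncut_orthogonal[OF eps_pos assms(2)] by simp
  then show ?thesis using LIMSEQ_unique tendsto_const by blast
qed

text \<open>This is the square of the norm of z^j, not the norm itself.\<close>

definition monomial_norm :: "real \<Rightarrow> nat \<Rightarrow> real" where
  "monomial_norm \<beta> j = (\<integral>z. cmod z ^ (2 * j) * wt \<beta> z \<partial>lebesgue_on unit_disk)"

lemma moment_one_diagonal: "moment \<beta> (\<lambda>_. 1) j j = complex_of_real (monomial_norm \<beta> j)"
proof -
  have "z ^ j * cnj z ^ j = complex_of_real (cmod z ^ (2 * j))" for z
    by (simp only: power_mult of_real_power[of "(cmod z)\<^sup>2"] complex_norm_square power_mult_distrib)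
  then show ?thesis
    unfolding moment_def monomial_norm_def by (simp only: of_real_mult[symmetric] mult_1_left integral_complex_of_real)
qed

text \<open>Sum and integral are exchanged under the cutoff, away from the circle. The cutoff is
  then removed by dominated convergence, for which integrability of f x^\<beta> suffices.\<close>

lemma moment_power_series:
  assumes "\<beta> > -1" and f: "\<And>z. z \<in> unit_disk \<Longrightarrow> (\<lambda>n. c n * z ^ n) sums f z"
    and int: "integrable (lebesgue_on unit_disk) (\<lambda>z. f z * complex_of_real (wt \<beta> z))"
  shows "moment \<beta> f a b = (if a \<le> b then c (b - a) * complex_of_real (monomial_norm \<beta> b) else 0)"
proof -
  have "integrable (lebesgue_on unit_disk) (\<lambda>z. 1 * complex_of_real (wt \<beta> z))"
    using integrable_wt[OF assms(1)] by simp
  from integral_moncut_tendsto_moment[OF this order_refl, of b b]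
  have 1: "(\<lambda>k. \<integral>z. moncut (eps k) \<beta> 0 b b z \<partial>lebesgue_on unit_disk) \<longlonglongrightarrow> complex_of_real (monomial_norm \<beta> b)"
    by (simp add: moment_one_diagonal)
  have 2: "(\<lambda>k. if a \<le> b then c (b - a) * (\<integral>z. moncut (eps k) \<beta> 0 b b z \<partial>lebesgue_on unit_disk) else 0)
      \<longlonglongrightarrow> (if a \<le> b then c (b - a) * complex_of_real (monomial_norm \<beta> b) else 0)"
    using tendsto_mult_left[OF 1] by (cases "a \<le> b") auto
  have "(\<lambda>k. if a \<le> b then c (b - a) * (\<integral>z. moncut (eps k) \<beta> 0 b b z \<partial>lebesgue_on unit_disk) else 0)
      \<longlonglongrightarrow> moment \<beta> f a b"
  proof -
    have "(\<integral>z. f z * moncut (eps k) \<beta> 0 a b z \<partial>lebesgue_on unit_disk) =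
      (if a \<le> b then c (b - a) * (\<integral>z. moncut (eps k) \<beta> 0 b b z \<partial>lebesgue_on unit_disk) else 0)" for k
      by (rule integral_power_series_moncut[OF f eps_pos])
    with integral_moncut_tendsto_moment[OF int order_refl, of a b] show ?thesis
      by (simp only:)
  qed
  then show ?thesis using 2 by (rule LIMSEQ_unique)
qed

lemma integrable_monomial_norm:
  assumes "\<beta> > -1"
  shows "integrable (lebesgue_on unit_disk) (\<lambda>z. cmod z ^ (2 * j) * wt \<beta> z)"
proof (rule Bochner_Integration.integrable_bound[OF integrable_wt[OF assms]])
  show "(\<lambda>z::complex. cmod z ^ (2 * j) * wt \<beta> z) \<in> borel_measurable (lebesgue_on unit_disk)"
    by (intro borel_measurable_disk) measurable
  show "AE z in lebesgue_on unit_disk. norm (cmod z ^ (2 * j) * wt \<beta> z) \<le> norm (wt \<beta> z)"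
    by (rule AE_I2) (simp add: abs_mult mult_left_le_one_le power_le_one)
qed

text \<open>On the annulus s < |z| < 1 one has |z|^(2j) \<ge> s^(2j), and C is the weighted area of
  the annulus. Since s may be any number below 1, this will give convergence of the power series in
  the whole disk.\<close>

lemma monomial_norm_lower_bound:
  assumes "\<beta> > -1" "0 \<le> s" "s < 1"
  obtains C where "C > 0" "\<And>j. C * s ^ (2 * j) \<le> monomial_norm \<beta> j"
proof
  let ?M = "lebesgue_on unit_disk"
  let ?A = "{z::complex. cmod z > s}"
  have op: "open ?A" by (intro open_Collect_less continuous_intros)
  have i: "integrable ?M (\<lambda>z. indicator ?A z * wt \<beta> z)"
  proof (rule Bochner_Integration.integrable_bound[OF integrable_wt[OF assms(1)]])
    show "(\<lambda>z::complex. indicator ?A z * wt \<beta> z) \<in> borel_measurable ?M"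
      using op by (intro borel_measurable_disk) measurable
  qed (auto simp: indicator_def)
  define C where "C = (\<integral>z. indicator ?A z * wt \<beta> z \<partial>?M)"
  have "C \<noteq> 0"
  proof
    assume "C = 0"
    then have "AE z in ?M. indicator ?A z * wt \<beta> z = 0"
      unfolding C_def by (subst (asm) integral_nonneg_eq_0_iff_AE[OF i]) auto
    then have "AE z in lebesgue. z \<in> unit_disk \<longrightarrow> indicator ?A z * wt \<beta> z = 0"
      by (subst (asm) AE_restrict_space_iff) auto
    then have "AE z in lebesgue. z \<notin> unit_disk \<inter> ?A"
    proof eventually_elim
      case (elim z)
      then show ?case using weight_pos[of z] by (auto simp: indicator_def)
    qed
    moreover have o: "open (unit_disk \<inter> ?A)" using op by (intro open_Int) auto
    then have "unit_disk \<inter> ?A \<in> sets lebesgue"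
      by (intro sets_completionI_sets) simp
    ultimately have "negligible (unit_disk \<inter> ?A)"
      unfolding negligible_iff_null_sets by (subst AE_iff_null_sets)
    then have "unit_disk \<inter> ?A = {}"
      using o open_not_negligible by blast
    \<comment> \<open>The midpoint of s and 1 shows that the open annulus is nonempty, hence not
      negligible.\<close>
    moreover have "cmod (complex_of_real ((1 + s) / 2)) = (1 + s) / 2"
      using assms(2) by (simp only: norm_of_real) simp
    then have "complex_of_real ((1 + s) / 2) \<in> unit_disk \<inter> ?A"
      using assms(3) by (simp only: mem_ball_0 Int_iff mem_Collect_eq) simp
    ultimately show False by blast
  qed
  moreover have "C \<ge> 0" unfolding C_def by (intro integral_nonneg_AE AE_I2) simp
  ultimately show "C > 0" by simp
  show "C * s ^ (2 * j) \<le> monomial_norm \<beta> j" for j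
  proof -
    have "C * s ^ (2 * j) = (\<integral>z. indicator ?A z * wt \<beta> z * s ^ (2 * j) \<partial>?M)"
      using i by (simp add: C_def)
    also have "\<dots> \<le> monomial_norm \<beta> j"
      unfolding monomial_norm_def
    proof (rule integral_mono)
      show "indicator ?A z * wt \<beta> z * s ^ (2 * j) \<le> cmod z ^ (2 * j) * wt \<beta> z" for z
        using assms(2) by (auto simp: indicator_def mult.commute intro!: mult_right_mono power_mono)
    qed (use i integrable_monomial_norm[OF assms(1)] in auto)
    finally show ?thesis .
  qed
qed

lemma monomial_norm_pos: "\<beta> > -1 \<Longrightarrow> monomial_norm \<beta> j > 0"
proof -
  assume "\<beta> > -1"
  then obtain C where "C > 0" "C * (1/2) ^ (2 * j) \<le> monomial_norm \<beta> j"
    using monomial_norm_lower_bound[of \<beta> "1/2"] by (metis divide_less_eq_1_pos half_gt_zero_iff less_eq_real_def one_less_numeral_iff semiring_norm(76) zero_less_numeral zero_less_one)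
  then show ?thesis by (smt (verit) mult_pos_pos zero_less_power half_gt_zero_iff zero_less_one)
qed

section \<open>Weak solutions are holomorphic\<close>

lemma L2_weighted_mono:
  assumes "F \<in> L2_weighted \<alpha>" "\<alpha> \<le> \<beta>"
  shows "F \<in> L2_weighted \<beta>"
proof -
  have Fm: "F \<in> borel_measurable (lebesgue_on unit_disk)"
    and i: "integrable (lebesgue_on unit_disk) (\<lambda>z. (cmod (F z))\<^sup>2 * wt \<alpha> z)"
    using assms(1) by (auto simp: L2_weighted_iff)
  have "integrable (lebesgue_on unit_disk) (\<lambda>z. (cmod (F z))\<^sup>2 * wt \<beta> z)"
  proof (rule Bochner_Integration.integrable_bound[OF i])
    show "(\<lambda>z. (cmod (F z))\<^sup>2 * wt \<beta> z) \<in> borel_measurable (lebesgue_on unit_disk)"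
      using Fm by measurable
    show "AE z in lebesgue_on unit_disk. norm ((cmod (F z))\<^sup>2 * wt \<beta> z) \<le> norm ((cmod (F z))\<^sup>2 * wt \<alpha> z)"
    proof (rule AE_I2)
      fix z assume "z \<in> space (lebesgue_on unit_disk)"
      then have "wt \<beta> z \<le> wt \<alpha> z"
        using weight_pos[of z] assms(2) by (intro powr_mono') auto
      then show "norm ((cmod (F z))\<^sup>2 * wt \<beta> z) \<le> norm ((cmod (F z))\<^sup>2 * wt \<alpha> z)"
        by (simp add: abs_mult mult_left_mono)
    qed
  qed
  then show ?thesis using Fm by (simp add: L2_weighted_iff)
qed

lemma one_L2_weighted: "\<alpha> > -1 \<Longrightarrow> (\<lambda>_. 1) \<in> L2_weighted \<alpha>"
  by (simp add: L2_weighted_iff integrable_wt)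

text \<open>The constant 1 is holomorphic, hence a weak solution; its moment recursion with a = j
  and b = j + 1 is the ratio of consecutive Beta integrals, obtained without computing them.\<close>

lemma monomial_norm_recursion:
  assumes "\<alpha> > -1"
  shows "of_nat (Suc j) * complex_of_real (monomial_norm (\<alpha> + 1) j)
    = complex_of_real (real (Suc j) + \<alpha> + 2) * complex_of_real (monomial_norm (\<alpha> + 1) (Suc j))"
  using moment_recursion[OF one_L2_weighted[OF assms] assms Delta_op_holomorphic, of "Suc j" j]
  by (simp add: moment_one_diagonal)

text \<open>The recursion moves along a diagonal of constant a - b. For a > b the diagonal starts at
  b = 0, where the factor b annihilates the left side; the coefficient b + \<alpha> + 2 is
  positive.\<close>

lemma moment_eq_0:
  assumes "F \<in> L2_weighted \<alpha>" "\<alpha> > -1" "distr_eq (Delta_op \<alpha> (distr_of F)) (\<lambda>\<phi>. 0)" "b < a"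
  shows "moment (\<alpha> + 1) F a b = 0"
  using assms(4)
proof (induction b arbitrary: a)
  case 0
  then obtain c where "a = Suc c" by (cases a) auto
  moreover have "complex_of_real (\<alpha> + 2) \<noteq> 0" using assms(2) by (simp del: of_real_add)
  ultimately show ?case
    using moment_recursion[OF assms(1-3), of 0 c] by simp
next
  case (Suc b)
  then obtain c where c: "a = Suc c" "b < c" by (cases a) auto
  have "complex_of_real (real (Suc b) + \<alpha> + 2) \<noteq> 0" using assms(2) by (simp del: of_real_add of_nat_Suc)
  then show ?case
    using moment_recursion[OF assms(1-3), of "Suc b" c] Suc.IH[OF c(2)] c(1) by simp
qed

text \<open>Along a diagonal the moments of F and the squared norms of the monomials obey the same
  two-term recursion, so their ratio is constant.\<close>

lemma moment_above_diagonal: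
  assumes "F \<in> L2_weighted \<alpha>" "\<alpha> > -1" "distr_eq (Delta_op \<alpha> (distr_of F)) (\<lambda>\<phi>. 0)"
  shows "moment (\<alpha> + 1) F a (a + j) * complex_of_real (monomial_norm (\<alpha> + 1) j) =
    moment (\<alpha> + 1) F 0 j * complex_of_real (monomial_norm (\<alpha> + 1) (a + j))"
proof (induction a)
  case (Suc a)
  define k where "k = complex_of_real (real (Suc (a + j)) + \<alpha> + 2)"
  have k: "k \<noteq> 0" using assms(2) unfolding k_def of_real_eq_0_iff by simp
  define N where "N i = complex_of_real (monomial_norm (\<alpha> + 1) i)" for i
  have 1: "of_nat (Suc (a + j)) * moment (\<alpha> + 1) F a (a + j) = k * moment (\<alpha> + 1) F (Suc a) (Suc a + j)"
    using moment_recursion[OF assms, of "Suc (a + j)" a] by (simp add: k_def)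
  have 2: "of_nat (Suc (a + j)) * N (a + j) = k * N (Suc a + j)"
    using monomial_norm_recursion[OF assms(2), of "a + j"] by (simp add: k_def N_def)
  have "k * (moment (\<alpha> + 1) F (Suc a) (Suc a + j) * N j) =
      of_nat (Suc (a + j)) * (moment (\<alpha> + 1) F a (a + j) * N j)"
    using 1 by (simp add: mult.assoc[symmetric] del: of_nat_Suc)
  also have "\<dots> = of_nat (Suc (a + j)) * (moment (\<alpha> + 1) F 0 j * N (a + j))"
    using Suc.IH by (simp add: N_def)
  also have "\<dots> = moment (\<alpha> + 1) F 0 j * (of_nat (Suc (a + j)) * N (a + j))"
    by (simp only: mult_ac)
  also have "\<dots> = k * (moment (\<alpha> + 1) F 0 j * N (Suc a + j))"
    unfolding 2 by (simp only: mult_ac)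
  finally show ?case using k unfolding N_def by simp
qed simp

text \<open>By the choice of c, F pairs with the partial sum S exactly as S pairs with itself. With
  Q and A the squared norms of S and F, Q = Re <F, S> \<le> A/2 + Q/2, hence Q \<le> A.\<close>

lemma bessel_inequality:
  assumes F: "F \<in> L2_weighted \<beta>" and \<beta>: "\<beta> > -1"
    and c: "\<And>j. c j * complex_of_real (monomial_norm \<beta> j) = moment \<beta> F 0 j"
  defines "S \<equiv> \<lambda>n z. \<Sum>j<n. c j * z ^ j"
  shows "integrable (lebesgue_on unit_disk) (\<lambda>z. (cmod (S n z))\<^sup>2 * wt \<beta> z)"
    and "(\<integral>z. (cmod (S n z))\<^sup>2 * wt \<beta> z \<partial>lebesgue_on unit_disk) = (\<Sum>j<n. (cmod (c j))\<^sup>2 * monomial_norm \<beta> j)"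
    and "(\<integral>z. (cmod (S n z))\<^sup>2 * wt \<beta> z \<partial>lebesgue_on unit_disk) \<le> (\<integral>z. (cmod (F z))\<^sup>2 * wt \<beta> z \<partial>lebesgue_on unit_disk)"
proof -
  let ?M = "lebesgue_on unit_disk"
  define Q where "Q = (\<Sum>j<n. (cmod (c j))\<^sup>2 * monomial_norm \<beta> j)"
  define A where "A = (\<integral>z. (cmod (F z))\<^sup>2 * wt \<beta> z \<partial>?M)"
  have Sc: "continuous_on UNIV (S n)" unfolding S_def by (intro continuous_intros)
  have i1: "integrable ?M (\<lambda>z. 1 * complex_of_real (wt \<beta> z))"
    using integrable_wt[OF \<beta>] by simp
  have iF2: "integrable ?M (\<lambda>z. (cmod (F z))\<^sup>2 * wt \<beta> z)" using F by (simp add: L2_weighted_iff)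
  have iF: "integrable ?M (\<lambda>z. F z * complex_of_real (wt \<beta> z))"
    by (rule L2_weighted_imp_integrable[OF F \<beta>])
  have iS: "integrable ?M (\<lambda>z. S n z * complex_of_real (wt \<beta> z))"
  proof -
    have "integrable ?M (\<lambda>z. \<Sum>j<n. c j * (1 * (z ^ j * cnj z ^ 0 * complex_of_real (wt \<beta> z))))"
      by (intro Bochner_Integration.integrable_sum Bochner_Integration.integrable_mult_right integrable_moment i1)
    then show ?thesis by (simp add: S_def sum_distrib_right mult.assoc)
  qed
  have pair: "integrable ?M (\<lambda>z. G z * cnj (S n z) * complex_of_real (wt \<beta> z))"
      "(\<integral>z. G z * cnj (S n z) * complex_of_real (wt \<beta> z) \<partial>?M) = (\<Sum>j<n. cnj (c j) * moment \<beta> G 0 j)"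
    if "integrable ?M (\<lambda>z. G z * complex_of_real (wt \<beta> z))" for G
  proof -
    have e: "G z * cnj (S n z) * complex_of_real (wt \<beta> z) =
        (\<Sum>j<n. cnj (c j) * (G z * (z ^ 0 * cnj z ^ j * complex_of_real (wt \<beta> z))))" for z
      unfolding S_def cnj_sum sum_distrib_left sum_distrib_right by (simp add: mult_ac)
    show "integrable ?M (\<lambda>z. G z * cnj (S n z) * complex_of_real (wt \<beta> z))"
      unfolding e by (intro Bochner_Integration.integrable_sum Bochner_Integration.integrable_mult_right integrable_moment that)
    show "(\<integral>z. G z * cnj (S n z) * complex_of_real (wt \<beta> z) \<partial>?M) = (\<Sum>j<n. cnj (c j) * moment \<beta> G 0 j)"
      unfolding e moment_def
      by (subst Bochner_Integration.integral_sum)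
        (intro Bochner_Integration.integrable_mult_right integrable_moment that, simp)
  qed
  have mS: "moment \<beta> (S n) 0 j = c j * complex_of_real (monomial_norm \<beta> j)" if "j < n" for j
  proof -
    have "moment \<beta> (S n) 0 j = (\<integral>z. (\<Sum>i<n. c i * (1 * (z ^ i * cnj z ^ j * complex_of_real (wt \<beta> z)))) \<partial>?M)"
      unfolding moment_def S_def sum_distrib_right by (simp add: mult_ac)
    also have "\<dots> = (\<Sum>i<n. c i * moment \<beta> (\<lambda>_. 1) i j)"
      unfolding moment_def
      by (subst Bochner_Integration.integral_sum)
        (intro Bochner_Integration.integrable_mult_right integrable_moment i1, simp)
    also have "\<dots> = (\<Sum>i<n. if i = j then c j * complex_of_real (monomial_norm \<beta> j) else 0)"
      by (intro sum.cong refl) (simp add: moment_one_diagonal moment_one_orthogonal[OF \<beta>])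
    also have "\<dots> = c j * complex_of_real (monomial_norm \<beta> j)"
      using that by simp
    finally show ?thesis .
  qed
  have Q: "complex_of_real Q = (\<Sum>j<n. cnj (c j) * (c j * complex_of_real (monomial_norm \<beta> j)))"
    by (simp add: Q_def complex_norm_square mult_ac del: of_real_power)
  have sq: "S n z * cnj (S n z) * complex_of_real (wt \<beta> z) = complex_of_real ((cmod (S n z))\<^sup>2 * wt \<beta> z)" for z
    by (simp only: of_real_mult complex_norm_square)
  have "integrable ?M (\<lambda>z. complex_of_real ((cmod (S n z))\<^sup>2 * wt \<beta> z))"
    using pair(1)[OF iS] unfolding sq .
  from integrable_Re[OF this] show int: "integrable ?M (\<lambda>z. (cmod (S n z))\<^sup>2 * wt \<beta> z)" by simp
  have "complex_of_real (\<integral>z. (cmod (S n z))\<^sup>2 * wt \<beta> z \<partial>?M) = complex_of_real Q"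
    using pair(2)[OF iS] unfolding sq Q integral_complex_of_real by (simp add: mS)
  then show norm: "(\<integral>z. (cmod (S n z))\<^sup>2 * wt \<beta> z \<partial>?M) = (\<Sum>j<n. (cmod (c j))\<^sup>2 * monomial_norm \<beta> j)"
    unfolding Q_def[symmetric] of_real_eq_iff .
  have "complex_of_real Q = (\<integral>z. F z * cnj (S n z) * complex_of_real (wt \<beta> z) \<partial>?M)"
    unfolding pair(2)[OF iF] Q by (simp add: c)
  then have "Q = Re (\<integral>z. F z * cnj (S n z) * complex_of_real (wt \<beta> z) \<partial>?M)"
    by (metis Re_complex_of_real)
  also have "\<dots> = (\<integral>z. Re (F z * cnj (S n z) * complex_of_real (wt \<beta> z)) \<partial>?M)"
    by (rule integral_Re[symmetric, OF pair(1)[OF iF]])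
  also have "\<dots> \<le> (\<integral>z. 1/2 * ((cmod (F z))\<^sup>2 * wt \<beta> z) + 1/2 * ((cmod (S n z))\<^sup>2 * wt \<beta> z) \<partial>?M)"
  proof (rule integral_mono)
    show "integrable ?M (\<lambda>z. Re (F z * cnj (S n z) * complex_of_real (wt \<beta> z)))"
      by (rule integrable_Re[OF pair(1)[OF iF]])
    show "integrable ?M (\<lambda>z. 1/2 * ((cmod (F z))\<^sup>2 * wt \<beta> z) + 1/2 * ((cmod (S n z))\<^sup>2 * wt \<beta> z))"
      by (intro Bochner_Integration.integrable_add Bochner_Integration.integrable_mult_right iF2 int)
    show "Re (F z * cnj (S n z) * complex_of_real (wt \<beta> z)) \<le> 1/2 * ((cmod (F z))\<^sup>2 * wt \<beta> z) + 1/2 * ((cmod (S n z))\<^sup>2 * wt \<beta> z)" for z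
    proof -
      have "Re (F z * cnj (S n z)) \<le> cmod (F z * cnj (S n z))" by (rule complex_Re_le_cmod)
      also have "\<dots> = cmod (F z) * cmod (S n z)" by (simp add: norm_mult)
      also have "\<dots> \<le> 1/2 * (cmod (F z))\<^sup>2 + 1/2 * (cmod (S n z))\<^sup>2"
        using sum_squares_bound[of "cmod (F z)" "cmod (S n z)"] by simp
      finally have "Re (F z * cnj (S n z)) * wt \<beta> z \<le> (1/2 * (cmod (F z))\<^sup>2 + 1/2 * (cmod (S n z))\<^sup>2) * wt \<beta> z"
        by (intro mult_right_mono) auto
      then show ?thesis by (simp add: algebra_simps)
    qed
  qed
  also have "\<dots> = 1/2 * A + 1/2 * Q"
    unfolding A_def Q_def norm[symmetric]
    by (simp only: Bochner_Integration.integral_add Bochner_Integration.integrable_mult_right iF2 int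
        Bochner_Integration.integral_mult_right_zero)
  finally show "(\<integral>z. (cmod (S n z))\<^sup>2 * wt \<beta> z \<partial>?M) \<le> (\<integral>z. (cmod (F z))\<^sup>2 * wt \<beta> z \<partial>?M)"
    unfolding norm Q_def[symmetric] A_def[symmetric] by simp
qed

lemma weak_solution_imp_holomorphic:
  assumes F: "F \<in> L2_weighted \<alpha>" and \<alpha>: "\<alpha> > -1"
    and weak: "distr_eq (Delta_op \<alpha> (distr_of F)) (\<lambda>\<phi>. 0)"
  obtains f where "f holomorphic_on unit_disk" "AE z in lebesgue_on unit_disk. F z = f z"
proof -
  let ?M = "lebesgue_on unit_disk"
  \<comment> \<open>The weight exponent of the moment recursion. F lies in this larger space because
    1 - |z|^2 \<le> 1.\<close>
  define \<beta> where "\<beta> = \<alpha> + 1"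
  have \<beta>: "\<beta> > -1" using \<alpha> by (simp add: \<beta>_def)
  define N where "N j = monomial_norm \<beta> j" for j
  have N: "N j > 0" for j unfolding N_def by (rule monomial_norm_pos[OF \<beta>])
  define c where "c j = moment \<beta> F 0 j / complex_of_real (N j)" for j
  have c: "c j * complex_of_real (monomial_norm \<beta> j) = moment \<beta> F 0 j" for j
    using N[of j] by (simp add: c_def N_def)
  have F\<beta>: "F \<in> L2_weighted \<beta>"
    by (rule L2_weighted_mono[OF F]) (simp add: \<beta>_def)
  define A where "A = (\<integral>z. (cmod (F z))\<^sup>2 * wt \<beta> z \<partial>?M)"
  define S where "S n z = (\<Sum>j<n. c j * z ^ j)" for n z
  note B = bessel_inequality[OF F\<beta> \<beta> c, folded S_def A_def N_def]
  have coeff: "(cmod (c j))\<^sup>2 * N j \<le> A" for j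
  proof -
    have "(cmod (c j))\<^sup>2 * N j \<le> (\<Sum>i<Suc j. (cmod (c i))\<^sup>2 * N i)"
      using less_imp_le[OF N] by (intro member_le_sum) auto
    also have "\<dots> \<le> A" using B(2,3)[of "Suc j"] by simp
    finally show ?thesis .
  qed
  define f where "f z = (\<Sum>n. c n * z ^ n)" for z
  have f: "(\<lambda>n. c n * z ^ n) sums f z" if z: "z \<in> unit_disk" for z
  proof -
    \<comment> \<open>With s strictly between |z| and 1, the coefficient bound and the lower bound
      on the norms give |c_j| s^j \<le> sqrt (A/C); Abel's lemma then yields absolute convergence at
      z.\<close>
    define s where "s = (1 + cmod z) / 2"
    have s: "cmod z < s" "0 \<le> s" "s < 1" using z by (auto simp: s_def)
    obtain C where C: "C > 0" "\<And>j. C * s ^ (2 * j) \<le> monomial_norm \<beta> j"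
      using monomial_norm_lower_bound[OF \<beta> s(2,3)] by metis
    have "cmod (c j) * s ^ j \<le> sqrt (A / C)" for j
    proof (rule real_le_rsqrt)
      have "(cmod (c j))\<^sup>2 * (C * s ^ (2 * j)) \<le> (cmod (c j))\<^sup>2 * N j"
        using C(2)[of j] by (intro mult_left_mono) (auto simp: N_def)
      also have "\<dots> \<le> A" by (rule coeff)
      finally show "(cmod (c j) * s ^ j)\<^sup>2 \<le> A / C"
        using C(1) by (simp add: power_mult_distrib power_mult[symmetric] field_simps)
    qed
    then have "summable (\<lambda>n. norm (c n) * cmod z ^ n)"
      by (rule Abel_lemma[OF norm_ge_zero s(1)])
    then have "summable (\<lambda>n. c n * z ^ n)"
      by (rule_tac summable_norm_cancel) (simp add: norm_mult norm_power)
    then show ?thesis unfolding f_def by (rule summable_sums)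
  qed
  have hol: "f holomorphic_on unit_disk" by (rule power_series_disk_holomorphic[OF f])
  have "integrable ?M (\<lambda>z. (cmod (f z))\<^sup>2 * wt \<beta> z)"
  proof (rule Fatou_integrable(1)[where B = A])
    show "integrable ?M (\<lambda>z. (cmod (S k z))\<^sup>2 * wt \<beta> z)" for k by (rule B(1))
    show "(\<integral>z. (cmod (S k z))\<^sup>2 * wt \<beta> z \<partial>?M) \<le> A" for k by (rule B(3))
    show "(\<lambda>k. (cmod (S k z))\<^sup>2 * wt \<beta> z) \<longlonglongrightarrow> (cmod (f z))\<^sup>2 * wt \<beta> z" if "z \<in> space ?M" for z
    proof -
      have "(\<lambda>k. S k z) \<longlonglongrightarrow> f z" using f[of z] that by (simp add: sums_def S_def)
      then show ?thesis by (intro tendsto_intros)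
    qed
  qed simp
  then have f\<beta>: "f \<in> L2_weighted \<beta>"
    using holomorphic_measurable_disk[OF hol] by (simp add: L2_weighted_iff)
  have iF: "integrable ?M (\<lambda>z. F z * complex_of_real (wt \<beta> z))"
    and i_f: "integrable ?M (\<lambda>z. f z * complex_of_real (wt \<beta> z))"
    by (rule L2_weighted_imp_integrable[OF F\<beta> \<beta>], rule L2_weighted_imp_integrable[OF f\<beta> \<beta>])
  have moment_f: "moment \<beta> f a b = (if a \<le> b then c (b - a) * complex_of_real (monomial_norm \<beta> b) else 0)" for a b
    by (rule moment_power_series[OF \<beta> f i_f])
  \<comment> \<open>For a > b both sides are 0; otherwise both equal c_(b-a) times the squared norm
    of z^b.\<close>
  have eq: "moment \<beta> F a b = moment \<beta> f a b" for a b
  proof (cases "a \<le> b")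
    case True
    define j where "j = b - a"
    have b: "b = a + j" using True by (simp add: j_def)
    have Nj: "complex_of_real (N j) \<noteq> 0" using N[of j] by simp
    have "moment \<beta> F a b * complex_of_real (N j) = moment \<beta> F 0 j * complex_of_real (N b)"
      using moment_above_diagonal[OF F \<alpha> weak, of a j] by (simp add: \<beta>_def N_def b)
    then have "moment \<beta> F a b = c j * complex_of_real (N b)"
      using Nj by (simp add: c_def field_simps)
    then show ?thesis
      using True by (simp add: moment_f j_def N_def)
  next
    case False
    then show ?thesis
      using moment_eq_0[OF F \<alpha> weak, of b a] by (simp add: moment_f flip: \<beta>_def)
  qed
  have "moment_free (\<lambda>z. F z * complex_of_real (wt \<beta> z) - f z * complex_of_real (wt \<beta> z))"
    unfolding moment_free_def
  proof (intro conjI allI)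
    show "integrable ?M (\<lambda>z. F z * complex_of_real (wt \<beta> z) - f z * complex_of_real (wt \<beta> z))"
      by (intro Bochner_Integration.integrable_diff iF i_f)
    fix a b
    have "(\<integral>z. (F z * complex_of_real (wt \<beta> z) - f z * complex_of_real (wt \<beta> z)) * (z ^ a * cnj z ^ b) \<partial>?M)
        = (\<integral>z. F z * (z ^ a * cnj z ^ b * complex_of_real (wt \<beta> z)) - f z * (z ^ a * cnj z ^ b * complex_of_real (wt \<beta> z)) \<partial>?M)"
      unfolding left_diff_distrib by (simp only: mult_ac)
    also have "\<dots> = moment \<beta> F a b - moment \<beta> f a b"
      unfolding moment_def by (intro Bochner_Integration.integral_diff integrable_moment iF i_f)
    finally show "(\<integral>z. (F z * complex_of_real (wt \<beta> z) - f z * complex_of_real (wt \<beta> z)) * (z ^ a * cnj z ^ b) \<partial>?M) = 0"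
      using eq by simp
  qed
  then have "AE z in ?M. F z * complex_of_real (wt \<beta> z) - f z * complex_of_real (wt \<beta> z) = 0"
    by (rule moment_free_AE_0)
  \<comment> \<open>The weight is positive inside the disk and can be divided out;
    \<open>AE_space\<close> supplies membership in the disk.\<close>
  then have "AE z in ?M. F z = f z"
    using AE_space
  proof eventually_elim
    case (elim z)
    then have "1 - (cmod z)\<^sup>2 > 0" by (intro weight_pos) simp
    then have "complex_of_real (wt \<beta> z) \<noteq> 0" by simp
    with elim show ?case by simp
  qed
  then show ?thesis using that hol by blast
qed

text \<open>A monomial times a cutoff is a test function, so G - g times a cutoff has vanishing
  moments and is zero almost everywhere. Countably many cutoffs suffice, since at every point of the
  disk one of them is nonzero.\<close>

lemma distr_eq_imp_AE_eq:
  assumes G: "G \<in> L2_weighted \<alpha>" and \<alpha>: "\<alpha> > -1" and g: "g holomorphic_on unit_disk"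
    and eq: "distr_eq (distr_of g) (distr_of G)"
  shows "AE z in lebesgue_on unit_disk. G z = g z"
proof -
  let ?M = "lebesgue_on unit_disk"
  have "AE z in ?M. G z * cutoff (eps k) 0 0 z - g z * cutoff (eps k) 0 0 z = 0" for k
  proof (rule moment_free_AE_0)
    have cg: "continuous_on unit_disk g" using g by (rule holomorphic_on_imp_continuous_on)
    have iG: "integrable ?M (\<lambda>z. G z * \<phi> z)" and ig: "integrable ?M (\<lambda>z. g z * \<phi> z)" if "test_function \<phi>" for \<phi>
      by (rule integrable_L2_test_function[OF G \<alpha> that], rule integrable_mult_test_function[OF cg that])
    show "moment_free (\<lambda>z. G z * cutoff (eps k) 0 0 z - g z * cutoff (eps k) 0 0 z)"
      unfolding moment_free_def
    proof (intro conjI allI)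
      show "integrable ?M (\<lambda>z. G z * cutoff (eps k) 0 0 z - g z * cutoff (eps k) 0 0 z)"
        by (intro Bochner_Integration.integrable_diff iG ig test_function_cutoff eps_pos)
      fix a b
      have t: "test_function (moncut (eps k) 0 0 a b)" by (rule test_function_moncut[OF eps_pos])
      have "(\<integral>z. (G z * cutoff (eps k) 0 0 z - g z * cutoff (eps k) 0 0 z) * (z ^ a * cnj z ^ b) \<partial>?M)
          = (\<integral>z. G z * moncut (eps k) 0 0 a b z - g z * moncut (eps k) 0 0 a b z \<partial>?M)"
        unfolding moncut_def left_diff_distrib by (simp only: mult_ac)
      also have "\<dots> = (\<integral>z. G z * moncut (eps k) 0 0 a b z \<partial>?M) - (\<integral>z. g z * moncut (eps k) 0 0 a b z \<partial>?M)"
        by (intro Bochner_Integration.integral_diff iG ig t)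
      also have "\<dots> = 0"
        using eq t by (simp add: distr_eq_def distr_of_def)
      finally show "(\<integral>z. (G z * cutoff (eps k) 0 0 z - g z * cutoff (eps k) 0 0 z) * (z ^ a * cnj z ^ b) \<partial>?M) = 0" .
    qed
  qed
  then have "AE z in ?M. \<forall>k. G z * cutoff (eps k) 0 0 z - g z * cutoff (eps k) 0 0 z = 0"
    unfolding AE_all_countable by blast
  then show ?thesis
    using AE_space
  proof eventually_elim
    case (elim z)
    then have x: "1 - (cmod z)\<^sup>2 > 0" by (intro weight_pos) simp
    have "\<forall>\<^sub>F k in sequentially. eps k < 1 - (cmod z)\<^sup>2"
      by (rule order_tendstoD(2)[OF eps_tendsto x])
    then obtain k where k: "eps k < 1 - (cmod z)\<^sup>2"
      using eventually_happens'[OF sequentially_bot] by blast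
    then have "cutoff (eps k) 0 0 z \<noteq> 0" using x by (simp add: cutoff_def bump_def)
    moreover have "G z * cutoff (eps k) 0 0 z - g z * cutoff (eps k) 0 0 z = 0" using elim(1) by blast
    ultimately show ?case by simp
  qed
qed

section \<open>The two inclusions\<close>

lemma distr_of_cong_AE:
  assumes "F \<in> borel_measurable (lebesgue_on unit_disk)" "G \<in> borel_measurable (lebesgue_on unit_disk)"
    "AE z in lebesgue_on unit_disk. F z = G z"
  shows "distr_eq (distr_of F) (distr_of G)"
  unfolding distr_eq_def distr_of_def
proof (intro allI impI integral_cong_AE)
  fix \<phi> assume "test_function \<phi>"
  then have "\<phi> \<in> borel_measurable (lebesgue_on unit_disk)"
    by (intro borel_measurable_disk borel_measurable_continuous_onI continuous_on_test_function)
  then show "(\<lambda>z. F z * \<phi> z) \<in> borel_measurable (lebesgue_on unit_disk)"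
    "(\<lambda>z. G z * \<phi> z) \<in> borel_measurable (lebesgue_on unit_disk)"
    using assms(1,2) by measurable
  show "AE z in lebesgue_on unit_disk. F z * \<phi> z = G z * \<phi> z"
    using assms(3) by eventually_elim simp
qed

lemma bergman_dirichlet_iff:
  "f \<in> bergman_dirichlet \<alpha> m \<longleftrightarrow> f holomorphic_on unit_disk \<and> (deriv ^^ m) f \<in> L2_weighted \<alpha>"
  using holomorphic_measurable_disk[OF holomorphic_higher_deriv[OF _ open_ball]]
  by (auto simp: bergman_dirichlet_def L2_weighted_def)

lemma bergman_dirichlet_subset:
  assumes "\<alpha> > -1" "f \<in> bergman_dirichlet \<alpha> m"
  shows "f \<in> Delta_domain \<alpha> m" "distr_eq (Delta_op \<alpha> (distr_of f)) (\<lambda>\<phi>. 0)"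
proof -
  have hol: "f holomorphic_on unit_disk" and fm: "(deriv ^^ m) f \<in> L2_weighted \<alpha>"
    using assms(2) by (auto simp: bergman_dirichlet_iff)
  have f: "f \<in> L2_weighted \<alpha>"
    using L2_higher_deriv_imp_L2[OF hol assms(1), of m] fm holomorphic_measurable_disk[OF hol]
    by (simp add: L2_weighted_iff)
  show weak: "distr_eq (Delta_op \<alpha> (distr_of f)) (\<lambda>\<phi>. 0)" by (rule Delta_op_holomorphic[OF hol])
  \<comment> \<open>The zero function represents the image of f under the operator.\<close>
  have "(\<lambda>_. 0) \<in> L2_weighted \<alpha>" by (simp add: L2_weighted_iff)
  moreover have "distr_of (\<lambda>_. 0) = (\<lambda>\<phi>. 0)" by (simp add: distr_of_def)
  ultimately have "distr_in_L2 \<alpha> (Delta_op \<alpha> (distr_of f))"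
    using weak unfolding distr_in_L2_def by (metis (no_types, lifting))
  moreover have "distr_in_L2 \<alpha> ((distr_dz ^^ m) (distr_of f))"
    unfolding distr_in_L2_def
    using fm distr_dz_power_holomorphic[OF hol] by (auto simp: distr_eq_def)
  ultimately show "f \<in> Delta_domain \<alpha> m" using f by (simp add: Delta_domain_def)
qed

text \<open>Once F = f almost everywhere, the m-th distributional derivative of F is the classical
  f^(m). The function G that represents it in L^(2,\<alpha>) then equals f^(m) almost everywhere, so
  the Bergman-Dirichlet integral is finite.\<close>

lemma kernel_imp_bergman_dirichlet:
  assumes \<alpha>: "\<alpha> > -1" and F: "F \<in> Delta_domain \<alpha> m" "distr_eq (Delta_op \<alpha> (distr_of F)) (\<lambda>\<phi>. 0)"
  obtains f where "f \<in> bergman_dirichlet \<alpha> m" "(F, f) \<in> ae_eq"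
proof -
  have FL: "F \<in> L2_weighted \<alpha>" and "distr_in_L2 \<alpha> ((distr_dz ^^ m) (distr_of F))"
    using F(1) by (auto simp: Delta_domain_def)
  then obtain G where G: "G \<in> L2_weighted \<alpha>" "distr_eq ((distr_dz ^^ m) (distr_of F)) (distr_of G)"
    by (auto simp: distr_in_L2_def)
  obtain f where f: "f holomorphic_on unit_disk" "AE z in lebesgue_on unit_disk. F z = f z"
    using weak_solution_imp_holomorphic[OF FL \<alpha> F(2)] .
  have Fm: "F \<in> borel_measurable (lebesgue_on unit_disk)" using FL by (simp add: L2_weighted_def)
  have hm: "(deriv ^^ m) f holomorphic_on unit_disk" by (rule holomorphic_higher_deriv[OF f(1) open_ball])
  have "distr_eq (distr_of F) (distr_of f)"
    by (rule distr_of_cong_AE[OF Fm holomorphic_measurable_disk[OF f(1)] f(2)])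
  from distr_dz_power_cong[OF this, of m] G(2)
  have "distr_eq (distr_of ((deriv ^^ m) f)) (distr_of G)"
    using distr_dz_power_holomorphic[OF f(1), of _ m] by (simp add: distr_eq_def)
  then have "AE z in lebesgue_on unit_disk. G z = (deriv ^^ m) f z"
    by (rule distr_eq_imp_AE_eq[OF G(1) \<alpha> hm])
  then have "AE z in lebesgue_on unit_disk.
      ennreal ((cmod ((deriv ^^ m) f z))\<^sup>2 * wt \<alpha> z) = ennreal ((cmod (G z))\<^sup>2 * wt \<alpha> z)"
    by eventually_elim simp
  then have "(\<integral>\<^sup>+ z. ennreal ((cmod ((deriv ^^ m) f z))\<^sup>2 * wt \<alpha> z) \<partial>lebesgue_on unit_disk) =
      (\<integral>\<^sup>+ z. ennreal ((cmod (G z))\<^sup>2 * wt \<alpha> z) \<partial>lebesgue_on unit_disk)"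
    by (rule nn_integral_cong_AE)
  then have "f \<in> bergman_dirichlet \<alpha> m"
    using f(1) G(1) by (simp add: bergman_dirichlet_def L2_weighted_def)
  moreover have "(F, f) \<in> ae_eq"
    using Fm holomorphic_measurable_disk[OF f(1)] f(2) by (simp add: ae_eq_def)
  ultimately show ?thesis using that by blast
qed

theorem proposition4p1:
  fixes \<alpha> :: real and m :: nat
  assumes "\<alpha> > -1"
  shows "bergman_dirichlet \<alpha> m // ae_eq =
    {F \<in> Delta_domain \<alpha> m. distr_eq (Delta_op \<alpha> (distr_of F)) (\<lambda>\<phi>. 0)} // ae_eq"
proof (intro equalityI subsetI)
  fix X assume "X \<in> bergman_dirichlet \<alpha> m // ae_eq"
  \<comment> \<open>Here the inclusion holds already for the representing functions.\<close>
  then show "X \<in> {F \<in> Delta_domain \<alpha> m. distr_eq (Delta_op \<alpha> (distr_of F)) (\<lambda>\<phi>. 0)} // ae_eq"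
    using bergman_dirichlet_subset[OF assms] unfolding quotient_def by blast
next
  fix X assume "X \<in> {F \<in> Delta_domain \<alpha> m. distr_eq (Delta_op \<alpha> (distr_of F)) (\<lambda>\<phi>. 0)} // ae_eq"
  then obtain F where F: "F \<in> Delta_domain \<alpha> m" "distr_eq (Delta_op \<alpha> (distr_of F)) (\<lambda>\<phi>. 0)"
    and X: "X = ae_eq `` {F}"
    by (auto simp: quotient_def)
  obtain f where f: "f \<in> bergman_dirichlet \<alpha> m" "(F, f) \<in> ae_eq"
    using kernel_imp_bergman_dirichlet[OF assms F] .
  \<comment> \<open>An element of the kernel is holomorphic only after a change on a null set, so
    its class is represented anew by f.\<close>
  have "X = ae_eq `` {f}"
    unfolding X by (rule equiv_class_eq[OF equiv_ae_eq f(2)])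
  then show "X \<in> bergman_dirichlet \<alpha> m // ae_eq"
    using f(1) by (auto intro: quotientI)
qed

end
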